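(* Let $s \in \mathbb{N}_0 = \{0,1,2,\ldots\}$ and let $f \in V_s$. Write $I_w[f] = \int_{-1}^1 w(x) f(x)\,\mathrm{d}x$. Error bounds of order $n^{-s-1}$, that is, $$I_w[f] - Q_n[f] = O(n^{-s-1}) \quad (n \to \infty),$$ hold for a very large class of weight functions and many quadrature formulas, namely whenever $w$ is an admissible weight function and, for each $n$, $Q_n$ is a positive interpolatory quadrature formula with $n$ nodes for $w$. In particular, bounds of this order hold, for example, for: (a) the Gauss and Radau formulas for all admissible weight functions $w$; (b) the Clenshaw-Curtis formulas and their close relatives, the Filippi formulas and the Polya formulas, at least for the standard weight function $w \equiv 1$; (c) the Gauss-Kronrod formulas for the ultraspherical weight functions $w_\lambda(x) = (1-x^2)^{\lambda-1/2}$ with $\lambda \in [0,1] \cup \{3\}$.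
   Context: $\operatorname{Var} g$ denotes the total variation of a function $g$ over $[-1,1]$. The function classes are $V_0 := \{ f : [-1,1] \to \mathbb{R} : \operatorname{Var} f < \infty \}$ and, for $s \in \{1,2,\ldots\}$, $V_s := \{ f : [-1,1] \to \mathbb{R} : f^{(s-1)} \text{ is absolutely continuous and } \operatorname{Var} f^{(s)} < \infty \}$. A weight function $w$ is a nonnegative integrable function on $(-1,1)$; it is called admissible here if there is $M > 0$ with $w(x) \le M(1-x^2)^{-1/2}$. A quadrature formula with $N$ nodes is a functional $Q[f] = \sum_{j=1}^N a_j f(x_j)$ with nodes $-1 \le x_1 < \cdots < x_N \le 1$ and weights $a_j \in \mathbb{R}$. It is positive if $a_j \ge 0$ for all $j$, and interpolatory for $w$ if $Q[p] = I_w[p]$ for all polynomials $p$ of degree at most $N-1$. The named formulas are all interpolatory for the weight in question: - $n$-point Gauss formula for $w$: the $n$-point formula exact for $I_w$ on all polynomials of degree at most $2n-1$. - $n$-point Radau formula for $w$: the $n$-point formula having a prescribed endpoint ($-1$ or $+1$) as a node and exact for $I_w$ on all polynomials of degree at most $2n-2$. - $n$-point Clenshaw-Curtis formula ($n \ge 2$): nodes $\cos\left(\frac{(j-1)\pi}{n-1}\right)$, $j = 1,\ldots,n$. - $n$-point Filippi formula: nodes $\cos\left(\frac{j\pi}{n+1}\right)$, $j=1,\ldots,n$ (zeros of the Chebyshev polynomial of the second kind $U_n$). - $n$-point Polya formula: nodes $\cos\left(\frac{(2j-1)\pi}{2n}\right)$, $j=1,\ldots,n$ (zeros of the Chebyshev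 polynomial of the first kind $T_n$). - Gauss-Kronrod formula with $2n+1$ nodes for $w$: the formula whose nodes are the $n$ nodes of the $n$-point Gauss formula for $w$ together with $n+1$ further nodes, chosen so that the formula is exact for $I_w$ on all polynomials of degree at most $3n+1$. *)

theory Defs
  imports "HOL-Analysis.Analysis" "HOL-Library.Landau_Symbols"
    "HOL-Computational_Algebra.Polynomial"
begin

definition total_variation :: "real \<Rightarrow> real \<Rightarrow> (real \<Rightarrow> real) \<Rightarrow> ereal" where
  "total_variation a b g =
     (SUP ts \<in> {ts. sorted ts \<and> set ts \<subseteq> {a..b}}.
        ereal (\<Sum>i<length ts - 1. \<bar>g (ts ! Suc i) - g (ts ! i)\<bar>))"

text \<open>A pair \<open>(u, v)\<close> in \<open>P\<close> stands for the interval with endpoints \<open>u < v\<close>.\<close>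

definition absolutely_continuous_on_Icc :: "real \<Rightarrow> real \<Rightarrow> (real \<Rightarrow> real) \<Rightarrow> bool" where
  "absolutely_continuous_on_Icc a b g \<longleftrightarrow>
     (\<forall>\<epsilon>>0. \<exists>\<delta>>0. \<forall>P :: (real \<times> real) set.
        finite P \<longrightarrow>
        (\<forall>(u, v)\<in>P. a \<le> u \<and> u < v \<and> v \<le> b) \<longrightarrow>
        pairwise (\<lambda>I J. disjnt {fst I<..<snd I} {fst J<..<snd J}) P \<longrightarrow>
        (\<Sum>(u, v)\<in>P. v - u) < \<delta> \<longrightarrow>
        (\<Sum>(u, v)\<in>P. \<bar>g v - g u\<bar>) < \<epsilon>)"

text \<open>
  Only the values of \<open>f\<close> on \<open>[-1,1]\<close> matter; \<open>F k\<close> is the \<open>k\<close>-th derivative of \<open>f\<close>, one-sided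
  at the endpoints.  For \<open>s \<ge> 1\<close>, absolute continuity of the \<open>(s - 1)\<close>-st derivative yields the
  \<open>s\<close>-th one only almost everywhere, so finite variation is required of some representative of it.
\<close>

definition V :: "nat \<Rightarrow> (real \<Rightarrow> real) set" where
  "V s = {f. if s = 0 then total_variation (-1) 1 f < \<infinity>
     else \<exists>F :: nat \<Rightarrow> real \<Rightarrow> real.
       (\<forall>x\<in>{-1..1}. F 0 x = f x) \<and>
       (\<forall>k. Suc k < s \<longrightarrow>
          (\<forall>x\<in>{-1..1}. (F k has_real_derivative F (Suc k) x) (at x within {-1..1}))) \<and>
       absolutely_continuous_on_Icc (-1) 1 (F (s - 1)) \<and>
       (AE x in lebesgue. x \<in> {-1<..<1} \<longrightarrow> (F (s - 1) has_real_derivative F s x) (at x)) \<and>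
       total_variation (-1) 1 (F s) < \<infinity>}"

definition weight_function :: "(real \<Rightarrow> real) \<Rightarrow> bool" where
  "weight_function w \<longleftrightarrow>
     (\<forall>x\<in>{-1<..<1}. 0 \<le> w x) \<and> set_integrable lebesgue {-1<..<1} w"

definition admissible :: "(real \<Rightarrow> real) \<Rightarrow> bool" where
  "admissible w \<longleftrightarrow> weight_function w \<and>
     (\<exists>M>0. \<forall>x\<in>{-1<..<1}. w x \<le> M * (1 - x\<^sup>2) powr (-1/2))"

definition weighted_integral :: "(real \<Rightarrow> real) \<Rightarrow> (real \<Rightarrow> real) \<Rightarrow> real" where
  "weighted_integral w f = (LINT x:{-1<..<1}|lebesgue. w x * f x)"

text \<open>Only the nodes and coefficients with index in \<open>{1..num_nodes Q}\<close> are meaningful.\<close>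

record quadrature =
  num_nodes :: nat
  node :: "nat \<Rightarrow> real"
  coefficient :: "nat \<Rightarrow> real"

definition node_set :: "quadrature \<Rightarrow> real set" where
  "node_set Q = node Q ` {1..num_nodes Q}"

definition quadrature_formula :: "nat \<Rightarrow> quadrature \<Rightarrow> bool" where
  "quadrature_formula N Q \<longleftrightarrow>
     num_nodes Q = N \<and> strict_mono_on {1..N} (node Q) \<and> node_set Q \<subseteq> {-1..1}"

definition apply_quadrature :: "quadrature \<Rightarrow> (real \<Rightarrow> real) \<Rightarrow> real" where
  "apply_quadrature Q f = (\<Sum>j=1..num_nodes Q. coefficient Q j * f (node Q j))"

definition positive_quadrature :: "quadrature \<Rightarrow> bool" where
  "positive_quadrature Q \<longleftrightarrow> (\<forall>j\<in>{1..num_nodes Q}. 0 \<le> coefficient Q j)"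

definition exact_to_degree :: "(real \<Rightarrow> real) \<Rightarrow> nat \<Rightarrow> quadrature \<Rightarrow> bool" where
  "exact_to_degree w d Q \<longleftrightarrow>
     (\<forall>p :: real poly. degree p \<le> d \<longrightarrow> apply_quadrature Q (poly p) = weighted_integral w (poly p))"

text \<open>
  The degrees below use truncated subtraction on \<^typ>\<open>nat\<close>, so all the following notions are
  meant for a positive number of nodes only.
\<close>

definition interpolatory :: "(real \<Rightarrow> real) \<Rightarrow> quadrature \<Rightarrow> bool" where
  "interpolatory w Q \<longleftrightarrow> exact_to_degree w (num_nodes Q - 1) Q"

definition gauss_formula :: "(real \<Rightarrow> real) \<Rightarrow> nat \<Rightarrow> quadrature \<Rightarrow> bool" where
  "gauss_formula w n Q \<longleftrightarrow> quadrature_formula n Q \<and> exact_to_degree w (2 * n - 1) Q"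

definition radau_formula :: "real \<Rightarrow> (real \<Rightarrow> real) \<Rightarrow> nat \<Rightarrow> quadrature \<Rightarrow> bool" where
  "radau_formula e w n Q \<longleftrightarrow>
     quadrature_formula n Q \<and> e \<in> node_set Q \<and> exact_to_degree w (2 * n - 2) Q"

definition clenshaw_curtis_formula :: "(real \<Rightarrow> real) \<Rightarrow> nat \<Rightarrow> quadrature \<Rightarrow> bool" where
  "clenshaw_curtis_formula w n Q \<longleftrightarrow>
     quadrature_formula n Q \<and> interpolatory w Q \<and>
     node_set Q = (\<lambda>j. cos ((real j - 1) * pi / (real n - 1))) ` {1..n}"

definition filippi_formula :: "(real \<Rightarrow> real) \<Rightarrow> nat \<Rightarrow> quadrature \<Rightarrow> bool" where
  "filippi_formula w n Q \<longleftrightarrow>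
     quadrature_formula n Q \<and> interpolatory w Q \<and>
     node_set Q = (\<lambda>j. cos (real j * pi / (real n + 1))) ` {1..n}"

definition polya_formula :: "(real \<Rightarrow> real) \<Rightarrow> nat \<Rightarrow> quadrature \<Rightarrow> bool" where
  "polya_formula w n Q \<longleftrightarrow>
     quadrature_formula n Q \<and> interpolatory w Q \<and>
     node_set Q = (\<lambda>j. cos ((2 * real j - 1) * pi / (2 * real n))) ` {1..n}"

definition gauss_kronrod_formula :: "(real \<Rightarrow> real) \<Rightarrow> nat \<Rightarrow> quadrature \<Rightarrow> bool" where
  "gauss_kronrod_formula w n Q \<longleftrightarrow>
     quadrature_formula (2 * n + 1) Q \<and>
     (\<exists>G. gauss_formula w n G \<and> node_set G \<subseteq> node_set Q) \<and>
     exact_to_degree w (3 * n + 1) Q"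

definition ultraspherical_weight :: "real \<Rightarrow> real \<Rightarrow> real" where
  "ultraspherical_weight l x = (1 - x\<^sup>2) powr (l - 1/2)"

definition error_order ::
    "(real \<Rightarrow> real) \<Rightarrow> (nat \<Rightarrow> quadrature) \<Rightarrow> (real \<Rightarrow> real) \<Rightarrow> nat \<Rightarrow> bool" where
  "error_order w Q f s \<longleftrightarrow>
     (\<lambda>n. weighted_integral w f - apply_quadrature (Q n) f) \<in> O(\<lambda>n. 1 / real n ^ (s + 1))"

end

theory Submission
  imports Defs "HOL-Real_Asymp.Real_Asymp"
begin

text \<open>
  Put \<open>x = cos t\<close> and cut \<open>[0, \<pi>]\<close> into \<open>N\<close> arcs of length \<open>\<pi> / N\<close>.  Both the weighted Lebesgue measure
  and the absolute weights of the quadrature formula have mass \<open>O(1 / N)\<close> on every arc: for the latter,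
  test the formula on a squared Fejer kernel of degree below \<open>2 N\<close> centred at the arc.  Hence the error is
  at most \<open>O(1 / N)\<close> times the sum over the arcs of \<open>sup \<bar>f - p\<bar>\<close>, for any polynomial \<open>p\<close> of degree
  comparable with \<open>N\<close>.  A discrete convolution with the same kernel makes that sum \<open>O(Var f)\<close>, and
  inductively \<open>O(N\<^sup>-\<^sup>s)\<close> for \<open>f \<in> V s\<close>: if \<open>q\<close> is good for \<open>f'\<close>, then \<open>f - \<integral>q\<close> has variation at most
  \<open>\<pi> / N\<close> times the sum for \<open>f' - q\<close>.

  Gauss and Radau weights are integrals of squared Lagrange polynomials; the weights of the
  Clenshaw-Curtis, Filippi and Polya formulas are integrals of explicit trigonometric sums.  The Kronrod
  nodes are zeros of the Stieltjes polynomial, whose Chebyshev coefficients are those of the reciprocal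
  of a hypergeometric series \<open>f\<close>.  At a Gauss node, \<open>f (e\<^sup>2\<^sup>i\<^sup>t)\<close> times a power of \<open>e\<^sup>i\<^sup>t\<close> is real, which yields
  the sign of the Stieltjes polynomial there (Szego's argument via Kaluza's theorem for \<open>\<lambda> \<le> 1\<close>, explicit
  estimates for \<open>\<lambda> = 3\<close>), hence interlacing, positivity at the other nodes, and a bound at the Gauss nodes.
\<close>

section \<open>Fejer kernels and arcs\<close>

text \<open>A function in \<open>V 0\<close> may jump, so no polynomial need be uniformly close to
  it; what stays bounded is the sum of the local errors over the arcs, since a jump affects mainly
  nearby arcs. This sum is a discrete L1 norm in the angle, and pairing it with arc masses O(1 / N)
  gives the order s + 1 instead of s. The kernel is squared because fourth-power decay splits into
  two quadratic decays, each summable: one for the sampling points, one for the arcs in between. The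
  convolution is discrete so that only point values of f enter. Positivity of a formula is used only
  through \<open>dominated\<close>, which tolerates a constant factor. This tolerance, and the
  freedom to take n large, make the parameter 3 accessible. There the hypergeometric series breaks
  off after its quadratic term and the first coefficient of its reciprocal is positive, so the sign
  pattern of Kaluza's theorem fails; the truncated reciprocal is controlled only at the Gauss nodes,
  with the help of the equation that they satisfy.\<close>

lemma sin_ge_jordan:
  fixes x :: real
  assumes "0 \<le> x" "x \<le> pi / 2"
  shows "2 * x / pi \<le> sin x"
proof -
  have "convex_on {0..pi} (\<lambda>x. - sin x)"
  proof (rule f''_ge0_imp_convex)
    show "convex {0..pi}" by simp
    show "((\<lambda>x. - sin x) has_real_derivative - cos x) (at x)" for x :: real
      by (auto intro!: derivative_eq_intros)
    show "((\<lambda>x. - cos x) has_real_derivative sin x) (at x)" for x :: real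
      by (auto intro!: derivative_eq_intros)
    show "0 \<le> sin x" if "x \<in> {0..pi}" for x :: real
      using that by (auto intro: sin_ge_zero)
  qed
  from convex_onD[OF this, of "2 * x / pi" 0 "pi / 2"] show ?thesis
    using assms by (auto simp: field_simps)
qed

section \<open>Even trigonometric polynomials and Chebyshev polynomials of the first kind\<close>

definition cosine_poly :: "nat \<Rightarrow> (real \<Rightarrow> real) \<Rightarrow> bool" where
  "cosine_poly D g \<longleftrightarrow> (\<exists>c. \<forall>t. g t = (\<Sum>l\<le>D. c l * cos (real l * t)))"

lemma cosine_poly_cos:
  assumes "l \<le> D"
  shows "cosine_poly D (\<lambda>t. cos (real l * t))"
  unfolding cosine_poly_def
proof (intro exI allI)
  fix t
  have "(\<Sum>m\<le>D. of_bool (m = l) * cos (real m * t)) = (\<Sum>m\<in>{l}. cos (real m * t))"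
    using assms by (intro sum.mono_neutral_cong_right) auto
  thus "cos (real l * t) = (\<Sum>m\<le>D. of_bool (m = l) * cos (real m * t))" by simp
qed

lemma cosine_poly_cos_diff:
  assumes "k \<le> D" "l \<le> D"
  shows "cosine_poly D (\<lambda>t. cos ((real k - real l) * t))"
proof (cases "k \<ge> l")
  case True
  thus ?thesis using cosine_poly_cos[of "k - l" D] assms by (simp add: of_nat_diff)
next
  case False
  hence "cos ((real k - real l) * t) = cos (real (l - k) * t)" for t
    using cos_minus[of "(real k - real l) * t"] by (simp add: of_nat_diff left_diff_distrib)
  thus ?thesis using cosine_poly_cos[of "l - k" D] assms by simp
qed

lemma cosine_poly_cmult: "cosine_poly D g \<Longrightarrow> cosine_poly D (\<lambda>t. a * g t)"
  unfolding cosine_poly_def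
proof (elim exE)
  fix c assume "\<forall>t. g t = (\<Sum>l\<le>D. c l * cos (real l * t))"
  thus "\<exists>c. \<forall>t. a * g t = (\<Sum>l\<le>D. c l * cos (real l * t))"
    by (intro exI[of _ "\<lambda>l. a * c l"]) (simp add: sum_distrib_left mult.assoc)
qed

lemma cosine_poly_add:
  assumes "cosine_poly D g" "cosine_poly D h"
  shows "cosine_poly D (\<lambda>t. g t + h t)"
proof -
  obtain c d where "\<forall>t. g t = (\<Sum>l\<le>D. c l * cos (real l * t))" "\<forall>t. h t = (\<Sum>l\<le>D. d l * cos (real l * t))"
    using assms unfolding cosine_poly_def by blast
  thus ?thesis unfolding cosine_poly_def
    by (intro exI[of _ "\<lambda>l. c l + d l"]) (simp add: sum.distrib distrib_right)
qed

lemma cosine_poly_sum: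
  assumes "\<And>i. i \<in> A \<Longrightarrow> cosine_poly D (g i)"
  shows "cosine_poly D (\<lambda>t. \<Sum>i\<in>A. g i t)"
proof (cases "finite A")
  case True
  thus ?thesis using assms
  proof induction
    case empty
    show ?case unfolding cosine_poly_def by (intro exI[of _ "\<lambda>_. 0"]) simp
  next
    case (insert x F)
    thus ?case by (auto intro: cosine_poly_add)
  qed
next
  case False
  thus ?thesis unfolding cosine_poly_def by (intro exI[of _ "\<lambda>_. 0"]) simp
qed

lemma cosine_poly_mult:
  assumes "cosine_poly D g" "cosine_poly E h"
  shows "cosine_poly (D + E) (\<lambda>t. g t * h t)"
proof -
  obtain c where c: "\<And>t. g t = (\<Sum>l\<le>D. c l * cos (real l * t))"
    using assms unfolding cosine_poly_def by blast
  obtain d where d: "\<And>t. h t = (\<Sum>l\<le>E. d l * cos (real l * t))"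
    using assms unfolding cosine_poly_def by blast
  have eq: "(\<lambda>t. g t * h t) = (\<lambda>t. \<Sum>k\<le>D. \<Sum>l\<le>E. (c k * d l / 2) *
          (cos ((real k - real l) * t) + cos (real (k + l) * t)))"
    unfolding c d sum_product
    by (intro ext sum.cong refl) (simp add: cos_times_cos algebra_simps)
  show ?thesis unfolding eq
    by (intro cosine_poly_sum cosine_poly_cmult cosine_poly_add cosine_poly_cos_diff cosine_poly_cos) auto
qed

fun cheb_T :: "nat \<Rightarrow> real poly" where
  "cheb_T 0 = 1"
| "cheb_T (Suc 0) = [:0, 1:]"
| "cheb_T (Suc (Suc n)) = [:0, 2:] * cheb_T (Suc n) - cheb_T n"

lemma poly_cheb_T_cos: "poly (cheb_T n) (cos t) = cos (real n * t)"
proof (induction n rule: cheb_T.induct)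
  case (3 n)
  have "cos (real (Suc (Suc n)) * t) = 2 * cos t * cos (real (Suc n) * t) - cos (real n * t)"
    using cos_add[of "real (Suc n) * t" t] cos_diff[of "real (Suc n) * t" t]
    by (simp add: algebra_simps)
  with 3 show ?case by simp
qed auto

lemma degree_cheb_T_le: "degree (cheb_T n) \<le> n"
proof (induction n rule: cheb_T.induct)
  case (3 n)
  have "degree ([:0, 2:] * cheb_T (Suc n)) \<le> Suc (Suc n)"
    by (rule order.trans[OF degree_mult_le]) (use 3 in auto)
  with 3 show ?case by (auto intro!: degree_diff_le)
qed auto

lemma degree_sum_smult_cheb_T_le: "degree (\<Sum>l\<le>D. smult (c l) (cheb_T l)) \<le> D"
  by (intro degree_sum_le) (auto intro: order.trans[OF degree_smult_le] order.trans[OF degree_cheb_T_le])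

text \<open>N times the classical Fejer kernel: off the multiples of 2 pi it is the quotient of the
  squared sines of N t / 2 and t / 2.\<close>

definition fejer :: "nat \<Rightarrow> real \<Rightarrow> real" where
  "fejer N t = (cmod (\<Sum>k<N. cis (real k * t)))\<^sup>2"

lemma fejer_nonneg: "0 \<le> fejer N t"
  by (simp add: fejer_def)

lemma fejer_eq_sum_cos: "fejer N t = (\<Sum>k<N. \<Sum>l<N. cos ((real k - real l) * t))"
  unfolding fejer_def cmod_power2
  by (simp add: power2_eq_square sum_product sum.distrib [symmetric] cos_diff left_diff_distrib)

lemma cosine_poly_fejer:
  assumes "N \<ge> 1"
  shows "cosine_poly (N - 1) (fejer N)"
proof -
  have eq: "fejer N = (\<lambda>t. \<Sum>k<N. \<Sum>l<N. cos ((real k - real l) * t))"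
    by (rule ext) (rule fejer_eq_sum_cos)
  show ?thesis unfolding eq
    by (intro cosine_poly_sum cosine_poly_cos_diff) auto
qed

lemma cmod_one_minus_cis: "(cmod (1 - cis t))\<^sup>2 = 4 * (sin (t / 2))\<^sup>2"
proof -
  have "(cmod (1 - cis t))\<^sup>2 = 2 - 2 * cos t"
    using sin_cos_squared_add[of t]
    by (simp add: cmod_power2 power2_diff)
  also have "\<dots> = 4 * (sin (t / 2))\<^sup>2"
    using cos_double_sin[of "t / 2"] by simp
  finally show ?thesis .
qed

lemma fejer_mult_sin: "fejer N t * (sin (t / 2))\<^sup>2 = (sin (real N * t / 2))\<^sup>2"
proof -
  have "(1 - cis t) * (\<Sum>k<N. cis (real k * t)) = 1 - cis (real N * t)"
    using one_diff_power_eq[of "cis t" N] by (simp add: Complex.DeMoivre)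
  hence "(cmod (1 - cis t))\<^sup>2 * fejer N t = (cmod (1 - cis (real N * t)))\<^sup>2"
    unfolding fejer_def by (metis norm_mult power_mult_distrib)
  thus ?thesis by (simp add: cmod_one_minus_cis mult.commute)
qed

lemma fejer_le: "fejer N t \<le> (real N)\<^sup>2"
proof -
  have "cmod (\<Sum>k<N. cis (real k * t)) \<le> (\<Sum>k<N. 1)"
    by (rule sum_norm_le) simp
  thus ?thesis unfolding fejer_def by (intro power_mono) auto
qed

lemma fejer_ge:
  assumes "\<bar>t\<bar> \<le> pi / (2 * real N)"
  shows "(real N)\<^sup>2 / 2 \<le> fejer N t"
proof -
  \<comment> \<open>Shifting by the mean frequency m leaves the modulus of the sum unchanged and
    brings every phase within pi / 4 of zero, so that no cancellation occurs.\<close>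
  define m where "m = (real N - 1) / 2"
  have "real N * (sqrt 2 / 2) = (\<Sum>k<N. cos (pi / 4))"
    by (simp add: cos_45)
  also have "\<dots> \<le> (\<Sum>k<N. cos ((real k - m) * t))"
  proof (rule sum_mono)
    fix k assume k: "k \<in> {..<N}"
    have "\<bar>real k - m\<bar> \<le> real N / 2"
      using k unfolding m_def abs_le_iff by (auto simp: field_simps)
    hence "\<bar>real k - m\<bar> * \<bar>t\<bar> \<le> (real N / 2) * (pi / (2 * real N))"
      using assms by (intro mult_mono) auto
    also have "\<dots> = pi / 4" using k by simp
    finally have *: "\<bar>(real k - m) * t\<bar> \<le> pi / 4" by (simp add: abs_mult)
    have "cos (pi / 4) \<le> cos \<bar>(real k - m) * t\<bar>"
      by (rule cos_monotone_0_pi_le) (use * pi_gt_zero in \<open>auto simp del: pi_gt_zero\<close>)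
    thus "cos (pi / 4) \<le> cos ((real k - m) * t)" by simp
  qed
  also have "\<dots> = Re (cis (- m * t) * (\<Sum>k<N. cis (real k * t)))"
    by (simp add: sum_distrib_left cis_mult algebra_simps)
  also have "\<dots> \<le> cmod (cis (- m * t) * (\<Sum>k<N. cis (real k * t)))"
    by (rule complex_Re_le_cmod)
  also have "\<dots> = cmod (\<Sum>k<N. cis (real k * t))"
    by (simp add: norm_mult)
  finally have "(real N * (sqrt 2 / 2))\<^sup>2 \<le> fejer N t"
    unfolding fejer_def by (intro power_mono) auto
  thus ?thesis by (simp add: power_mult_distrib power_divide)
qed

text \<open>The angular midpoint of arc i. The points \<open>cos (tau N i)\<close> are the zeros of
  \<open>cheb_T N\<close>, which is the source of the discrete orthogonality in
  \<open>sum_cos_tau\<close>.\<close>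

definition tau :: "nat \<Rightarrow> nat \<Rightarrow> real" where
  "tau N i = (2 * real i + 1) * pi / (2 * real N)"

definition cos_arc :: "nat \<Rightarrow> nat \<Rightarrow> real set" where
  "cos_arc N k = {cos (real (Suc k) * pi / real N)..cos (real k * pi / real N)}"

lemma tau_bounds:
  assumes "i < N"
  shows "real i * pi / N \<le> tau N i" "tau N i \<le> real (Suc i) * pi / N" "0 \<le> tau N i" "tau N i \<le> pi"
proof -
  show a: "real i * pi / N \<le> tau N i" "tau N i \<le> real (Suc i) * pi / N"
    using assms by (auto simp: tau_def field_simps)
  show "0 \<le> tau N i" by (simp add: tau_def)
  have "real (Suc i) * pi \<le> real N * pi" using assms by (intro mult_right_mono) auto
  hence "real (Suc i) * pi / N \<le> pi" using assms by (simp add: field_simps)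
  with a show "tau N i \<le> pi" by linarith
qed

lemma arc_angle:
  assumes "x \<in> cos_arc N k" "k < N"
  obtains t where "x = cos t" "real k * pi / N \<le> t" "t \<le> real (Suc k) * pi / N" "0 \<le> t" "t \<le> pi"
proof
  have N: "real N > 0" using assms by simp
  have le: "real (Suc k) * pi / N \<le> pi"
    using assms mult_right_mono[of "real (Suc k)" "real N" pi] by (simp add: field_simps)
  have le': "real k * pi / N \<le> real (Suc k) * pi / N" using N by (simp add: field_simps)
  have x1: "cos (real (Suc k) * pi / N) \<le> x" "x \<le> cos (real k * pi / N)"
    using assms by (auto simp: cos_arc_def)
  have x: "-1 \<le> x" "x \<le> 1" using x1 cos_ge_minus_one cos_le_one order.trans by blast+
  show "x = cos (arccos x)" using x by simp
  have "arccos (cos (real k * pi / N)) = real k * pi / N"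
    using le le' by (intro arccos_cos) auto
  moreover have "arccos (cos (real k * pi / N)) \<le> arccos x"
    using x1 x by (intro arccos_le_arccos) auto
  ultimately show "real k * pi / N \<le> arccos x" by simp
  have "arccos (cos (real (Suc k) * pi / N)) = real (Suc k) * pi / N"
    using le by (intro arccos_cos) auto
  moreover have "arccos x \<le> arccos (cos (real (Suc k) * pi / N))"
    using x1 x by (intro arccos_le_arccos) auto
  ultimately show "arccos x \<le> real (Suc k) * pi / N" by simp
  show "0 \<le> arccos x" "arccos x \<le> pi" using x by (auto intro: arccos_lbound arccos_ubound)
qed

lemma arc_subset: "cos_arc N k \<subseteq> {-1..1}"
proof
  fix x assume "x \<in> cos_arc N k"
  hence "cos (real (Suc k) * pi / N) \<le> x" "x \<le> cos (real k * pi / N)"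
    by (auto simp: cos_arc_def)
  thus "x \<in> {-1..1}"
    using cos_ge_minus_one[of "real (Suc k) * pi / N"] cos_le_one[of "real k * pi / N"]
    by (auto simp del: cos_ge_minus_one cos_le_one)
qed

lemma cos_tau_in_arc: "i < N \<Longrightarrow> cos (tau N i) \<in> cos_arc N i"
  using tau_bounds[of i N] mult_right_mono[of "real (Suc i)" "real N" pi]
  by (auto simp: cos_arc_def field_simps intro!: cos_monotone_0_pi_le)

lemma arc_cover:
  assumes "x \<in> {-1..1}" "N \<ge> 1"
  obtains k where "k < N" "x \<in> cos_arc N k"
proof -
  define t where "t = arccos x"
  have t: "0 \<le> t" "t \<le> pi" "x = cos t"
    using assms by (auto simp: t_def arccos_lbound arccos_ubound)
  \<comment> \<open>The minimum with \<open>N - 1\<close> is for t = pi, where the quotient is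
    exactly N.\<close>
  define k where "k = min (N - 1) (nat \<lfloor>t * N / pi\<rfloor>)"
  have k: "k < N" using assms by (auto simp: k_def)
  have f: "real (nat \<lfloor>t * N / pi\<rfloor>) = of_int \<lfloor>t * N / pi\<rfloor>" using t by simp
  have "real k \<le> real (nat \<lfloor>t * N / pi\<rfloor>)" by (simp add: k_def)
  hence "real k \<le> t * N / pi"
    using f of_int_floor_le[of "t * N / pi"] by linarith
  hence 1: "real k * pi / N \<le> t" using assms by (simp add: field_simps)
  have 2: "t \<le> real (Suc k) * pi / N"
  proof (cases "k = N - 1")
    case True
    hence "real (Suc k) = real N" using assms by simp
    thus ?thesis using t assms by simp
  next
    case False
    hence "k = nat \<lfloor>t * N / pi\<rfloor>" by (auto simp: k_def min_def split: if_splits)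
    hence "t * N / pi \<le> real (Suc k)" using f by simp linarith
    thus ?thesis using assms by (simp add: field_simps)
  qed
  have "x \<in> cos_arc N k"
    unfolding cos_arc_def \<open>x = cos t\<close> using 1 2 t k mult_right_mono[of "real (Suc k)" "real N" pi]
    by (auto simp: field_simps intro!: cos_monotone_0_pi_le)
  with k show thesis by (rule that)
qed

lemma arc_subset_cos_diff_le:
  assumes "x \<in> cos_arc N k" "y \<in> cos_arc N k" "k < N"
  shows "\<bar>x - y\<bar> \<le> pi / N"
proof -
  have *: "\<bar>cos a - cos b\<bar> \<le> \<bar>a - b\<bar>" for a b :: real
    using field_differentiable_bound[of UNIV cos "\<lambda>x. - sin x" 1 a b]
    by (auto intro!: derivative_eq_intros)
  have "\<bar>x - y\<bar> \<le> \<bar>cos (real k * pi / N) - cos (real (Suc k) * pi / N)\<bar>"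
    using assms by (auto simp: cos_arc_def)
  also have "\<dots> \<le> \<bar>real k * pi / N - real (Suc k) * pi / N\<bar>" by (rule *)
  also have "real k * pi / real N - real (Suc k) * pi / real N = - (pi / N)"
    by (simp add: diff_divide_distrib[symmetric] algebra_simps)
  finally show ?thesis by simp
qed

text \<open>Multiplication by 2 sin a makes the sum telescope, and the end term is sin (l pi) = 0.
  The range l < 2 N keeps a below pi and covers the degree 2 N - 2 of the squared kernel.\<close>

lemma sum_cos_tau:
  assumes "0 < l" "l < 2 * N"
  shows "(\<Sum>i<N. cos (real l * tau N i)) = 0"
proof -
  define a where "a = real l * pi / (2 * real N)"
  have a: "0 < a" "a < pi" using assms by (auto simp: a_def field_simps)
  have "2 * sin a * (\<Sum>i<N. cos (real l * tau N i)) = (\<Sum>i<N. sin (2 * real (Suc i) * a) - sin (2 * real i * a))"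
    unfolding sum_distrib_left
  proof (rule sum.cong[OF refl])
    fix i
    have "real l * tau N i = (2 * real i + 1) * a" by (simp add: tau_def a_def)
    moreover have "sin (2 * real (Suc i) * a) = sin ((2 * real i + 1) * a + a)"
         "sin (2 * real i * a) = sin ((2 * real i + 1) * a - a)"
      by (simp_all add: algebra_simps)
    ultimately show "2 * sin a * cos (real l * tau N i) = sin (2 * real (Suc i) * a) - sin (2 * real i * a)"
      by (simp only: sin_add sin_diff) simp
  qed
  also have "\<dots> = sin (2 * real N * a)"
    by (subst sum_lessThan_telescope) simp
  also have "2 * real N * a = real l * pi" using assms by (simp add: a_def)
  also have "sin (real l * pi) = 0" by simp
  finally show ?thesis using sin_gt_zero[OF a] by simp
qed

text \<open>The squared Fejer kernel centred at \<open>\<tau>\<^sub>i\<close>, made even and written in the variable \<open>cos t\<close>.\<close>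

lemma kernel_poly:
  assumes N: "N \<ge> 1"
  obtains P :: "nat \<Rightarrow> real poly" and S :: real where
    "\<And>i. degree (P i) \<le> 2 * N - 2"
    "\<And>i t. poly (P i) (cos t) = (fejer N (t - tau N i))\<^sup>2 + (fejer N (t + tau N i))\<^sup>2"
    "\<And>x. (\<Sum>i<N. poly (P i) x) = S" "S \<ge> real N ^ 4"
proof -
  have "cosine_poly ((N - 1) + (N - 1)) (\<lambda>t. fejer N t * fejer N t)"
    using N by (intro cosine_poly_mult cosine_poly_fejer)
  moreover have "(N - 1) + (N - 1) = 2 * N - 2" by simp
  ultimately have "cosine_poly (2 * N - 2) (\<lambda>t. (fejer N t)\<^sup>2)"
    by (simp add: power2_eq_square)
  then obtain c where c: "\<And>t. (fejer N t)\<^sup>2 = (\<Sum>l\<le>2*N-2. c l * cos (real l * t))"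
    unfolding cosine_poly_def by blast
  define P where "P = (\<lambda>i. \<Sum>l\<le>2*N-2. smult (2 * c l * cos (real l * tau N i)) (cheb_T l))"
  define S where "S = 2 * c 0 * N"
  have deg: "degree (P i) \<le> 2 * N - 2" for i
    unfolding P_def by (rule degree_sum_smult_cheb_T_le)
  have P: "poly (P i) (cos t) = (fejer N (t - tau N i))\<^sup>2 + (fejer N (t + tau N i))\<^sup>2" for i t
    unfolding P_def c poly_sum poly_smult poly_cheb_T_cos sum.distrib[symmetric]
    by (intro sum.cong refl) (simp add: cos_add cos_diff algebra_simps)
  \<comment> \<open>Summed over the midpoints every frequency except zero cancels, so the kernels
    add up to a constant.\<close>
  have "(\<Sum>i<N. P i) = (\<Sum>l\<le>2*N-2. smult (2 * c l * (\<Sum>i<N. cos (real l * tau N i))) (cheb_T l))"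
    unfolding P_def by (subst sum.swap) (simp add: sum_distrib_left smult_sum)
  also have "\<dots> = (\<Sum>l\<in>{0}. smult (2 * c l * (\<Sum>i<N. cos (real l * tau N i))) (cheb_T l))"
  proof (rule sum.mono_neutral_right)
    show "\<forall>l\<in>{..2*N-2} - {0}. smult (2 * c l * (\<Sum>i<N. cos (real l * tau N i))) (cheb_T l) = 0"
    proof
      fix l assume l: "l \<in> {..2*N-2} - {0}"
      hence "(\<Sum>i<N. cos (real l * tau N i)) = 0" using N by (intro sum_cos_tau) auto
      thus "smult (2 * c l * (\<Sum>i<N. cos (real l * tau N i))) (cheb_T l) = 0" by simp
    qed
  qed auto
  also have "\<dots> = [:S:]" by (simp add: S_def one_pCons)
  finally have sumP: "(\<Sum>i<N. P i) = [:S:]" .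
  have S: "(\<Sum>i<N. poly (P i) x) = S" for x
    using arg_cong[OF sumP, of "\<lambda>p. poly p x"] by (simp add: poly_sum)
  \<comment> \<open>The constant S is bounded below by its value at the midpoint of arc 0, where the
    kernel of that arc alone contributes N^4.\<close>
  have "fejer N 0 = (real N)\<^sup>2" by (simp add: fejer_def)
  hence "real N ^ 4 \<le> poly (P 0) (cos (tau N 0))" by (simp add: P power2_eq_square power4_eq_xxxx)
  also have "\<dots> \<le> (\<Sum>i<N. poly (P i) (cos (tau N 0)))"
    using N by (intro member_le_sum) (auto simp: P)
  finally have "real N ^ 4 \<le> S" by (simp only: S)
  with deg P S show thesis by (rule that)
qed

text \<open>For arcs at distance d >= 1, Jordan's inequality makes the sine in the denominator at
  least d / (2 N), so the kernel is at most 4 N^2 / d^2 <= 16 N^2 / (1 + d)^2; for d = 0 the trivial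
  bound N^2 serves. Squaring gives 256, and the two mirror images give 512.\<close>

lemma kernel_decay:
  assumes "i < N" "k < N" "real k * pi / N \<le> t" "t \<le> real (Suc k) * pi / N"
  shows "(fejer N (t - tau N i))\<^sup>2 + (fejer N (t + tau N i))\<^sup>2 \<le> 512 * real N ^ 4 / (1 + \<bar>real i - real k\<bar>) ^ 4"
proof -
  define d where "d = \<bar>real i - real k\<bar>"
  define u where "u = \<bar>t - tau N i\<bar>"
  have N: "real N > 0" using assms by simp
  have leN: "real (Suc k) * pi / N \<le> pi"
    using assms mult_right_mono[of "real (Suc k)" "real N" pi] by (simp add: field_simps)
  have t: "0 \<le> t" "t \<le> pi"
    using assms(3,4) leN by (auto intro: order.trans[rotated])
  note tau = tau_bounds[OF assms(1)]
  have key: "fejer N s \<le> 16 * (real N)\<^sup>2 / (1 + d)\<^sup>2"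
    if s: "(sin (u / 2))\<^sup>2 \<le> (sin (s / 2))\<^sup>2" for s
  proof (cases "d = 0")
    case True
    have "(real N)\<^sup>2 \<le> 16 * (real N)\<^sup>2" by simp
    with fejer_le[of N s] have "fejer N s \<le> 16 * (real N)\<^sup>2" by linarith
    thus ?thesis using True by simp
  next
    case False
    hence "i \<noteq> k" by (auto simp: d_def)
    hence d1: "1 \<le> d" by (auto simp: d_def)
    have "d * pi / (2 * N) \<le> u"
    proof (cases "i < k")
      case True
      have "d * pi / (2 * N) \<le> (d - 1 / 2) * pi / N" using d1 N by (simp add: field_simps)
      also have "\<dots> = real k * pi / N - tau N i"
        using True N by (simp add: d_def tau_def field_simps)
      also have "\<dots> \<le> u" unfolding u_def using assms by linarith
      finally show ?thesis .
    next
      case False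
      hence ik: "k < i" using \<open>i \<noteq> k\<close> by simp
      have "d * pi / (2 * N) \<le> (d - 1 / 2) * pi / N" using d1 N by (simp add: field_simps)
      also have "\<dots> = tau N i - real (Suc k) * pi / N"
        using ik N by (simp add: d_def tau_def field_simps)
      also have "\<dots> \<le> u" unfolding u_def using assms by linarith
      finally show ?thesis .
    qed
    hence "d / (2 * N) \<le> 2 * (u / 2) / pi" using N by (simp add: field_simps)
    also have "\<dots> \<le> sin (u / 2)"
      by (rule sin_ge_jordan) (use t tau in \<open>auto simp: u_def\<close>)
    finally have "(d / (2 * N))\<^sup>2 \<le> (sin (u / 2))\<^sup>2" using d1 by (intro power_mono) auto
    also note s
    finally have *: "(d / (2 * N))\<^sup>2 \<le> (sin (s / 2))\<^sup>2" .
    have "fejer N s * (d / (2 * N))\<^sup>2 \<le> fejer N s * (sin (s / 2))\<^sup>2"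
      by (intro mult_left_mono * fejer_nonneg)
    also have "\<dots> \<le> 1" unfolding fejer_mult_sin by (simp add: abs_square_le_1)
    finally have "fejer N s * d\<^sup>2 \<le> 4 * (real N)\<^sup>2" using N d1 by (simp add: field_simps)
    moreover have "(1 + d)\<^sup>2 \<le> (2 * d)\<^sup>2" using d1 by (intro power_mono) auto
    hence "fejer N s * (1 + d)\<^sup>2 \<le> fejer N s * (2 * d)\<^sup>2"
      by (intro mult_left_mono fejer_nonneg)
    ultimately have "fejer N s * (1 + d)\<^sup>2 \<le> 16 * (real N)\<^sup>2" by (simp add: power_mult_distrib)
    thus ?thesis using d1 by (simp add: field_simps)
  qed
  have d0: "0 \<le> d" by (simp add: d_def)
  have "(sin (u / 2))\<^sup>2 = (sin ((t - tau N i) / 2))\<^sup>2"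
    by (cases "t \<ge> tau N i") (auto simp: u_def, metis minus_diff_eq minus_divide_left power2_minus sin_minus)
  hence 1: "fejer N (t - tau N i) \<le> 16 * (real N)\<^sup>2 / (1 + d)\<^sup>2" by (intro key) auto
  \<comment> \<open>The mirror image is never closer than the original: the squared half-angle sines
    differ by a product of two nonnegative sines.\<close>
  have "(sin ((t + tau N i) / 2))\<^sup>2 - (sin ((t - tau N i) / 2))\<^sup>2 = sin t * sin (tau N i)"
    using cos_double_sin[of "(t + tau N i) / 2"] cos_double_sin[of "(t - tau N i) / 2"]
      cos_add[of t "tau N i"] cos_diff[of t "tau N i"] by (simp del: distrib_left_numeral right_diff_distrib_numeral)
  also have "\<dots> \<ge> 0" using t tau by (intro mult_nonneg_nonneg sin_ge_zero) auto
  finally have 2: "fejer N (t + tau N i) \<le> 16 * (real N)\<^sup>2 / (1 + d)\<^sup>2"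
    using \<open>(sin (u / 2))\<^sup>2 = _\<close> by (intro key) auto
  have "(16 * (real N)\<^sup>2 / (1 + d)\<^sup>2)\<^sup>2 = 256 * real N ^ 4 / (1 + d) ^ 4"
    by (simp add: power_divide power_mult_distrib flip: power_mult)
  moreover have "(fejer N (t - tau N i))\<^sup>2 \<le> (16 * (real N)\<^sup>2 / (1 + d)\<^sup>2)\<^sup>2"
    by (intro power_mono 1 fejer_nonneg)
  moreover have "(fejer N (t + tau N i))\<^sup>2 \<le> (16 * (real N)\<^sup>2 / (1 + d)\<^sup>2)\<^sup>2"
    by (intro power_mono 2 fejer_nonneg)
  ultimately show ?thesis unfolding d_def[symmetric] by simp
qed

lemma kernel_lower:
  assumes "k < N" "real k * pi / N \<le> t" "t \<le> real (Suc k) * pi / N"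
  shows "real N ^ 4 / 4 \<le> (fejer N (t - tau N k))\<^sup>2 + (fejer N (t + tau N k))\<^sup>2"
proof -
  have "tau N k = real k * pi / N + pi / (2 * real N)"
    "real (Suc k) * pi / N = real k * pi / N + 2 * (pi / (2 * real N))"
    using assms(1) by (simp_all add: tau_def field_simps)
  hence "\<bar>t - tau N k\<bar> \<le> pi / (2 * real N)"
    using assms unfolding abs_le_iff by linarith
  hence "((real N)\<^sup>2 / 2)\<^sup>2 \<le> (fejer N (t - tau N k))\<^sup>2"
    by (intro power_mono fejer_ge) auto
  moreover have "((real N)\<^sup>2 / 2)\<^sup>2 = real N ^ 4 / 4"
    by (simp add: power_divide flip: power_mult)
  ultimately show ?thesis using zero_le_power2[of "fejer N (t + tau N k)"] by linarith
qed

section \<open>Local approximation\<close>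

lemma sum_inverse_square_shift_le: "(\<Sum>d<n. 1 / (1 + real d)\<^sup>2) \<le> 2"
proof -
  have "(\<Sum>d<Suc n. 1 / (1 + real d)\<^sup>2) \<le> 2 - 1 / (1 + real n)" for n
  proof (induction n)
    case (Suc n)
    have "1 / (1 + real (Suc n))\<^sup>2 \<le> 1 / (1 + real n) - 1 / (1 + real (Suc n))"
      by (simp add: divide_simps power2_eq_square)
    with Suc show ?case by simp
  qed simp
  from this[of n] have "(\<Sum>d<Suc n. 1 / (1 + real d)\<^sup>2) \<le> 2 - 1 / (1 + real n)" .
  moreover have "0 \<le> 1 / (1 + real n)" "0 \<le> 1 / (1 + real n)\<^sup>2" by simp_all
  ultimately show ?thesis unfolding sum.lessThan_Suc by linarith
qed

lemma sum_inverse_square_dist_le: "(\<Sum>i<N. 1 / (1 + \<bar>real i - real j\<bar>)\<^sup>2) \<le> 4"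
proof -
  let ?g = "\<lambda>i. 1 / (1 + \<bar>real i - real j\<bar>)\<^sup>2" and ?h = "\<lambda>d. 1 / (1 + real d)\<^sup>2"
  have "(\<Sum>i<N. ?g i) \<le> (\<Sum>i\<in>{..<j} \<union> {j..<j+N}. ?g i)"
    by (rule sum_mono2) auto
  also have "\<dots> = (\<Sum>i<j. ?g i) + (\<Sum>i=j..<j+N. ?g i)"
    by (rule sum.union_disjoint) auto
  also have "(\<Sum>i=j..<j+N. ?g i) = (\<Sum>d<N. ?h d)"
    using sum.shift_bounds_nat_ivl[of ?g 0 j N] by (simp add: add.commute atLeast0LessThan)
  also have "(\<Sum>i<j. ?g i) = (\<Sum>d<j. ?g (j - Suc d))"
    by (rule sum.nat_diff_reindex[symmetric])
  also have "\<dots> \<le> (\<Sum>d<j. ?h d)"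
  proof (rule sum_mono)
    fix d assume "d \<in> {..<j}"
    hence "\<bar>real (j - Suc d) - real j\<bar> = real d + 1" by (simp add: of_nat_diff)
    thus "?g (j - Suc d) \<le> ?h d" by (simp, intro divide_left_mono power_mono mult_pos_pos) auto
  qed
  finally show ?thesis
    using sum_inverse_square_shift_le[of N] sum_inverse_square_shift_le[of j] by linarith
qed

lemma arc_endpoint:
  assumes "Suc k < N"
  shows "cos (real (Suc k) * pi / N) \<in> cos_arc N k" "cos (real (Suc k) * pi / N) \<in> cos_arc N (Suc k)"
proof -
  have "cos (real (Suc j) * pi / N) \<le> cos (real j * pi / N)" if "j < N" for j
    using that mult_right_mono[of "real (Suc j)" "real N" pi]
    by (intro cos_monotone_0_pi_le) (auto simp: field_simps)
  from this[of k] this[of "Suc k"] assms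
  show "cos (real (Suc k) * pi / N) \<in> cos_arc N k" "cos (real (Suc k) * pi / N) \<in> cos_arc N (Suc k)"
    by (auto simp: cos_arc_def)
qed

text \<open>Neighbouring arcs share an endpoint, so values on distant arcs are compared by passing
  through all the arcs between them.\<close>

lemma arc_chain:
  fixes f :: "real \<Rightarrow> real"
  assumes osc: "\<forall>k<N. \<forall>x\<in>cos_arc N k. \<forall>y\<in>cos_arc N k. \<bar>f x - f y\<bar> \<le> W k"
    and "i \<le> k" "k < N" "x \<in> cos_arc N k" "y \<in> cos_arc N i"
  shows "\<bar>f x - f y\<bar> \<le> (\<Sum>j=i..k. W j)"
  using assms(2-4)
proof (induction k arbitrary: x rule: dec_induct)
  case base
  thus ?case using osc assms by simp
next
  case (step k)
  let ?e = "cos (real (Suc k) * pi / N)"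
  have "\<bar>f x - f ?e\<bar> \<le> W (Suc k)" using osc step arc_endpoint[of k N] by blast
  moreover have "\<bar>f ?e - f y\<bar> \<le> (\<Sum>j=i..k. W j)" using step arc_endpoint[of k N] by (intro step) auto
  ultimately show ?case using step.hyps by (simp add: sum.nat_ivl_Suc')
qed

text \<open>The weight at arc \<open>j\<close> decays quadratically on both sides because every \<open>j\<close> between \<open>i\<close> and
  \<open>k\<close> satisfies \<open>(1 + \<bar>i - j\<bar>) (1 + \<bar>j - k\<bar>) \<le> (1 + \<bar>i - k\<bar>)\<^sup>2\<close>.\<close>

lemma jackson_arcs:
  fixes f :: "real \<Rightarrow> real"
  assumes N: "N \<ge> 1"
    and osc: "\<forall>k<N. \<forall>x\<in>cos_arc N k. \<forall>y\<in>cos_arc N k. \<bar>f x - f y\<bar> \<le> W k"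
  shows "\<exists>p S. degree p \<le> 2 * N \<and> (\<forall>k<N. \<forall>x\<in>cos_arc N k. \<bar>f x - poly p x\<bar> \<le> S k) \<and>
    (\<Sum>k<N. S k) \<le> 8192 * (\<Sum>k<N. W k)"
proof -
  obtain P S0 where P: "\<And>i. degree (P i) \<le> 2 * N - 2"
    "\<And>i t. poly (P i) (cos t) = (fejer N (t - tau N i))\<^sup>2 + (fejer N (t + tau N i))\<^sup>2"
    "\<And>x. (\<Sum>i<N. poly (P i) x) = S0" "S0 \<ge> real N ^ 4"
    using kernel_poly[OF N] by metis
  have "real N ^ 4 > 0" using N by simp
  hence S0: "S0 > 0" using P(4) by linarith
  define p where "p = (\<Sum>i<N. smult (f (cos (tau N i)) / S0) (P i))"
  define D where "D = (\<lambda>i j. 1 / (1 + \<bar>real i - real j\<bar>)\<^sup>2)"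
  \<comment> \<open>2048 is the 512 of \<open>kernel_decay\<close> times the bound 4 for the sum of
    \<open>D i j\<close> over i; summing over k costs a further 4, hence 8192.\<close>
  define S where "S = (\<lambda>k. 2048 * (\<Sum>j<N. W j * D j k))"
  have W: "W k \<ge> 0" if "k < N" for k
    using osc that cos_tau_in_arc[OF that] by fastforce
  have D0: "D i j \<ge> 0" for i j by (simp add: D_def)
  have Dsum: "(\<Sum>i<N. D i j) \<le> 4" "(\<Sum>i<N. D j i) \<le> 4" for j
    using sum_inverse_square_dist_le[of j N] by (simp_all add: D_def abs_minus_commute)
  have "degree p \<le> 2 * N" unfolding p_def
    by (intro degree_sum_le) (auto intro: order.trans[OF degree_smult_le] order.trans[OF P(1)])
  moreover have "\<bar>f x - poly p x\<bar> \<le> S k" if k: "k < N" and x: "x \<in> cos_arc N k" for k x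
  proof -
    obtain t where t: "x = cos t" "real k * pi / N \<le> t" "t \<le> real (Suc k) * pi / N"
      using arc_angle[OF x k] by metis
    have Pb: "0 \<le> poly (P i) x" "poly (P i) x / S0 \<le> 512 / (1 + \<bar>real i - real k\<bar>) ^ 4" if "i < N" for i
    proof -
      show 0: "0 \<le> poly (P i) x" by (simp add: t P)
      have "poly (P i) x / S0 \<le> poly (P i) x / real N ^ 4"
        using P(4) 0 N S0 by (intro divide_left_mono) auto
      also have "\<dots> \<le> (512 * real N ^ 4 / (1 + \<bar>real i - real k\<bar>) ^ 4) / real N ^ 4"
        unfolding t(1) P using that k t by (intro divide_right_mono kernel_decay) auto
      also have "\<dots> = 512 / (1 + \<bar>real i - real k\<bar>) ^ 4" using N by simp
      finally show "poly (P i) x / S0 \<le> 512 / (1 + \<bar>real i - real k\<bar>) ^ 4" .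
    qed
    \<comment> \<open>The quotients \<open>poly (P i) x / S0\<close> sum to 1, so the error is an
      average of differences of values of f.\<close>
    have "f x - poly p x = (\<Sum>i<N. (f x - f (cos (tau N i))) * (poly (P i) x / S0))"
      using P(3)[of x] S0
      by (simp add: p_def poly_sum left_diff_distrib sum_subtractf diff_divide_distrib flip: sum_distrib_left sum_divide_distrib)
    also have "\<bar>\<dots>\<bar> \<le> (\<Sum>i<N. \<Sum>j<N. 512 * (W j * D j k) * D i j)"
    proof (rule order.trans[OF sum_abs sum_mono])
      fix i assume "i \<in> {..<N}"
      hence i: "i < N" by simp
      define A where "A = {min i k..max i k}"
      have "\<bar>f x - f (cos (tau N i))\<bar> \<le> (\<Sum>j\<in>A. W j)"
      proof (cases "i \<le> k")
        case True
        thus ?thesis using arc_chain[where f = f and W = W, OF osc True k x cos_tau_in_arc[OF i]]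
          by (simp add: A_def min_def max_def)
      next
        case False
        hence "k \<le> i" by simp
        from arc_chain[where f = f and W = W, OF osc this i cos_tau_in_arc[OF i] x] False
        show ?thesis by (simp add: A_def min_def max_def abs_minus_commute)
      qed
      hence "\<bar>(f x - f (cos (tau N i))) * (poly (P i) x / S0)\<bar> \<le>
          (\<Sum>j\<in>A. W j) * (512 / (1 + \<bar>real i - real k\<bar>) ^ 4)"
        unfolding abs_mult using Pb[OF i] S0 by (intro mult_mono) (auto simp: A_def i k W intro!: sum_nonneg)
      also have "\<dots> \<le> (\<Sum>j\<in>A. 512 * (W j * D j k) * D i j)"
        unfolding sum_distrib_right
      proof (rule sum_mono)
        fix j assume j: "j \<in> A"
        hence jN: "j < N" using i k by (auto simp: A_def)
        have "\<bar>real i - real j\<bar> \<le> \<bar>real i - real k\<bar>" "\<bar>real j - real k\<bar> \<le> \<bar>real i - real k\<bar>"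
          using j by (auto simp: A_def)
        hence "(1 + \<bar>real i - real j\<bar>)\<^sup>2 * (1 + \<bar>real j - real k\<bar>)\<^sup>2 \<le>
            (1 + \<bar>real i - real k\<bar>)\<^sup>2 * (1 + \<bar>real i - real k\<bar>)\<^sup>2"
          by (intro mult_mono power_mono) auto
        hence "1 / (1 + \<bar>real i - real k\<bar>) ^ 4 \<le>
             1 / ((1 + \<bar>real i - real j\<bar>)\<^sup>2 * (1 + \<bar>real j - real k\<bar>)\<^sup>2)"
          by (intro divide_left_mono mult_pos_pos) (auto simp flip: power_add)
        also have "\<dots> = D j k * D i j" by (simp add: D_def)
        finally have "512 * W j * (1 / (1 + \<bar>real i - real k\<bar>) ^ 4) \<le> 512 * W j * (D j k * D i j)"
          using W[OF jN] by (intro mult_left_mono) auto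
        thus "W j * (512 / (1 + \<bar>real i - real k\<bar>) ^ 4) \<le> 512 * (W j * D j k) * D i j"
          by (simp add: mult_ac)
      qed
      also have "\<dots> \<le> (\<Sum>j<N. 512 * (W j * D j k) * D i j)"
        using i k by (intro sum_mono2) (auto simp: A_def intro!: mult_nonneg_nonneg W D0)
      finally show "\<bar>(f x - f (cos (tau N i))) * (poly (P i) x / S0)\<bar> \<le> (\<Sum>j<N. 512 * (W j * D j k) * D i j)" .
    qed
    also have "\<dots> = (\<Sum>j<N. 512 * (W j * D j k) * (\<Sum>i<N. D i j))"
      by (subst sum.swap) (simp add: sum_distrib_left)
    also have "\<dots> \<le> (\<Sum>j<N. 512 * (W j * D j k) * 4)"
      by (intro sum_mono mult_left_mono Dsum) (auto intro!: mult_nonneg_nonneg W D0)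
    also have "\<dots> = S k" by (simp add: S_def sum_distrib_left sum_distrib_right mult_ac)
    finally show ?thesis .
  qed
  moreover have "(\<Sum>k<N. S k) \<le> 8192 * (\<Sum>k<N. W k)"
  proof -
    have "(\<Sum>k<N. S k) = 2048 * (\<Sum>j<N. W j * (\<Sum>k<N. D j k))"
      unfolding S_def sum_distrib_left[symmetric] by (subst sum.swap) (simp add: sum_distrib_left)
    also have "\<dots> \<le> 2048 * (\<Sum>j<N. W j * 4)"
      by (intro mult_left_mono sum_mono Dsum W) auto
    finally show ?thesis by (simp add: sum_distrib_right[symmetric])
  qed
  ultimately show ?thesis by blast
qed

section \<open>Antiderivatives of polynomials and increments of absolutely continuous
  functions\<close>

lemma poly_antiderivative:
  fixes q :: "real poly"
  obtains P where "pderiv P = q" "degree P \<le> Suc (degree q)"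
proof -
  define P where "P = (\<Sum>i\<le>degree q. monom (coeff q i / (real i + 1)) (Suc i))"
  have "degree P \<le> Suc (degree q)"
    unfolding P_def by (intro degree_sum_le) (auto intro: order.trans[OF degree_monom_le])
  moreover have coeffP: "coeff P (Suc n) = coeff q n / (real n + 1)" for n
    unfolding P_def coeff_sum by (simp add: coeff_eq_0)
  have "pderiv P = q"
  proof (rule poly_eqI)
    fix n
    have "real n + 1 \<noteq> 0" by linarith
    thus "coeff (pderiv P) n = coeff q n"
      unfolding coeff_pderiv coeffP by (simp add: add.commute)
  qed
  ultimately show thesis by (intro that)
qed

lemma poly_lipschitz_on_Icc:
  fixes q :: "real poly"
  obtains L where "L > 0" "\<And>x y. x \<in> {a..b} \<Longrightarrow> y \<in> {a..b} \<Longrightarrow> \<bar>poly q x - poly q y\<bar> \<le> L * \<bar>x - y\<bar>"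
proof -
  have "continuous_on {a..b} (poly (pderiv q))"
    by (rule continuous_at_imp_continuous_on) (simp add: poly_isCont)
  hence "bounded (poly (pderiv q) ` {a..b})"
    by (intro compact_imp_bounded compact_continuous_image) auto
  then obtain L where L: "L > 0" "\<And>x. x \<in> {a..b} \<Longrightarrow> \<bar>poly (pderiv q) x\<bar> \<le> L"
    unfolding bounded_pos by auto
  have "\<bar>poly q x - poly q y\<bar> \<le> L * \<bar>x - y\<bar>" if "x \<in> {a..b}" "y \<in> {a..b}" for x y
    using field_differentiable_bound[of "{a..b}" "poly q" "poly (pderiv q)" L x y] that L
    by (auto intro: has_field_derivative_at_within poly_DERIV)
  with L(1) show thesis by (rule that)
qed

lemma absolutely_continuous_on_IccE:
  assumes ac: "absolutely_continuous_on_Icc c d g" and e: "e > 0"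
  obtains \<delta> where "\<delta> > 0" "\<And>P :: (real \<times> real) set. finite P \<Longrightarrow> (\<forall>(u, v)\<in>P. c \<le> u \<and> u < v \<and> v \<le> d) \<Longrightarrow>
        pairwise (\<lambda>I J. disjnt {fst I<..<snd I} {fst J<..<snd J}) P \<Longrightarrow>
        (\<Sum>(u, v)\<in>P. v - u) < \<delta> \<Longrightarrow> (\<Sum>(u, v)\<in>P. \<bar>g v - g u\<bar>) < e"
proof -
  obtain \<delta> where \<delta>: "\<delta> > 0" and *: "\<forall>P :: (real \<times> real) set. finite P \<longrightarrow> (\<forall>(u, v)\<in>P. c \<le> u \<and> u < v \<and> v \<le> d) \<longrightarrow>
        pairwise (\<lambda>I J. disjnt {fst I<..<snd I} {fst J<..<snd J}) P \<longrightarrow>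
        (\<Sum>(u, v)\<in>P. v - u) < \<delta> \<longrightarrow> (\<Sum>(u, v)\<in>P. \<bar>g v - g u\<bar>) < e"
    using ac[unfolded absolutely_continuous_on_Icc_def, THEN spec, THEN mp, OF e] by (elim exE conjE)
  show thesis by (rule that[OF \<delta> *[THEN spec, THEN mp, THEN mp, THEN mp, THEN mp]])
qed

lemma absolutely_continuous_on_Icc_diff_lipschitz:
  assumes g: "absolutely_continuous_on_Icc a b g" and L: "L > 0"
    and lip: "\<And>x y. x \<in> {a..b} \<Longrightarrow> y \<in> {a..b} \<Longrightarrow> \<bar>h x - h y\<bar> \<le> L * \<bar>x - y\<bar>"
  shows "absolutely_continuous_on_Icc a b (\<lambda>x. g x - h x)"
  unfolding absolutely_continuous_on_Icc_def
proof (intro allI impI)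
  fix e :: real assume "e > 0"
  hence e2: "e / 2 > 0" by simp
  obtain d where d: "d > 0" "\<And>P :: (real \<times> real) set. finite P \<Longrightarrow> (\<forall>(u, v)\<in>P. a \<le> u \<and> u < v \<and> v \<le> b) \<Longrightarrow>
        pairwise (\<lambda>I J. disjnt {fst I<..<snd I} {fst J<..<snd J}) P \<Longrightarrow>
        (\<Sum>(u, v)\<in>P. v - u) < d \<Longrightarrow> (\<Sum>(u, v)\<in>P. \<bar>g v - g u\<bar>) < e / 2"
  proof (rule absolutely_continuous_on_IccE[OF g e2], goal_cases)
    case (1 \<delta>)
    from 1(2,3) show ?case by (rule 1(1))
  qed
  show "\<exists>\<delta>>0. \<forall>P. finite P \<longrightarrow> (\<forall>(u, v)\<in>P. a \<le> u \<and> u < v \<and> v \<le> b) \<longrightarrow>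
        pairwise (\<lambda>I J. disjnt {fst I<..<snd I} {fst J<..<snd J}) P \<longrightarrow>
        (\<Sum>(u, v)\<in>P. v - u) < \<delta> \<longrightarrow> (\<Sum>(u, v)\<in>P. \<bar>(g v - h v) - (g u - h u)\<bar>) < e"
  proof (intro exI[of _ "min d (e / (2 * L))"] conjI allI impI)
    show "min d (e / (2 * L)) > 0" using d \<open>e > 0\<close> L by simp
    fix P :: "(real \<times> real) set"
    assume P: "finite P" "\<forall>(u, v)\<in>P. a \<le> u \<and> u < v \<and> v \<le> b"
      "pairwise (\<lambda>I J. disjnt {fst I<..<snd I} {fst J<..<snd J}) P"
      "(\<Sum>(u, v)\<in>P. v - u) < min d (e / (2 * L))"
    have "(\<Sum>(u, v)\<in>P. \<bar>(g v - h v) - (g u - h u)\<bar>) \<le> (\<Sum>(u, v)\<in>P. \<bar>g v - g u\<bar> + L * (v - u))"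
    proof (rule sum_mono, clarify)
      fix u v assume "(u, v) \<in> P"
      hence "a \<le> u" "u < v" "v \<le> b" using P by auto
      thus "\<bar>(g v - h v) - (g u - h u)\<bar> \<le> \<bar>g v - g u\<bar> + L * (v - u)"
        using lip[of v u] by auto
    qed
    also have "\<dots> = (\<Sum>(u, v)\<in>P. \<bar>g v - g u\<bar>) + L * (\<Sum>(u, v)\<in>P. v - u)"
      by (simp add: case_prod_unfold sum.distrib sum_distrib_left)
    also have "(\<Sum>(u, v)\<in>P. \<bar>g v - g u\<bar>) < e / 2" using P by (intro d) auto
    also have "L * (\<Sum>(u, v)\<in>P. v - u) \<le> L * (e / (2 * L))"
      using P L by (intro mult_left_mono) auto
    finally show "(\<Sum>(u, v)\<in>P. \<bar>(g v - h v) - (g u - h u)\<bar>) < e" using L by simp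
  qed
qed

text \<open>A gauge argument: tags in the exceptional null set are covered by a small open set, where
  absolute continuity controls the increments; at the other tags the derivative does.\<close>

lemma absolutely_continuous_increment_le:
  assumes ac: "absolutely_continuous_on_Icc c d g"
    and der: "AE x in lebesgue. x \<in> {c<..<d} \<longrightarrow> (g has_real_derivative g' x) (at x)"
    and ab: "c \<le> a" "a \<le> b" "b \<le> d"
    and bnd: "\<And>x. x \<in> {a..b} \<Longrightarrow> \<bar>g' x\<bar> \<le> B"
  shows "\<bar>g b - g a\<bar> \<le> B * (b - a)"
proof (rule field_le_epsilon)
  fix e0 :: real assume e0: "e0 > 0"
  \<comment> \<open>The excess will be e (b - a) from the ordinary tags plus e from the exceptional
    ones.\<close>
  define e where "e = e0 / (b - a + 1)"
  have e: "e > 0" using e0 ab by (simp add: e_def)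
  obtain \<delta> where \<delta>: "\<delta> > 0" "\<And>P :: (real \<times> real) set. finite P \<Longrightarrow> (\<forall>(u, v)\<in>P. c \<le> u \<and> u < v \<and> v \<le> d) \<Longrightarrow>
        pairwise (\<lambda>I J. disjnt {fst I<..<snd I} {fst J<..<snd J}) P \<Longrightarrow>
        (\<Sum>(u, v)\<in>P. v - u) < \<delta> \<Longrightarrow> (\<Sum>(u, v)\<in>P. \<bar>g v - g u\<bar>) < e"
  proof (rule absolutely_continuous_on_IccE[OF ac e], goal_cases)
    case (1 \<delta>)
    from 1(2,3) show ?case by (rule 1(1))
  qed
  obtain Z0 where Z0: "\<And>x. x \<in> space lebesgue - Z0 \<Longrightarrow> x \<in> {c<..<d} \<longrightarrow> (g has_real_derivative g' x) (at x)"
      "Z0 \<in> null_sets lebesgue"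
    using AE_E3[OF der] by blast
  \<comment> \<open>The endpoints join the exceptional set because the derivative is given in the
    open interval only.\<close>
  define Z where "Z = Z0 \<union> {c, d}"
  have Z: "Z \<in> null_sets lebesgue"
    unfolding Z_def by (intro null_sets.Un Z0) (simp add: negligible_iff_null_sets[symmetric])
  obtain T where T: "open T" "Z \<subseteq> T" "T - Z \<in> lmeasurable" "emeasure lebesgue (T - Z) < ennreal \<delta>"
    using sets_lebesgue_outer_open[of Z \<delta>] Z \<delta>(1) by (auto simp: null_sets_def)
  have Tm: "T \<in> sets lebesgue" using T(1) by (simp add: borel_open)
  have "emeasure lebesgue T = emeasure lebesgue (T - Z)"
    by (rule emeasure_Diff_null_set[symmetric]) (use Z Tm in auto)
  hence T\<delta>: "emeasure lebesgue T < ennreal \<delta>" using T by simp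
  have "\<exists>r>0. (x \<in> Z \<longrightarrow> ball x r \<subseteq> T) \<and>
      (x \<in> {a..b} - Z \<longrightarrow> (\<forall>y\<in>ball x r. \<bar>g y - g x\<bar> \<le> (B + e) * \<bar>y - x\<bar>))" for x
  proof (cases "x \<in> Z")
    case True
    thus ?thesis using T openE[of T x] by blast
  next
    case False
    show ?thesis
    proof (cases "x \<in> {a..b}")
      case x: True
      have xcd: "x \<in> {c<..<d}" using x False ab by (auto simp: Z_def)
      hence "(g has_real_derivative g' x) (at x)" using Z0(1)[of x] False by (auto simp: Z_def)
      hence "(\<lambda>h. (g (x + h) - g x) / h) \<midarrow>0\<rightarrow> g' x" by (simp add: DERIV_def)
      from LIM_D[OF this e] obtain r where r: "r > 0"
        "\<And>h. h \<noteq> 0 \<Longrightarrow> \<bar>h\<bar> < r \<Longrightarrow> \<bar>(g (x + h) - g x) / h - g' x\<bar> < e" by auto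
      have "\<bar>g y - g x\<bar> \<le> (B + e) * \<bar>y - x\<bar>" if "y \<in> ball x r" for y
      proof (cases "y = x")
        case False
        have "\<bar>(g y - g x) / (y - x) - g' x\<bar> < e"
          using r(2)[of "y - x"] False that by (auto simp: dist_real_def abs_minus_commute)
        hence "\<bar>(g y - g x) / (y - x)\<bar> \<le> B + e" using bnd[OF x] by linarith
        thus ?thesis using False by (simp add: abs_divide field_simps)
      qed auto
      thus ?thesis using r False by auto
    qed (use False in \<open>auto intro: exI[of _ 1]\<close>)
  qed
  then obtain r where r: "\<And>x. r x > 0" "\<And>x. x \<in> Z \<Longrightarrow> ball x (r x) \<subseteq> T"
      "\<And>x y. x \<in> {a..b} \<Longrightarrow> x \<notin> Z \<Longrightarrow> y \<in> ball x (r x) \<Longrightarrow> \<bar>g y - g x\<bar> \<le> (B + e) * \<bar>y - x\<bar>"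
    by (metis DiffI)
  have "gauge (\<lambda>x. ball x (r x))" using r by (simp add: gauge_def)
  then obtain p where p: "p tagged_division_of {a..b}" "(\<lambda>x. ball x (r x)) fine p"
    by (rule fine_division_exists_real)
  note pD = tagged_division_ofD[OF p(1)]
  have K: "\<exists>u v. K = {u..v} \<and> u \<le> x \<and> x \<le> v \<and> a \<le> u \<and> v \<le> b \<and> Inf K = u \<and> Sup K = v \<and> u \<in> K \<and> v \<in> K"
    if xK: "(x, K) \<in> p" for x K
  proof -
    obtain u v where uv: "K = {u..v}" using pD(4)[OF xK] by auto
    moreover have "x \<in> K" "K \<subseteq> {a..b}" using pD(2,3)[OF xK] by auto
    ultimately show ?thesis by (intro exI[of _ u] exI[of _ v]) auto
  qed
  define p1 where "p1 = {(x, K) \<in> p. x \<notin> Z}"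
  define p2 where "p2 = {(x, K) \<in> p. x \<in> Z}"
  \<comment> \<open>Absolute continuity speaks of intervals with u < v; the degenerate ones dropped
    here have increment zero.\<close>
  define p3 where "p3 = {(x, K) \<in> p2. Inf K < Sup K}"
  have fin: "finite p" "finite p1" "finite p2" "finite p3"
    using pD(1) by (auto simp: p1_def p2_def p3_def intro: finite_subset[of _ p])
  have sum_split: "(\<Sum>z\<in>p. \<phi> z) = (\<Sum>z\<in>p1. \<phi> z) + (\<Sum>z\<in>p2. \<phi> z)" for \<phi> :: "real \<times> real set \<Rightarrow> real"
    using fin by (subst sum.union_disjoint[symmetric]) (auto simp: p1_def p2_def intro!: sum.cong)
  define io where "io = (\<lambda>(x :: real, K :: real set). (Inf K :: real, Sup K :: real))"
  define P where "P = io ` p3"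
  have disj: "disjnt {Inf K<..<Sup K} {Inf K'<..<Sup K'}"
    if h: "(x, K) \<in> p" "(x', K') \<in> p" "(x, K) \<noteq> (x', K')" for x K x' K'
  proof -
    obtain u v where uv: "K = {u..v}" "Inf K = u" "Sup K = v" using K[OF h(1)] by auto
    obtain u' v' where uv': "K' = {u'..v'}" "Inf K' = u'" "Sup K' = v'" using K[OF h(2)] by auto
    show ?thesis using pD(5)[OF h] uv uv' by (simp add: disjnt_def)
  qed
  \<comment> \<open>Non-degenerate intervals with disjoint interiors cannot coincide, so passing
    from tagged intervals to pairs of endpoints loses no term.\<close>
  have inj: "inj_on io p3"
  proof (rule inj_onI, clarify)
    fix x K x' K' assume h: "(x, K) \<in> p3" "(x', K') \<in> p3" "io (x, K) = io (x', K')"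
    show "x = x' \<and> K = K'"
    proof (rule ccontr)
      assume "\<not> (x = x' \<and> K = K')"
      hence "disjnt {Inf K<..<Sup K} {Inf K'<..<Sup K'}" using h by (intro disj) (auto simp: p3_def p2_def)
      moreover have "Inf K < Sup K" "Inf K = Inf K'" "Sup K = Sup K'" using h by (auto simp: p3_def io_def)
      ultimately show False by (simp add: disjnt_def)
    qed
  qed
  have P_uv: "c \<le> u \<and> u < v \<and> v \<le> d \<and> {u<..<v} \<subseteq> T" if "(u, v) \<in> P" for u v
  proof -
    obtain x K' where h: "(x, K') \<in> p3" "u = Inf K'" "v = Sup K'" using \<open>(u, v) \<in> P\<close> by (auto simp: P_def io_def)
    hence h': "(x, K') \<in> p" "x \<in> Z" "u < v" by (auto simp: p3_def p2_def)
    hence "K' \<subseteq> T" using fineD[OF p(2), of x K'] r(2)[of x] by auto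
    thus ?thesis using K[OF h'(1)] h h' ab by auto
  qed
  have P_disj: "pairwise (\<lambda>I J. disjnt {fst I<..<snd I} {fst J<..<snd J}) P"
    unfolding pairwise_def P_def by (auto simp: p3_def p2_def io_def intro: disj)
  have fin_Ioo: "emeasure lborel {u<..<v} \<noteq> top" for u v :: real
    using emeasure_bounded_finite[of "{u<..<v}"] by (simp add: less_top)
  have "(\<Sum>(u, v)\<in>P. v - u) = (\<Sum>I\<in>P. measure lebesgue {fst I<..<snd I})"
    by (intro sum.cong) (auto dest: P_uv simp: measure_completion)
  also have "\<dots> = measure lebesgue (\<Union>I\<in>P. {fst I<..<snd I})"
    using fin P_disj by (intro measure_finite_Union[symmetric])
      (auto simp: P_def disjoint_family_on_def pairwise_def disjnt_def emeasure_completion fin_Ioo)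
  also have "\<dots> \<le> measure lebesgue T"
  proof (rule measure_mono_fmeasurable)
    show "(\<Union>I\<in>P. {fst I<..<snd I}) \<subseteq> T" using P_uv by force
    show "T \<in> lmeasurable" using T\<delta> Tm by (intro fmeasurableI) (auto intro: order.strict_trans simp: less_top[symmetric])
  qed (auto simp: P_def fin intro!: sets.finite_UN)
  also have "\<dots> < \<delta>"
    using T\<delta> \<delta>(1) by (simp add: measure_def enn2real_less_iff less_top order.strict_trans[OF _ ennreal_less_top])
  finally have len: "(\<Sum>(u, v)\<in>P. v - u) < \<delta>" .
  have "finite P" by (simp add: P_def fin)
  hence "(\<Sum>(u, v)\<in>P. \<bar>g v - g u\<bar>) < e"
    using P_disj P_uv len by (intro \<delta>) auto
  moreover have "(\<Sum>(u, v)\<in>P. \<bar>g v - g u\<bar>) = (\<Sum>(x, K)\<in>p3. \<bar>g (Sup K) - g (Inf K)\<bar>)"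
    unfolding P_def sum.reindex[OF inj] by (intro sum.cong) (auto simp: io_def)
  moreover have "(\<Sum>(x, K)\<in>p2. \<bar>g (Sup K) - g (Inf K)\<bar>) = (\<Sum>(x, K)\<in>p3. \<bar>g (Sup K) - g (Inf K)\<bar>)"
  proof (rule sum.mono_neutral_right)
    show "\<forall>z\<in>p2 - p3. (case z of (x, K) \<Rightarrow> \<bar>g (Sup K) - g (Inf K)\<bar>) = 0"
    proof clarify
      fix x K' assume h: "(x, K') \<in> p2" "(x, K') \<notin> p3"
      hence "(x, K') \<in> p" "\<not> Inf K' < Sup K'" by (auto simp: p2_def p3_def)
      hence "Inf K' = Sup K'" using K[of x K'] by auto
      thus "\<bar>g (Sup K') - g (Inf K')\<bar> = 0" by simp
    qed
  qed (auto simp: fin p3_def)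
  ultimately have s2: "(\<Sum>(x, K)\<in>p2. \<bar>g (Sup K) - g (Inf K)\<bar>) \<le> e" by simp
  have s1: "(\<Sum>(x, K)\<in>p1. \<bar>g (Sup K) - g (Inf K)\<bar>) \<le> (\<Sum>(x, K)\<in>p1. (B + e) * (Sup K - Inf K))"
  proof (rule sum_mono, clarify)
    fix x K' assume "(x, K') \<in> p1"
    hence xK: "(x, K') \<in> p" "x \<notin> Z" by (auto simp: p1_def)
    then obtain u v where uv: "u \<le> x" "x \<le> v" "a \<le> u" "v \<le> b" "Inf K' = u" "Sup K' = v" "u \<in> K'" "v \<in> K'"
      using K[of x K'] by blast
    hence "u \<in> ball x (r x)" "v \<in> ball x (r x)" using fineD[OF p(2) xK(1)] by auto
    hence "\<bar>g u - g x\<bar> \<le> (B + e) * \<bar>u - x\<bar>" "\<bar>g v - g x\<bar> \<le> (B + e) * \<bar>v - x\<bar>"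
      using r(3)[of x u] r(3)[of x v] uv(1-4) xK(2) by auto
    moreover have "(B + e) * \<bar>u - x\<bar> + (B + e) * \<bar>v - x\<bar> = (B + e) * (v - u)"
      using uv by (simp add: algebra_simps)
    ultimately show "\<bar>g (Sup K') - g (Inf K')\<bar> \<le> (B + e) * (Sup K' - Inf K')"
      unfolding uv(5,6) by linarith
  qed
  have len0: "0 \<le> Sup K' - Inf K'" if "(x, K') \<in> p" for x K' using K[OF that] by auto
  have B0: "0 \<le> B" using bnd[of a] ab by force
  have "\<bar>g b - g a\<bar> = \<bar>\<Sum>(x, K)\<in>p. g (Sup K) - g (Inf K)\<bar>"
    using additive_tagged_division_1[OF ab(2) p(1), of g] by simp
  also have "\<dots> \<le> (\<Sum>(x, K)\<in>p. \<bar>g (Sup K) - g (Inf K)\<bar>)"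
    by (rule order.trans[OF sum_abs]) (auto simp: case_prod_unfold)
  also have "\<dots> \<le> (\<Sum>(x, K)\<in>p1. (B + e) * (Sup K - Inf K)) + e"
    unfolding sum_split using s1 s2 by simp
  also have "(\<Sum>(x, K)\<in>p1. (B + e) * (Sup K - Inf K)) \<le> (\<Sum>(x, K)\<in>p. (B + e) * (Sup K - Inf K))"
    using fin B0 e by (intro sum_mono2) (auto simp: p1_def intro!: mult_nonneg_nonneg dest: len0)
  also have "\<dots> = (B + e) * (b - a)"
    using additive_tagged_division_1[OF ab(2) p(1), of "\<lambda>x. x"]
    by (simp add: case_prod_unfold sum_distrib_left[symmetric])
  also have "(B + e) * (b - a) + e = B * (b - a) + e * (b - a + 1)" by (simp add: algebra_simps)
  also have "e * (b - a + 1) = e0" using ab by (simp add: e_def)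
  finally show "\<bar>g b - g a\<bar> \<le> B * (b - a) + e0" by simp
qed

section \<open>Functions whose derivative has bounded variation\<close>

text \<open>v x is the variation over [-1, x]: extending a partition of [-1, x] by x and y adds |g y
  - g x|. Consequently v and v - g are both nondecreasing, which is the Jordan
  decomposition.\<close>

lemma finite_variation_majorant:
  fixes g :: "real \<Rightarrow> real"
  assumes "total_variation (-1) 1 g < \<infinity>"
  obtains v where "\<And>x y. -1 \<le> x \<Longrightarrow> x \<le> y \<Longrightarrow> y \<le> 1 \<Longrightarrow> \<bar>g y - g x\<bar> \<le> v y - v x"
proof -
  define A where "A = (\<lambda>x :: real. {ts :: real list. sorted ts \<and> set ts \<subseteq> {-1..x}})"
  define \<sigma> where "\<sigma> = (\<lambda>ts :: real list. \<Sum>i<length ts - 1. \<bar>g (ts ! Suc i) - g (ts ! i)\<bar>)"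
  define v where "v = (\<lambda>x. SUP ts\<in>A x. \<sigma> ts)"
  have tv: "ereal (\<sigma> ts) \<le> total_variation (-1) 1 g" if "ts \<in> A 1" for ts
    unfolding total_variation_def \<sigma>_def using that by (intro SUP_upper) (auto simp: A_def)
  have "[] \<in> A x" for x by (simp add: A_def)
  hence ne: "A x \<noteq> {}" for x by blast
  obtain T where T: "\<And>ts. ts \<in> A 1 \<Longrightarrow> \<sigma> ts \<le> T"
  proof (cases "total_variation (-1) 1 g")
    case (real r)
    thus ?thesis using tv that by auto
  next
    case MInf
    thus ?thesis using tv[OF \<open>[] \<in> A 1\<close>] by simp
  qed (use assms in auto)
  have sub: "A x \<subseteq> A y" if "x \<le> y" for x y using that by (auto simp: A_def)
  have bdd: "bdd_above (\<sigma> ` A x)" if "x \<le> 1" for x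
    using T sub[OF that] by (intro bdd_aboveI[of _ T]) auto
  have "\<bar>g y - g x\<bar> \<le> v y - v x" if xy: "-1 \<le> x" "x \<le> y" "y \<le> 1" for x y
  proof -
    have "v x \<le> v y - \<bar>g y - g x\<bar>"
      unfolding v_def
    proof (rule cSUP_least[OF ne])
      fix ts assume ts: "ts \<in> A x"
      let ?us = "ts @ [x, y]"
      have us: "?us \<in> A y" using ts xy by (force simp: A_def sorted_append)
      have "\<sigma> ts + \<bar>g y - g x\<bar> = (\<Sum>i<length ts - 1. \<bar>g (?us ! Suc i) - g (?us ! i)\<bar>) +
            (\<Sum>i\<in>{length ts}. \<bar>g (?us ! Suc i) - g (?us ! i)\<bar>)"
        unfolding \<sigma>_def by (intro arg_cong2[where f = "(+)"] sum.cong) (auto simp: nth_append)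
      \<comment> \<open>For nonempty \<open>ts\<close> the index \<open>length ts - 1\<close>, the
        step from the last point to x, is left out; its term is nonnegative.\<close>
      also have "\<dots> = (\<Sum>i\<in>{..<length ts - 1} \<union> {length ts}. \<bar>g (?us ! Suc i) - g (?us ! i)\<bar>)"
        by (rule sum.union_disjoint[symmetric]) auto
      also have "\<dots> \<le> \<sigma> ?us" unfolding \<sigma>_def by (rule sum_mono2) auto
      also have "\<dots> \<le> (SUP ts\<in>A y. \<sigma> ts)" using us bdd xy by (intro cSUP_upper) auto
      finally show "\<sigma> ts \<le> (SUP ts\<in>A y. \<sigma> ts) - \<bar>g y - g x\<bar>" by simp
    qed
    thus ?thesis by simp
  qed
  thus thesis by (rule that)
qed

text \<open>A discrete L1 norm of local sup errors. The exponent is s and not s + 1 because the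
  remaining factor 1 / N comes from the mass of a single arc. Each of the s integrations raises the
  degree by one.\<close>

definition arc_approximable :: "nat \<Rightarrow> (real \<Rightarrow> real) \<Rightarrow> bool" where
  "arc_approximable s f \<longleftrightarrow> (\<exists>C\<ge>0. \<forall>N\<ge>1. \<exists>p S. degree p \<le> 2 * N + s \<and>
     (\<forall>k<N. \<forall>x\<in>cos_arc N k. \<bar>f x - poly p x\<bar> \<le> S k) \<and> (\<Sum>k<N. S k) \<le> C / real N ^ s)"

text \<open>The oscillation on an arc is at most the increment of the majorant v across it, and
  these increments telescope to v 1 - v (-1).\<close>

lemma arc_approximable_finite_variation:
  assumes "total_variation (-1) 1 g < \<infinity>"
  shows "arc_approximable 0 g"
proof -
  obtain v where v: "\<And>x y. -1 \<le> x \<Longrightarrow> x \<le> y \<Longrightarrow> y \<le> 1 \<Longrightarrow> \<bar>g y - g x\<bar> \<le> v y - v x"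
    using finite_variation_majorant[OF assms] by metis
  have mono: "v x \<le> v y" if "-1 \<le> x" "x \<le> y" "y \<le> 1" for x y
    using v[OF that] by linarith
  show ?thesis unfolding arc_approximable_def
  proof (rule exI[of _ "8192 * (v 1 - v (-1))"], intro conjI allI impI)
    show "0 \<le> 8192 * (v 1 - v (-1))" using mono[of "-1" 1] by simp
    fix N :: nat assume N: "1 \<le> N"
    define W where "W = (\<lambda>k. v (cos (real k * pi / N)) - v (cos (real (Suc k) * pi / N)))"
    have "\<bar>g x - g y\<bar> \<le> W k" if "k < N" "x \<in> cos_arc N k" "y \<in> cos_arc N k" for k x y
    proof -
      have *: "\<bar>g y - g x\<bar> \<le> W k" if "x \<in> cos_arc N k" "y \<in> cos_arc N k" "x \<le> y" for x y
      proof -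
        let ?a = "cos (real (Suc k) * pi / N)" and ?b = "cos (real k * pi / N)"
        have "?a \<le> x" "y \<le> ?b" using that by (auto simp: cos_arc_def)
        moreover have "-1 \<le> ?a" "?b \<le> 1" by (rule cos_ge_minus_one, rule cos_le_one)
        ultimately have "v ?a \<le> v x" "v y \<le> v ?b" "\<bar>g y - g x\<bar> \<le> v y - v x"
          using that(3) by (auto intro!: mono v simp del: cos_ge_minus_one cos_le_one)
        thus ?thesis unfolding W_def by linarith
      qed
      show ?thesis using *[of x y] *[of y x] that by (cases "x \<le> y") (auto simp: abs_minus_commute)
    qed
    hence osc: "\<forall>k<N. \<forall>x\<in>cos_arc N k. \<forall>y\<in>cos_arc N k. \<bar>g x - g y\<bar> \<le> W k" by blast
    have "(\<Sum>k<N. W k) = v (cos (real 0 * pi / N)) - v (cos (real N * pi / N))"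
      unfolding W_def by (rule sum_lessThan_telescope')
    also have "\<dots> = v 1 - v (-1)" using N by simp
    finally have W: "(\<Sum>k<N. W k) = v 1 - v (-1)" .
    show "\<exists>p S. degree p \<le> 2 * N + 0 \<and> (\<forall>k<N. \<forall>x\<in>cos_arc N k. \<bar>g x - poly p x\<bar> \<le> S k) \<and>
        (\<Sum>k<N. S k) \<le> 8192 * (v 1 - v (-1)) / real N ^ 0"
      using jackson_arcs[OF N osc] by (simp add: W)
  qed
qed

text \<open>The hypothesis \<open>incr\<close> abstracts the mean value inequality, which is needed
  in two forms: for a derivative existing everywhere, and for the almost everywhere derivative of
  highest order. An arc has length at most pi / N, hence the factor pi.\<close>

lemma arc_approximable_Suc:
  assumes g: "arc_approximable s g"
    and incr: "\<And>P a b B. -1 \<le> a \<Longrightarrow> a \<le> b \<Longrightarrow> b \<le> 1 \<Longrightarrow> (\<And>x. x \<in> {a..b} \<Longrightarrow> \<bar>g x - poly (pderiv P) x\<bar> \<le> B) \<Longrightarrow>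
        \<bar>(f b - poly P b) - (f a - poly P a)\<bar> \<le> B * (b - a)"
  shows "arc_approximable (Suc s) f"
proof -
  obtain C where C: "C \<ge> 0" "\<And>N. N \<ge> 1 \<Longrightarrow> \<exists>p S. degree p \<le> 2 * N + s \<and>
     (\<forall>k<N. \<forall>x\<in>cos_arc N k. \<bar>g x - poly p x\<bar> \<le> S k) \<and> (\<Sum>k<N. S k) \<le> C / real N ^ s"
    using g unfolding arc_approximable_def by blast
  show ?thesis unfolding arc_approximable_def
  proof (rule exI[of _ "8192 * pi * C"], intro conjI allI impI)
    show "0 \<le> 8192 * pi * C" using C by simp
    fix N :: nat assume N: "1 \<le> N"
    from C(2)[OF N] obtain q S where q: "degree q \<le> 2 * N + s"
     "\<And>k x. k < N \<Longrightarrow> x \<in> cos_arc N k \<Longrightarrow> \<bar>g x - poly q x\<bar> \<le> S k" "(\<Sum>k<N. S k) \<le> C / real N ^ s" by blast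
    obtain P where P: "pderiv P = q" "degree P \<le> Suc (degree q)" by (rule poly_antiderivative)
    have S0: "S k \<ge> 0" if "k < N" for k
      using q(2)[OF that cos_tau_in_arc[OF that]] by linarith
    define h where "h = (\<lambda>x. f x - poly P x)"
    have "\<bar>h x - h y\<bar> \<le> S k * (pi / N)" if k: "k < N" "x \<in> cos_arc N k" "y \<in> cos_arc N k" for k x y
    proof -
      have *: "\<bar>h y - h x\<bar> \<le> S k * (y - x)" if "x \<in> cos_arc N k" "y \<in> cos_arc N k" "x \<le> y" for x y
        unfolding h_def
      proof (rule incr)
        show "-1 \<le> x" "y \<le> 1" using that arc_subset[of N k] by auto
        fix z assume "z \<in> {x..y}"
        hence "z \<in> cos_arc N k" using that by (auto simp: cos_arc_def)
        thus "\<bar>g z - poly (pderiv P) z\<bar> \<le> S k" unfolding P(1) using k by (intro q(2))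
      qed fact
      have "\<bar>h x - h y\<bar> \<le> S k * \<bar>x - y\<bar>"
        using *[of x y] *[of y x] that by (cases "x \<le> y") (auto simp: abs_minus_commute)
      also have "\<dots> \<le> S k * (pi / N)"
        using S0 k arc_subset_cos_diff_le[OF k(2,3,1)] by (intro mult_left_mono) auto
      finally show ?thesis .
    qed
    hence osc: "\<forall>k<N. \<forall>x\<in>cos_arc N k. \<forall>y\<in>cos_arc N k. \<bar>h x - h y\<bar> \<le> S k * (pi / N)" by blast
    obtain p T where p: "degree p \<le> 2 * N" "\<forall>k<N. \<forall>x\<in>cos_arc N k. \<bar>h x - poly p x\<bar> \<le> T k"
      "(\<Sum>k<N. T k) \<le> 8192 * (\<Sum>k<N. S k * (pi / N))"
      using jackson_arcs[OF N osc] by (elim exE conjE)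
    have "8192 * (\<Sum>k<N. S k * (pi / N)) = 8192 * (pi / N) * (\<Sum>k<N. S k)"
      unfolding sum_distrib_right[symmetric] by simp
    also have "\<dots> \<le> 8192 * (pi / N) * (C / real N ^ s)"
      by (intro mult_left_mono q) auto
    also have "\<dots> = 8192 * pi * C / real N ^ Suc s" by simp
    finally have "(\<Sum>k<N. T k) \<le> 8192 * pi * C / real N ^ Suc s" using p(3) by linarith
    moreover have "degree (P + p) \<le> 2 * N + Suc s"
      using P q p by (intro degree_add_le) auto
    ultimately show "\<exists>p S. degree p \<le> 2 * N + Suc s \<and> (\<forall>k<N. \<forall>x\<in>cos_arc N k. \<bar>f x - poly p x\<bar> \<le> S k) \<and>
        (\<Sum>k<N. S k) \<le> 8192 * pi * C / real N ^ Suc s"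
      using p(2) by (intro exI[of _ "P + p"] exI[of _ T]) (auto simp: h_def diff_diff_eq)
  qed
qed

lemma increment_le_of_deriv_within:
  fixes h :: "real \<Rightarrow> real"
  assumes der: "\<And>x. x \<in> {-1..1} \<Longrightarrow> (f has_real_derivative g x) (at x within {-1..1})"
    and "-1 \<le> a" "a \<le> b" "b \<le> 1" and bnd: "\<And>x. x \<in> {a..b} \<Longrightarrow> \<bar>g x - poly (pderiv P) x\<bar> \<le> B"
  shows "\<bar>(f b - poly P b) - (f a - poly P a)\<bar> \<le> B * (b - a)"
proof -
  have "((\<lambda>x. f x - poly P x) has_real_derivative g x - poly (pderiv P) x) (at x within {a..b})"
    if "x \<in> {a..b}" for x
    using that assms by (intro DERIV_diff DERIV_subset[OF der] has_field_derivative_at_within[OF poly_DERIV]) auto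
  from field_differentiable_bound[of "{a..b}" "\<lambda>x. f x - poly P x", OF _ this, of B b a] bnd assms
  show ?thesis by auto
qed

lemma increment_le_of_absolutely_continuous:
  assumes ac: "absolutely_continuous_on_Icc (-1) 1 f"
    and der: "AE x in lebesgue. x \<in> {-1<..<1} \<longrightarrow> (f has_real_derivative g x) (at x)"
    and ab: "-1 \<le> a" "a \<le> b" "b \<le> 1" and bnd: "\<And>x. x \<in> {a..b} \<Longrightarrow> \<bar>g x - poly (pderiv P) x\<bar> \<le> B"
  shows "\<bar>(f b - poly P b) - (f a - poly P a)\<bar> \<le> B * (b - a)"
proof -
  obtain L where L: "L > 0" "\<And>x y. x \<in> {-1..1} \<Longrightarrow> y \<in> {-1..1} \<Longrightarrow> \<bar>poly P x - poly P y\<bar> \<le> L * \<bar>x - y\<bar>"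
    using poly_lipschitz_on_Icc by metis
  have "AE x in lebesgue. x \<in> {-1<..<1} \<longrightarrow>
      ((\<lambda>x. f x - poly P x) has_real_derivative g x - poly (pderiv P) x) (at x)"
    using der by eventually_elim (auto intro: DERIV_diff poly_DERIV)
  from absolutely_continuous_increment_le[OF absolutely_continuous_on_Icc_diff_lipschitz[OF ac L] this ab bnd]
  show ?thesis by simp
qed

lemma arc_approximable_V:
  assumes "f \<in> V s"
  shows "arc_approximable s f"
proof (cases "s = 0")
  case True
  thus ?thesis using assms by (auto simp: V_def intro: arc_approximable_finite_variation)
next
  case False
  with assms obtain F :: "nat \<Rightarrow> real \<Rightarrow> real" where F:
    "\<And>x. x \<in> {-1..1} \<Longrightarrow> F 0 x = f x"
    "\<And>k x. Suc k < s \<Longrightarrow> x \<in> {-1..1} \<Longrightarrow> (F k has_real_derivative F (Suc k) x) (at x within {-1..1})"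
    "absolutely_continuous_on_Icc (-1) 1 (F (s - 1))"
    "AE x in lebesgue. x \<in> {-1<..<1} \<longrightarrow> (F (s - 1) has_real_derivative F s x) (at x)"
    "total_variation (-1) 1 (F s) < \<infinity>"
    unfolding V_def by (auto simp del: atLeastAtMost_iff)
  \<comment> \<open>Integration starts from the s-th derivative; only its first step, j = 0, meets
    the almost everywhere derivative.\<close>
  have "j \<le> s \<Longrightarrow> arc_approximable j (F (s - j))" for j
  proof (induction j)
    case 0
    thus ?case using F(5) by (auto intro: arc_approximable_finite_variation)
  next
    case (Suc j)
    have eq: "s - j = Suc (s - Suc j)" using Suc.prems by simp
    show ?case
    proof (rule arc_approximable_Suc[OF Suc.IH])
      show "j \<le> s" using Suc.prems by simp
      fix P a b B assume *: "-1 \<le> a" "a \<le> b" "b \<le> (1::real)"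
        "\<And>x. x \<in> {a..b} \<Longrightarrow> \<bar>F (s - j) x - poly (pderiv P) x\<bar> \<le> B"
      show "\<bar>(F (s - Suc j) b - poly P b) - (F (s - Suc j) a - poly P a)\<bar> \<le> B * (b - a)"
      proof (cases "j = 0")
        case True
        show ?thesis
          by (rule increment_le_of_absolutely_continuous[where g = "F s"]) (use F * True in auto)
      next
        case False
        show ?thesis
          by (rule increment_le_of_deriv_within[where g = "F (s - j)", OF _ *])
             (use False Suc.prems eq in \<open>auto simp del: atLeastAtMost_iff intro!: F(2)\<close>)
      qed
    qed
  qed
  from this[of s] have "arc_approximable s (F 0)" by simp
  thus ?thesis unfolding arc_approximable_def using F(1) arc_subset by (smt (verit) subsetD)
qed

text \<open>For N = 1 the single arc is all of [-1, 1]. Boundedness is what makes w f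
  integrable.\<close>

lemma bounded_of_arc_approximable:
  assumes "arc_approximable s f"
  obtains B where "\<And>x. x \<in> {-1..1} \<Longrightarrow> \<bar>f x\<bar> \<le> B"
proof -
  obtain p S where p: "\<forall>k<1. \<forall>x\<in>cos_arc 1 k. \<bar>f x - poly p x\<bar> \<le> S k"
    using assms unfolding arc_approximable_def by blast
  obtain L where L: "\<And>x y. x \<in> {-1..1} \<Longrightarrow> y \<in> {-1..1} \<Longrightarrow> \<bar>poly p x - poly p y\<bar> \<le> L * \<bar>x - y\<bar>" "L > 0"
    using poly_lipschitz_on_Icc by metis
  have "\<bar>f x\<bar> \<le> S 0 + \<bar>poly p 0\<bar> + L" if "x \<in> {-1..1}" for x
  proof -
    have "\<bar>f x - poly p x\<bar> \<le> S 0" using p that by (auto simp: cos_arc_def)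
    moreover have "\<bar>poly p x - poly p 0\<bar> \<le> L * \<bar>x - 0\<bar>" using that by (intro L) auto
    moreover have "L * \<bar>x - 0\<bar> \<le> L * 1" using that L(2) by (intro mult_left_mono) auto
    ultimately show ?thesis by linarith
  qed
  thus thesis by (rule that)
qed

text \<open>Needed for w f to be integrable. For s = 0, f is a difference of two monotone functions;
  for s >= 1 each S k is at most the whole sum, so f is a uniform limit of polynomials.\<close>

lemma borel_measurable_V:
  assumes "f \<in> V s"
  shows "f \<in> borel_measurable (restrict_space borel {-1..1})"
proof (cases "s = 0")
  case True
  hence "total_variation (-1) 1 f < \<infinity>" using assms by (simp add: V_def)
  then obtain v where v: "\<And>x y. -1 \<le> x \<Longrightarrow> x \<le> y \<Longrightarrow> y \<le> 1 \<Longrightarrow> \<bar>f y - f x\<bar> \<le> v y - v x"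
    using finite_variation_majorant by metis
  have "mono_on {-1..1} v" "mono_on {-1..1} (\<lambda>x. v x - f x)"
  proof (auto intro!: mono_onI)
    fix x y :: real assume "-1 \<le> x" "x \<le> y" "y \<le> 1"
    from v[OF this] show "v x \<le> v y" "v x - f x \<le> v y - f y" by linarith+
  qed
  from this[THEN borel_measurable_mono_on_fnc]
  have "(\<lambda>x. v x - (v x - f x)) \<in> borel_measurable (restrict_space borel {-1..1})" by measurable
  thus ?thesis by simp
next
  case False
  obtain C where C: "C \<ge> 0" "\<And>N. N \<ge> 1 \<Longrightarrow> \<exists>p S. degree p \<le> 2 * N + s \<and>
     (\<forall>k<N. \<forall>x\<in>cos_arc N k. \<bar>f x - poly p x\<bar> \<le> S k) \<and> (\<Sum>k<N. S k) \<le> C / real N ^ s"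
    using arc_approximable_V[OF assms] unfolding arc_approximable_def by blast
  hence "\<exists>p. \<forall>x\<in>{-1..1}. \<bar>f x - poly p x\<bar> \<le> C / real N" if N: "N \<ge> 1" for N
  proof -
    from C(2)[OF N] obtain q S where q:
     "\<And>k x. k < N \<Longrightarrow> x \<in> cos_arc N k \<Longrightarrow> \<bar>f x - poly q x\<bar> \<le> S k" "(\<Sum>k<N. S k) \<le> C / real N ^ s" by blast
    have S0: "S k \<ge> 0" if "k < N" for k
      using q(1)[OF that cos_tau_in_arc[OF that]] by linarith
    have "real N ^ 1 \<le> real N ^ s" using False N by (intro power_increasing) auto
    hence "C / real N ^ s \<le> C / real N" using C(1) N by (intro divide_left_mono) auto
    moreover have "S k \<le> (\<Sum>k<N. S k)" if "k < N" for k
      using that S0 by (intro member_le_sum) auto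
    ultimately have "\<bar>f x - poly q x\<bar> \<le> C / real N" if "x \<in> {-1..1}" for x
      using arc_cover[OF that N] q by (metis order.trans)
    thus ?thesis by blast
  qed
  then obtain p where p: "\<And>N x. N \<ge> 1 \<Longrightarrow> x \<in> {-1..1} \<Longrightarrow> \<bar>f x - poly (p N) x\<bar> \<le> C / real N"
    by metis
  show ?thesis
  proof (rule borel_measurable_LIMSEQ_real)
    show "(\<lambda>N. poly (p N) x) \<longlonglongrightarrow> f x" if "x \<in> space (restrict_space borel {-1..1})" for x
    proof (rule Lim_transform_bound[where g = "\<lambda>N. C / real N", THEN Lim_null[THEN iffD2]])
      show "\<forall>\<^sub>F N in sequentially. norm (poly (p N) x - f x) \<le> norm (C / real N)"
        using eventually_ge_at_top[of 1]
      proof eventually_elim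
        case (elim N)
        have "\<bar>f x - poly (p N) x\<bar> \<le> C / real N" using p[OF elim, of x] that by (simp add: space_restrict_space)
        thus ?case using C(1) by (simp add: abs_minus_commute)
      qed
      show "(\<lambda>N. C / real N) \<longlonglongrightarrow> 0" by real_asymp
    qed
    show "poly (p N) \<in> borel_measurable (restrict_space borel {-1..1})" for N
      by (intro measurable_restrict_space1 borel_measurable_continuous_onI continuous_at_imp_continuous_on)
         (simp add: poly_isCont)
  qed
qed

section \<open>Errors of quadrature formulas\<close>

abbreviation arcsine_weight :: "real \<Rightarrow> real" where
  "arcsine_weight x \<equiv> (1 - x\<^sup>2) powr (-1/2)"

text \<open>The antiderivative is - arccos: the arcsine weight is the image of the angular measure,
  so every arc has the same mass wherever it lies.\<close>

lemma arcsine_weight_arc: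
  assumes k: "k < N"
  shows "set_integrable lebesgue (cos_arc N k) arcsine_weight"
    "(LINT x:cos_arc N k|lebesgue. arcsine_weight x) = pi / N"
proof -
  have N: "real N > 0" using k by simp
  let ?a = "cos (real (Suc k) * pi / N)" and ?b = "cos (real k * pi / N)"
  have le: "real (Suc k) * pi / N \<le> pi"
    using k N mult_right_mono[of "real (Suc k)" "real N" pi] by (simp add: field_simps)
  have le': "real k * pi / N \<le> real (Suc k) * pi / N" using N by (simp add: field_simps)
  have ab: "?a \<le> ?b" using le le' by (intro cos_monotone_0_pi_le) auto
  have bnd: "-1 \<le> ?a" "?b \<le> 1" by (rule cos_ge_minus_one, rule cos_le_one)
  have "(arcsine_weight has_integral (- arccos ?b - (- arccos ?a))) {?a..?b}"
  proof (rule fundamental_theorem_of_calculus_interior[OF ab])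
    show "continuous_on {?a..?b} (\<lambda>x. - arccos x)"
      using bnd by (intro continuous_intros continuous_on_subset[OF continuous_on_arccos']) auto
    fix x assume x: "x \<in> {?a<..<?b}"
    hence x1: "-1 < x" "x < 1" using bnd by (auto simp del: cos_ge_minus_one cos_le_one)
    hence "x\<^sup>2 < 1" by (simp add: abs_square_less_1 abs_if)
    hence "arcsine_weight x = - inverse (- sqrt (1 - x\<^sup>2))"
      by (simp add: powr_minus powr_half_sqrt)
    moreover have "((\<lambda>x. - arccos x) has_real_derivative - inverse (- sqrt (1 - x\<^sup>2))) (at x)"
      using x1 by (intro DERIV_minus DERIV_arccos)
    ultimately show "((\<lambda>x. - arccos x) has_vector_derivative arcsine_weight x) (at x)"
      by (simp add: has_real_derivative_iff_has_vector_derivative)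
  qed
  moreover have "arccos ?b = real k * pi / N" using le le' by (intro arccos_cos) auto
  moreover have "arccos ?a = real (Suc k) * pi / N" using le by (intro arccos_cos) auto
  moreover have "- (real k * pi / N) - (- (real (Suc k) * pi / N)) = pi / N"
    by (simp add: diff_divide_distrib[symmetric] algebra_simps)
  ultimately have int: "(arcsine_weight has_integral pi / N) (cos_arc N k)" by (simp add: cos_arc_def)
  hence "arcsine_weight integrable_on cos_arc N k" by blast
  thus si: "set_integrable lebesgue (cos_arc N k) arcsine_weight"
    by (rule nonnegative_absolutely_integrable_1) simp
  show "(LINT x:cos_arc N k|lebesgue. arcsine_weight x) = pi / N"
    using set_lebesgue_integral_eq_integral(2)[OF si] int by (simp add: integral_unique)
qed

lemma weighted_integrable:
  assumes w: "weight_function w" and f: "f \<in> borel_measurable (restrict_space borel {-1..1})"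
    and B: "\<And>x. x \<in> {-1..1} \<Longrightarrow> \<bar>f x\<bar> \<le> B"
  shows "set_integrable lebesgue {-1<..<1} (\<lambda>x. w x * f x)"
proof -
  have w': "integrable lebesgue (\<lambda>x. indicator {-1<..<1} x *\<^sub>R w x)"
    using w by (simp add: weight_function_def set_integrable_def)
  have "(\<lambda>x. indicator {-1..1} x *\<^sub>R f x) \<in> borel_measurable borel"
    using f by (subst (asm) borel_measurable_restrict_space_iff) auto
  hence f': "(\<lambda>x. indicator {-1..1} x *\<^sub>R f x) \<in> borel_measurable lebesgue"
    by (intro measurable_completion) simp
  have eq: "(\<lambda>x. indicator {-1<..<1} x *\<^sub>R (w x * f x)) =
      (\<lambda>x. (indicator {-1<..<1} x *\<^sub>R w x) * (indicator {-1..1} x *\<^sub>R f x))"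
    by (auto simp: fun_eq_iff indicator_def)
  have "integrable lebesgue (\<lambda>x. (indicator {-1<..<1} x *\<^sub>R w x) * (indicator {-1..1} x *\<^sub>R f x))"
  proof (rule Bochner_Integration.integrable_bound)
    show "integrable lebesgue (\<lambda>x. (indicator {-1<..<1} x *\<^sub>R w x) * B)" using w' by simp
    show "(\<lambda>x. (indicator {-1<..<1} x *\<^sub>R w x) * (indicator {-1..1} x *\<^sub>R f x)) \<in> borel_measurable lebesgue"
      using borel_measurable_integrable[OF w'] f' by (rule borel_measurable_times)
    show "AE x in lebesgue. norm ((indicator {-1<..<1} x *\<^sub>R w x) * (indicator {-1..1} x *\<^sub>R f x))
         \<le> norm ((indicator {-1<..<1} x *\<^sub>R w x) * B)"
    proof (rule AE_I2)
      fix x :: real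
      show "norm ((indicator {-1<..<1} x *\<^sub>R w x) * (indicator {-1..1} x *\<^sub>R f x))
         \<le> norm ((indicator {-1<..<1} x *\<^sub>R w x) * B)"
      proof (cases "x \<in> {-1<..<1}")
        case True
        hence "\<bar>f x\<bar> \<le> \<bar>B\<bar>" using B[of x] by auto
        thus ?thesis using True by (auto simp: abs_mult intro: mult_left_mono)
      qed simp
    qed
  qed
  thus ?thesis unfolding set_integrable_def eq .
qed

lemma borel_measurable_poly_Icc:
  fixes p :: "real poly"
  shows "poly p \<in> borel_measurable (restrict_space borel {-1..1})"
  by (intro measurable_restrict_space1 borel_measurable_continuous_onI continuous_at_imp_continuous_on)
     (simp add: poly_isCont)

lemma bounded_poly_Icc:
  fixes p :: "real poly"
  obtains B where "\<And>x. x \<in> {-1..1} \<Longrightarrow> \<bar>poly p x\<bar> \<le> B"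
proof -
  have "continuous_on {-1..1} (poly p)"
    by (rule continuous_at_imp_continuous_on) (simp add: poly_isCont)
  hence "bounded (poly p ` {-1..1})"
    by (intro compact_imp_bounded compact_continuous_image) auto
  then obtain B where "\<forall>x\<in>{-1..1}. \<bar>poly p x\<bar> \<le> B"
    unfolding bounded_iff by (auto simp del: atLeastAtMost_iff)
  thus thesis by (intro that[of B]) blast
qed

lemma weighted_integrable_poly:
  "weight_function w \<Longrightarrow> set_integrable lebesgue {-1<..<1} (\<lambda>x. w x * poly p x)"
  using weighted_integrable[OF _ borel_measurable_poly_Icc] bounded_poly_Icc by metis

lemma weighted_integral_arc_bound:
  assumes wM: "\<And>x. x \<in> {-1<..<1} \<Longrightarrow> \<bar>w x\<bar> \<le> M * arcsine_weight x" and M: "M \<ge> 0" and N: "N \<ge> 1"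
    and int: "set_integrable lebesgue {-1<..<1} (\<lambda>x. w x * h x)"
    and S: "\<And>k x. k < N \<Longrightarrow> x \<in> cos_arc N k \<Longrightarrow> \<bar>h x\<bar> \<le> S k"
  shows "\<bar>weighted_integral w h\<bar> \<le> M * pi / N * (\<Sum>k<N. S k)"
proof -
  have S0: "S k \<ge> 0" if "k < N" for k
    using S[OF that cos_tau_in_arc[OF that]] by linarith
  \<comment> \<open>G is only a majorant: neighbouring arcs share an endpoint, where two terms are
    counted.\<close>
  define G where "G = (\<lambda>x. \<Sum>k<N. S k * M * (indicator (cos_arc N k) x *\<^sub>R arcsine_weight x))"
  have Gint: "integrable lebesgue G" unfolding G_def
    using arcsine_weight_arc(1) by (auto simp: set_integrable_def)
  have "integral\<^sup>L lebesgue G = (\<Sum>k<N. S k * M * (LINT x:cos_arc N k|lebesgue. arcsine_weight x))"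
    unfolding G_def set_lebesgue_integral_def using arcsine_weight_arc(1)
    by (subst Bochner_Integration.integral_sum) (auto simp: set_integrable_def)
  also have "\<dots> = (\<Sum>k<N. S k * M * (pi / N))"
    using arcsine_weight_arc(2) by (intro sum.cong refl) (simp only: lessThan_iff)
  also have "\<dots> = M * pi / N * (\<Sum>k<N. S k)"
    unfolding sum_distrib_left by (intro sum.cong refl) simp
  finally have Gval: "integral\<^sup>L lebesgue G = M * pi / N * (\<Sum>k<N. S k)" .
  have "norm (LINT x|lebesgue. indicator {-1<..<1} x *\<^sub>R (w x * h x)) \<le>
      (LINT x|lebesgue. norm (indicator {-1<..<1} x *\<^sub>R (w x * h x)))"
    by (rule integral_norm_bound)
  also have "\<dots> \<le> integral\<^sup>L lebesgue G"
  proof (rule integral_mono)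
    show "integrable lebesgue (\<lambda>x. norm (indicator {-1<..<1} x *\<^sub>R (w x * h x)))"
      using int unfolding set_integrable_def by (rule integrable_norm)
    fix x :: real
    have nonneg: "0 \<le> S k * M * (indicator (cos_arc N k) x *\<^sub>R arcsine_weight x)" if "k < N" for k
      using S0[OF that] M by (intro mult_nonneg_nonneg) auto
    show "norm (indicator {-1<..<1} x *\<^sub>R (w x * h x)) \<le> G x"
    proof (cases "x \<in> {-1<..<1}")
      case True
      then obtain k where k: "k < N" "x \<in> cos_arc N k" using arc_cover[of x N] N by auto
      have "norm (indicator {-1<..<1} x *\<^sub>R (w x * h x)) = \<bar>w x\<bar> * \<bar>h x\<bar>"
        using True by (simp add: abs_mult)
      also have "\<dots> \<le> (M * arcsine_weight x) * S k"
        using wM[OF True] S[OF k] M by (intro mult_mono) auto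
      also have "\<dots> = S k * M * (indicator (cos_arc N k) x *\<^sub>R arcsine_weight x)"
        using k by simp
      also have "\<dots> \<le> G x" unfolding G_def using k nonneg by (intro member_le_sum) auto
      finally show ?thesis .
    next
      case False
      thus ?thesis unfolding G_def using nonneg by (auto intro: sum_nonneg)
    qed
  qed (rule Gint)
  finally show ?thesis unfolding Gval weighted_integral_def set_lebesgue_integral_def by simp
qed

text \<open>Positive formulas satisfy this with \<open>c = 1\<close>.  The Gauss-Kronrod formulas get a larger constant,
  because at the Gauss nodes only a lower bound for their weights is established, not the sign.\<close>

definition dominated :: "real \<Rightarrow> nat \<Rightarrow> (real \<Rightarrow> real) \<Rightarrow> quadrature \<Rightarrow> bool" where
  "dominated c d w Q \<longleftrightarrow> (\<forall>p. degree p \<le> d \<longrightarrow> (\<forall>x\<in>{-1..1}. 0 \<le> poly p x) \<longrightarrow>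
     (\<Sum>j=1..num_nodes Q. \<bar>coefficient Q j\<bar> * poly p (node Q j)) \<le> c * weighted_integral w (poly p))"

lemma dominated_positive:
  assumes "positive_quadrature Q" "exact_to_degree w d Q"
  shows "dominated 1 d w Q"
  unfolding dominated_def
proof (intro allI impI)
  fix p :: "real poly" assume "degree p \<le> d"
  hence "weighted_integral w (poly p) = apply_quadrature Q (poly p)"
    using assms by (simp add: exact_to_degree_def)
  also have "\<dots> = (\<Sum>j=1..num_nodes Q. \<bar>coefficient Q j\<bar> * poly p (node Q j))"
    unfolding apply_quadrature_def using assms(1)
    by (intro sum.cong) (auto simp: positive_quadrature_def)
  finally show "(\<Sum>j=1..num_nodes Q. \<bar>coefficient Q j\<bar> * poly p (node Q j)) \<le> 1 * weighted_integral w (poly p)"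
    by simp
qed

text \<open>The kernel polynomial of arc k is nonnegative and at least N^4 / 4 on that arc, so
  domination bounds the mass there by its weighted integral. The constant is 4 * 512 * 4: the
  reciprocal of the lower bound, the decay of the kernel, and the sum of the inverse
  squares.\<close>

lemma arc_mass_le:
  assumes dom: "dominated c d w Q" and c: "c \<ge> 0" and N: "N \<ge> 1" "2 * N \<le> d" and k: "k < N"
    and w: "weight_function w" and wM: "\<And>x. x \<in> {-1<..<1} \<Longrightarrow> w x \<le> M * arcsine_weight x" and M: "M \<ge> 0"
    and nodes: "node_set Q \<subseteq> {-1..1}"
  shows "(\<Sum>j=1..num_nodes Q. \<bar>coefficient Q j\<bar> * indicator (cos_arc N k) (node Q j)) \<le> 8192 * pi * c * M / N"
proof -
  obtain P S0 where P: "\<And>i. degree (P i) \<le> 2 * N - 2"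
    "\<And>i t. poly (P i) (cos t) = (fejer N (t - tau N i))\<^sup>2 + (fejer N (t + tau N i))\<^sup>2"
    using kernel_poly[OF N(1)] by metis
  have N4: "real N ^ 4 > 0" using N by simp
  define m where "m = (\<Sum>j=1..num_nodes Q. \<bar>coefficient Q j\<bar> * indicator (cos_arc N k) (node Q j))"
  have P0: "0 \<le> poly (P k) x" if "x \<in> {-1..1}" for x
  proof -
    have "x = cos (arccos x)" using that by simp
    thus ?thesis using P(2)[of k "arccos x"] by simp
  qed
  have w0: "\<bar>w x\<bar> \<le> M * arcsine_weight x" if "x \<in> {-1<..<1}" for x
    using wM[OF that] w that by (auto simp: weight_function_def)
  have "real N ^ 4 / 4 * m \<le> (\<Sum>j=1..num_nodes Q. \<bar>coefficient Q j\<bar> * poly (P k) (node Q j))"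
    unfolding m_def sum_distrib_left
  proof (rule sum_mono)
    fix j assume j: "j \<in> {1..num_nodes Q}"
    have "real N ^ 4 / 4 * indicator (cos_arc N k) (node Q j) \<le> poly (P k) (node Q j)"
    proof (cases "node Q j \<in> cos_arc N k")
      case True
      obtain t where "node Q j = cos t" "real k * pi / N \<le> t" "t \<le> real (Suc k) * pi / N"
        using arc_angle[OF True k] by metis
      thus ?thesis using True kernel_lower[OF k, of t] by (simp add: P)
    next
      case False
      have "node Q j \<in> {-1..1}" using nodes j unfolding node_set_def by blast
      thus ?thesis using False P0[of "node Q j"] by simp
    qed
    hence "\<bar>coefficient Q j\<bar> * (real N ^ 4 / 4 * indicator (cos_arc N k) (node Q j)) \<le>
        \<bar>coefficient Q j\<bar> * poly (P k) (node Q j)" by (intro mult_left_mono) auto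
    thus "real N ^ 4 / 4 * (\<bar>coefficient Q j\<bar> * indicator (cos_arc N k) (node Q j))
         \<le> \<bar>coefficient Q j\<bar> * poly (P k) (node Q j)" by (simp add: mult_ac)
  qed
  also have "\<dots> \<le> c * weighted_integral w (poly (P k))"
    using dom P(1)[of k] P0 N unfolding dominated_def by auto
  also have "\<dots> \<le> c * (M * pi / N * (\<Sum>i<N. 512 * real N ^ 4 * (1 / (1 + \<bar>real i - real k\<bar>)\<^sup>2)))"
  proof (intro mult_left_mono c order.trans[OF abs_ge_self weighted_integral_arc_bound])
    fix i x assume i: "i < N" "x \<in> cos_arc N i"
    obtain t where t: "x = cos t" "real i * pi / N \<le> t" "t \<le> real (Suc i) * pi / N"
      using arc_angle[OF i(2,1)] by metis
    have "\<bar>poly (P k) x\<bar> \<le> 512 * real N ^ 4 / (1 + \<bar>real k - real i\<bar>) ^ 4"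
      using kernel_decay[OF k i(1) t(2,3)] by (simp add: t(1) P)
    also have "\<dots> \<le> 512 * real N ^ 4 / (1 + \<bar>real k - real i\<bar>)\<^sup>2"
      by (intro divide_left_mono power_increasing mult_pos_pos) auto
    finally show "\<bar>poly (P k) x\<bar> \<le> 512 * real N ^ 4 * (1 / (1 + \<bar>real i - real k\<bar>)\<^sup>2)"
      by (simp add: abs_minus_commute)
  qed (use w0 M N w in \<open>auto intro: weighted_integrable_poly\<close>)
  also have "\<dots> \<le> c * (M * pi / N * (512 * real N ^ 4 * 4))"
    unfolding sum_distrib_left[symmetric] using c M sum_inverse_square_dist_le[of k N]
    by (intro mult_left_mono) auto
  finally have "real N ^ 4 / 4 * m \<le> real N ^ 4 / 4 * (8192 * pi * c * M / N)" by (simp add: mult_ac)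
  thus ?thesis using N4 unfolding m_def by (subst (asm) mult_le_cancel_left_pos) auto
qed

text \<open>By exactness both functionals may act on f - p; in the constant the 1 belongs to the
  integral and 8192 c to the quadrature sum.\<close>

lemma quadrature_error_le:
  assumes dom: "dominated c d w Q" and ex: "exact_to_degree w d Q" and c: "c \<ge> 0"
    and N: "N \<ge> 1" "2 * N \<le> d"
    and w: "weight_function w" and wM: "\<And>x. x \<in> {-1<..<1} \<Longrightarrow> w x \<le> M * arcsine_weight x" and M: "M \<ge> 0"
    and nodes: "node_set Q \<subseteq> {-1..1}"
    and int: "set_integrable lebesgue {-1<..<1} (\<lambda>x. w x * f x)"
    and p: "degree p \<le> d" and S: "\<And>k x. k < N \<Longrightarrow> x \<in> cos_arc N k \<Longrightarrow> \<bar>f x - poly p x\<bar> \<le> S k"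
  shows "\<bar>weighted_integral w f - apply_quadrature Q f\<bar> \<le> (1 + 8192 * c) * pi * M / N * (\<Sum>k<N. S k)"
proof -
  define h where "h = (\<lambda>x. f x - poly p x)"
  note intp = weighted_integrable_poly[OF w, of p]
  have inth: "set_integrable lebesgue {-1<..<1} (\<lambda>x. w x * h x)"
    unfolding h_def right_diff_distrib by (rule set_integral_diff(1)[OF int intp])
  have Ih: "weighted_integral w h = weighted_integral w f - weighted_integral w (poly p)"
    unfolding h_def weighted_integral_def right_diff_distrib by (rule set_integral_diff(2)[OF int intp])
  have Qh: "apply_quadrature Q h = apply_quadrature Q f - apply_quadrature Q (poly p)"
    by (simp add: h_def apply_quadrature_def right_diff_distrib sum_subtractf)
  have w0: "\<bar>w x\<bar> \<le> M * arcsine_weight x" if "x \<in> {-1<..<1}" for x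
    using wM[OF that] w that by (auto simp: weight_function_def)
  have hS: "\<bar>h x\<bar> \<le> S k" if "k < N" "x \<in> cos_arc N k" for k x
    using S that by (simp add: h_def)
  have S0: "S k \<ge> 0" if "k < N" for k
    using hS[OF that cos_tau_in_arc[OF that]] by linarith
  have 1: "\<bar>weighted_integral w h\<bar> \<le> M * pi / N * (\<Sum>k<N. S k)"
    by (rule weighted_integral_arc_bound[OF w0 M N(1) inth hS])
  have "\<bar>apply_quadrature Q h\<bar> \<le> (\<Sum>j=1..num_nodes Q. \<bar>coefficient Q j\<bar> * (\<Sum>k<N. S k * indicator (cos_arc N k) (node Q j)))"
    unfolding apply_quadrature_def
  proof (rule order.trans[OF sum_abs sum_mono])
    fix j assume "j \<in> {1..num_nodes Q}"
    hence "node Q j \<in> {-1..1}" using nodes unfolding node_set_def by blast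
    then obtain k where k: "k < N" "node Q j \<in> cos_arc N k" using arc_cover N by blast
    have "\<bar>h (node Q j)\<bar> \<le> S k * indicator (cos_arc N k) (node Q j)" using hS k by simp
    also have "\<dots> \<le> (\<Sum>k<N. S k * indicator (cos_arc N k) (node Q j))"
      using k S0 by (intro member_le_sum) auto
    finally show "\<bar>coefficient Q j * h (node Q j)\<bar> \<le>
        \<bar>coefficient Q j\<bar> * (\<Sum>k<N. S k * indicator (cos_arc N k) (node Q j))"
      unfolding abs_mult by (intro mult_left_mono) auto
  qed
  also have "\<dots> = (\<Sum>k<N. S k * (\<Sum>j=1..num_nodes Q. \<bar>coefficient Q j\<bar> * indicator (cos_arc N k) (node Q j)))"
    unfolding sum_distrib_left by (subst sum.swap) (simp add: mult_ac)
  also have "\<dots> \<le> (\<Sum>k<N. S k * (8192 * pi * c * M / N))"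
    by (intro sum_mono mult_left_mono arc_mass_le[OF dom c N _ w wM M nodes]) (auto simp: S0)
  finally have 2: "\<bar>apply_quadrature Q h\<bar> \<le> 8192 * pi * c * M / N * (\<Sum>k<N. S k)"
    unfolding sum_distrib_right[symmetric] by (simp add: mult.commute)
  have "apply_quadrature Q (poly p) = weighted_integral w (poly p)"
    using ex p by (simp add: exact_to_degree_def)
  hence "weighted_integral w f - apply_quadrature Q f = weighted_integral w h - apply_quadrature Q h"
    using Ih Qh by simp
  hence "\<bar>weighted_integral w f - apply_quadrature Q f\<bar> \<le> M * pi / N * (\<Sum>k<N. S k) + 8192 * pi * c * M / N * (\<Sum>k<N. S k)"
    using 1 2 by linarith
  also have "\<dots> = (1 + 8192 * c) * pi * M / N * (\<Sum>k<N. S k)"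
    by (simp add: algebra_simps add_divide_distrib)
  finally show ?thesis .
qed

text \<open>The hypothesis speaks of degrees instead of the number of nodes, so that Gauss-Kronrod
  formulas, with 2 n + 1 nodes at index n, are covered too.\<close>

lemma error_order_of_dominated:
  assumes adm: "admissible w" and f: "f \<in> V s" and c: "c \<ge> 0"
    and Q: "\<forall>\<^sub>F n in sequentially. node_set (Q n) \<subseteq> {-1..1} \<and> exact_to_degree w (n - 1) (Q n) \<and> dominated c (n - 1) w (Q n)"
  shows "error_order w Q f s"
proof -
  obtain M where M: "M > 0" and wM: "\<And>x. x \<in> {-1<..<1} \<Longrightarrow> w x \<le> M * arcsine_weight x"
    and w: "weight_function w"
    using adm unfolding admissible_def by blast
  obtain C where C: "C \<ge> 0" "\<And>N. N \<ge> 1 \<Longrightarrow> \<exists>p S. degree p \<le> 2 * N + s \<and>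
     (\<forall>k<N. \<forall>x\<in>cos_arc N k. \<bar>f x - poly p x\<bar> \<le> S k) \<and> (\<Sum>k<N. S k) \<le> C / real N ^ s"
    using arc_approximable_V[OF f] unfolding arc_approximable_def by blast
  obtain B where B: "\<And>x. x \<in> {-1..1} \<Longrightarrow> \<bar>f x\<bar> \<le> B"
    using bounded_of_arc_approximable[OF arc_approximable_V[OF f]] by metis
  note int = weighted_integrable[OF w borel_measurable_V[OF f] B]
  define K where "K = (1 + 8192 * c) * pi * M"
  have K: "K \<ge> 0" using c M by (simp add: K_def)
  show ?thesis unfolding error_order_def
  proof (rule bigoI[where c = "K * C * 4 ^ (s + 1)"])
    show "\<forall>\<^sub>F n in sequentially. norm (weighted_integral w f - apply_quadrature (Q n) f)
        \<le> K * C * 4 ^ (s + 1) * norm (1 / real n ^ (s + 1))"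
      using Q eventually_ge_at_top[of "2 * s + 10"]
    proof eventually_elim
      case (elim n)
      \<comment> \<open>The largest N for which a polynomial of degree 2 N + s is still integrated
        exactly. Since n >= 2 s + 10, it satisfies n <= 4 N, which converts powers of N into powers
        of n.\<close>
      define N where "N = (n - 1 - s) div 2"
      have N: "N \<ge> 1" "2 * N + s \<le> n - 1" "n \<le> 4 * N" using elim(2) unfolding N_def by auto
      from C(2)[OF N(1)] obtain p S where p: "degree p \<le> 2 * N + s"
        "\<And>k x. k < N \<Longrightarrow> x \<in> cos_arc N k \<Longrightarrow> \<bar>f x - poly p x\<bar> \<le> S k" "(\<Sum>k<N. S k) \<le> C / real N ^ s"
        by blast
      have "\<bar>weighted_integral w f - apply_quadrature (Q n) f\<bar> \<le> K / N * (\<Sum>k<N. S k)"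
        unfolding K_def
        by (rule quadrature_error_le[where d = "n - 1" and p = p]) (use elim(1) c N w wM M int p in auto)
      also have "\<dots> \<le> K / N * (C / real N ^ s)"
        using K by (intro mult_left_mono p) auto
      also have "\<dots> = K * C / real N ^ (s + 1)" by simp
      also have "\<dots> \<le> K * C / (real n / 4) ^ (s + 1)"
        using N elim(2) K C(1) by (intro divide_left_mono power_mono mult_pos_pos) auto
      also have "\<dots> = K * C * 4 ^ (s + 1) * norm (1 / real n ^ (s + 1))"
        by (simp add: power_divide)
      finally show ?case by simp
    qed
  qed
qed

section \<open>Positive weights\<close>

lemma weighted_integral_nonneg:
  assumes "weight_function w" "\<And>x. x \<in> {-1<..<1} \<Longrightarrow> 0 \<le> g x"
  shows "0 \<le> weighted_integral w g"
  unfolding weighted_integral_def set_lebesgue_integral_def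
  using assms by (intro integral_nonneg_AE AE_I2) (auto simp: weight_function_def indicator_def)

lemma apply_quadrature_single:
  assumes "j \<in> {1..num_nodes Q}" "\<And>i. i \<in> {1..num_nodes Q} \<Longrightarrow> i \<noteq> j \<Longrightarrow> g (node Q i) = 0"
  shows "apply_quadrature Q g = coefficient Q j * g (node Q j)"
proof -
  have "apply_quadrature Q g = (\<Sum>i\<in>{j}. coefficient Q i * g (node Q i))"
    unfolding apply_quadrature_def using assms by (intro sum.mono_neutral_right) auto
  thus ?thesis by simp
qed

lemma coefficient_nonneg_of_test_poly:
  assumes "exact_to_degree w d Q" "degree p \<le> d" "j \<in> {1..num_nodes Q}"
    and "\<And>i. i \<in> {1..num_nodes Q} \<Longrightarrow> i \<noteq> j \<Longrightarrow> poly p (node Q i) = 0"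
    and "poly p (node Q j) > 0" "0 \<le> weighted_integral w (poly p)"
  shows "0 \<le> coefficient Q j"
proof -
  have "coefficient Q j * poly p (node Q j) = weighted_integral w (poly p)"
    using apply_quadrature_single[of j Q "poly p"] assms by (simp add: exact_to_degree_def)
  thus ?thesis using assms(5,6) by (metis zero_le_mult_iff not_le)
qed

lemma quadrature_formula_node_inj:
  assumes "quadrature_formula n Q" "i \<in> {1..n}" "j \<in> {1..n}" "i \<noteq> j"
  shows "node Q i \<noteq> node Q j"
  using assms by (meson inj_onD quadrature_formula_def strict_mono_on_imp_inj_on)

text \<open>The square of a Lagrange polynomial has degree 2 n - 2, which is just the exactness of a
  Radau formula.\<close>

lemma positive_of_exact:
  assumes Q: "quadrature_formula n Q" and ex: "exact_to_degree w (2 * n - 2) Q" and w: "weight_function w"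
  shows "positive_quadrature Q"
  unfolding positive_quadrature_def
proof
  fix j assume j: "j \<in> {1..num_nodes Q}"
  have n: "num_nodes Q = n" using Q by (simp add: quadrature_formula_def)
  define p where "p = (\<Prod>i\<in>{1..n}-{j}. [:- node Q i, 1:])"
  have "degree p = n - 1"
    unfolding p_def using j n by (subst degree_prod_eq_sum_degree) auto
  hence "degree (p\<^sup>2) \<le> 2 * n - 2"
    using degree_power_le[of p 2] by simp
  moreover have "poly (p\<^sup>2) (node Q i) = 0" if "i \<in> {1..num_nodes Q}" "i \<noteq> j" for i
    using that n by (auto simp: p_def poly_prod)
  moreover have "poly p (node Q j) \<noteq> 0"
    using quadrature_formula_node_inj[OF Q] j n by (auto simp: p_def poly_prod)
  hence "poly (p\<^sup>2) (node Q j) > 0" by simp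
  moreover have "0 \<le> weighted_integral w (poly (p\<^sup>2))" by (rule weighted_integral_nonneg[OF w]) simp
  ultimately show "0 \<le> coefficient Q j" by (intro coefficient_nonneg_of_test_poly[OF ex _ j, of "p\<^sup>2"]) auto
qed

section \<open>Chebyshev polynomials of the second kind and moments for the weight 1\<close>

fun cheb_U :: "nat \<Rightarrow> real poly" where
  "cheb_U 0 = 1"
| "cheb_U (Suc 0) = [:0, 2:]"
| "cheb_U (Suc (Suc n)) = [:0, 2:] * cheb_U (Suc n) - cheb_U n"

lemma poly_cheb_U_cos: "poly (cheb_U n) (cos t) * sin t = sin (real (Suc n) * t)"
proof (induction n rule: cheb_U.induct)
  case 2
  show ?case using sin_double[of t] by (simp add: mult_ac)
next
  case (3 n)
  have "sin (real (Suc (Suc (Suc n))) * t) = 2 * cos t * sin (real (Suc (Suc n)) * t) - sin (real (Suc n) * t)"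
    using sin_add[of "real (Suc (Suc n)) * t" t] sin_diff[of "real (Suc (Suc n)) * t" t]
    by (simp add: algebra_simps)
  also have "\<dots> = poly (cheb_U (Suc (Suc n))) (cos t) * sin t"
    unfolding 3[symmetric] by (simp add: algebra_simps)
  finally show ?case by simp
qed auto

lemma degree_cheb_U_le: "degree (cheb_U n) \<le> n"
proof (induction n rule: cheb_U.induct)
  case (3 n)
  have "degree ([:0, 2:] * cheb_U (Suc n)) \<le> Suc (Suc n)"
    by (rule order.trans[OF degree_mult_le]) (use 3 in auto)
  with 3 show ?case by (auto intro!: degree_diff_le)
qed auto

text \<open>The factor sin t is kept on both sides because \<open>cheb_U\<close> has its
  trigonometric form only after multiplication by it.\<close>

lemma poly_eqI_cos:
  fixes p q :: "real poly"
  assumes "\<And>t. 0 < t \<Longrightarrow> t < pi \<Longrightarrow> poly p (cos t) * sin t = poly q (cos t) * sin t"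
  shows "p = q"
proof (rule ccontr)
  assume "p \<noteq> q"
  hence "finite {x. poly (p - q) x = 0}" by (intro poly_roots_finite) simp
  moreover have "{-1<..<1} \<subseteq> {x. poly (p - q) x = 0}"
  proof
    fix x :: real assume x: "x \<in> {-1<..<1}"
    have t: "0 < arccos x" "arccos x < pi" using x arccos_lt_bounded[of x] by auto
    have "sin (arccos x) \<noteq> 0" using sin_gt_zero[OF t] by simp
    thus "x \<in> {x. poly (p - q) x = 0}" using assms[OF t] x by simp
  qed
  ultimately have "finite {-1<..<1::real}" by (rule rev_finite_subset)
  thus False using infinite_Ioo[of "-1" "1::real"] by simp
qed

lemma pderiv_cheb_T: "pderiv (cheb_T (Suc n)) = smult (real (Suc n)) (cheb_U n)"
proof (rule poly_eqI_cos)
  fix t :: real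
  have "((\<lambda>t. poly (cheb_T (Suc n)) (cos t)) has_real_derivative
      poly (pderiv (cheb_T (Suc n))) (cos t) * (- sin t)) (at t)"
    by (rule DERIV_chain2[OF poly_DERIV]) (auto intro!: derivative_eq_intros)
  moreover have "((\<lambda>t. cos (real (Suc n) * t)) has_real_derivative - (real (Suc n) * sin (real (Suc n) * t))) (at t)"
    by (auto intro!: derivative_eq_intros)
  ultimately have "poly (pderiv (cheb_T (Suc n))) (cos t) * (- sin t) = - (real (Suc n) * sin (real (Suc n) * t))"
    unfolding poly_cheb_T_cos by (rule DERIV_unique)
  thus "poly (pderiv (cheb_T (Suc n))) (cos t) * sin t = poly (smult (real (Suc n)) (cheb_U n)) (cos t) * sin t"
    using poly_cheb_U_cos[of n t] by (simp add: mult.assoc)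
qed

lemma cheb_T_eq_diff_cheb_U: "smult 2 (cheb_T (Suc (Suc n))) = cheb_U (Suc (Suc n)) - cheb_U n"
proof (rule poly_eqI_cos)
  fix t :: real
  have "sin (real (Suc (Suc (Suc n))) * t) - sin (real (Suc n) * t) = 2 * cos (real (Suc (Suc n)) * t) * sin t"
    using sin_add[of "real (Suc (Suc n)) * t" t] sin_diff[of "real (Suc (Suc n)) * t" t]
    by (simp add: algebra_simps)
  thus "poly (smult 2 (cheb_T (Suc (Suc n)))) (cos t) * sin t = poly (cheb_U (Suc (Suc n)) - cheb_U n) (cos t) * sin t"
    using poly_cheb_U_cos[of n t] poly_cheb_U_cos[of "Suc (Suc n)" t]
    by (simp add: poly_cheb_T_cos left_diff_distrib del: cheb_T.simps cheb_U.simps of_nat_Suc)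
qed

lemma weight_function_one: "weight_function (\<lambda>_. 1)"
  unfolding weight_function_def set_integrable_def by (auto intro!: integrable_mult_left)

lemma admissible_one: "admissible (\<lambda>_. 1)"
  unfolding admissible_def
proof (intro conjI exI[of _ 1] ballI)
  fix x :: real assume "x \<in> {-1<..<1}"
  hence "x\<^sup>2 < 1" by (auto simp: abs_square_less_1 abs_if)
  hence "(1 - x\<^sup>2) powr (1/2) \<le> 1" "(1 - x\<^sup>2) powr (1/2) > 0" by (auto simp: powr_half_sqrt)
  hence "1 \<le> inverse ((1 - x\<^sup>2) powr (1/2))" by (simp add: one_le_inverse_iff)
  also have "\<dots> = (1 - x\<^sup>2) powr (-1/2)" by (simp add: powr_minus)
  finally show "1 \<le> 1 * (1 - x\<^sup>2) powr (-1/2)" by simp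
qed (auto simp: weight_function_one)

lemma integral_one_pderiv: "weighted_integral (\<lambda>_. 1) (poly (pderiv P)) = poly P 1 - poly P (-1)"
proof -
  have "(poly (pderiv P) has_integral (poly P 1 - poly P (-1))) {-1..1}"
    by (rule fundamental_theorem_of_calculus)
       (auto simp: has_real_derivative_iff_has_vector_derivative[symmetric]
          intro!: has_field_derivative_at_within[OF poly_DERIV])
  hence "(poly (pderiv P) has_integral (poly P 1 - poly P (-1))) {-1<..<1}"
    by (simp add: has_integral_Icc_iff_Ioo)
  moreover have "set_integrable lebesgue {-1<..<1} (poly (pderiv P))"
    using weighted_integrable_poly[OF weight_function_one, of "pderiv P"] by simp
  ultimately show ?thesis
    unfolding weighted_integral_def by (simp add: set_lebesgue_integral_eq_integral(2) integral_unique)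
qed

lemma weighted_integral_poly_add:
  "weight_function w \<Longrightarrow> weighted_integral w (poly (p + q)) = weighted_integral w (poly p) + weighted_integral w (poly q)"
  unfolding weighted_integral_def using set_integral_add(2)[OF weighted_integrable_poly weighted_integrable_poly, of w w p q]
  by (simp add: distrib_left)

lemma weighted_integral_poly_smult:
  "weighted_integral w (poly (smult c p)) = c * weighted_integral w (poly p)"
  unfolding weighted_integral_def set_integral_mult_right[symmetric] by (simp add: mult_ac)

lemma weighted_integral_poly_zero [simp]: "weighted_integral w (poly 0) = 0"
  by (simp add: weighted_integral_def)

lemma weighted_integral_poly_diff:
  assumes "weight_function w"
  shows "weighted_integral w (poly (p - q)) = weighted_integral w (poly p) - weighted_integral w (poly q)"
  using weighted_integral_poly_add[OF assms, of p "smult (-1) q"] weighted_integral_poly_smult[of w "-1" q] by simp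

lemma weighted_integral_poly_sum:
  assumes "weight_function w"
  shows "weighted_integral w (poly (\<Sum>i\<in>A. p i)) = (\<Sum>i\<in>A. weighted_integral w (poly (p i)))"
  by (induction A rule: infinite_finite_induct)
     (simp_all only: sum.infinite sum.empty sum.insert weighted_integral_poly_zero weighted_integral_poly_add[OF assms] not_False_eq_True)

lemma poly_cheb_T_1: "poly (cheb_T n) 1 = 1" "poly (cheb_T n) (-1) = (-1) ^ n"
  using poly_cheb_T_cos[of n 0] poly_cheb_T_cos[of n pi] by simp_all

definition cheb_int :: "nat \<Rightarrow> real" where
  "cheb_int n = weighted_integral (\<lambda>_. 1) (poly (cheb_T n))"

lemma integral_cheb_U: "weighted_integral (\<lambda>_. 1) (poly (cheb_U n)) = (1 - (-1) ^ Suc n) / real (Suc n)"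
proof -
  have "real (Suc n) * weighted_integral (\<lambda>_. 1) (poly (cheb_U n)) = 1 - (-1) ^ Suc n"
    using integral_one_pderiv[of "cheb_T (Suc n)"]
    unfolding pderiv_cheb_T weighted_integral_poly_smult poly_cheb_T_1 .
  thus ?thesis by (simp add: field_simps)
qed

lemma cheb_int_simps:
  "cheb_int 0 = 2" "cheb_int 1 = 0"
  "cheb_int (Suc (Suc n)) = (if even n then 1 / real (n + 3) - 1 / real (n + 1) else 0)"
proof -
  show "cheb_int 0 = 2" using integral_cheb_U[of 0] by (simp add: cheb_int_def)
  have "2 * cheb_int 1 = weighted_integral (\<lambda>_. 1) (poly (cheb_U 1))"
    unfolding cheb_int_def weighted_integral_poly_smult[symmetric] by simp
  also have "\<dots> = (1 - (-1) ^ Suc 1) / real (Suc 1)" by (rule integral_cheb_U)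
  finally show "cheb_int 1 = 0" by simp
  have "2 * cheb_int (Suc (Suc n)) = weighted_integral (\<lambda>_. 1) (poly (smult 2 (cheb_T (Suc (Suc n)))))"
    by (simp only: weighted_integral_poly_smult cheb_int_def)
  also have "\<dots> = (1 - (-1) ^ Suc (Suc (Suc n))) / real (Suc (Suc (Suc n))) - (1 - (-1) ^ Suc n) / real (Suc n)"
    unfolding cheb_T_eq_diff_cheb_U weighted_integral_poly_diff[OF weight_function_one] integral_cheb_U ..
  finally show "cheb_int (Suc (Suc n)) = (if even n then 1 / real (n + 3) - 1 / real (n + 1) else 0)"
    by (cases "even n") (auto simp: add.commute)
qed

text \<open>The odd moments vanish, and the even ones, of modulus 1 / (k - 1) - 1 / (k + 1),
  telescope. The bound 1 equals the integral of the constant 1/2, so that this constant term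
  outweighs all the others in the cosine sums below.\<close>

lemma sum_abs_cheb_int_le: "(\<Sum>k=1..n. \<bar>cheb_int k\<bar>) \<le> 1"
proof -
  have "(\<Sum>k=1..Suc n. \<bar>cheb_int k\<bar>) = 1 - 1 / real (if even n then n + 1 else n + 2)" for n
  proof (induction n)
    case 0
    show ?case using cheb_int_simps(2) by simp
  next
    case (Suc n)
    have "1 / real (n + 3) \<le> 1 / real (n + 1)" by (intro divide_left_mono) auto
    thus ?case using Suc.IH
      by (cases "even n") (auto simp: cheb_int_simps(3) sum.nat_ivl_Suc' add.commute)
  qed
  from this[of "n - 1"] show ?thesis by (cases n) (auto simp del: sum.cl_ivl_Suc)
qed

definition dirichlet :: "nat \<Rightarrow> real \<Rightarrow> real" where
  "dirichlet L a = 1 / 2 + (\<Sum>k=1..<L. cos (real k * a))"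

lemma dirichlet_mult_sin: "L \<ge> 1 \<Longrightarrow> 2 * sin (a / 2) * dirichlet L a = sin ((real L - 1 / 2) * a)"
proof (induction L rule: dec_induct)
  case base
  show ?case by (simp add: dirichlet_def)
next
  case (step L)
  have "2 * sin (a / 2) * dirichlet (Suc L) a = sin ((real L - 1 / 2) * a) + 2 * sin (a / 2) * cos (real L * a)"
    using step by (simp add: dirichlet_def algebra_simps)
  also have "\<dots> = sin ((real (Suc L) - 1 / 2) * a)"
    using sin_add[of "real L * a" "a / 2"] sin_diff[of "real L * a" "a / 2"]
    by (simp add: algebra_simps)
  finally show ?case .
qed

text \<open>At t = a pi / L one has (L - 1/2) t = a pi - t / 2, so the sine of t / 2 cancels and
  only the values 1/2 and -1/2 remain; the range of a excludes the peaks of the kernel. The second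
  form is the kernel with its next term halved, as in the trapezoidal rule.\<close>

lemma dirichlet_at_multiple:
  assumes L: "L \<ge> 1" and a: "0 < \<bar>a\<bar>" "\<bar>a\<bar> < 2 * int L"
  shows "dirichlet L (of_int a * pi / L) = - cos (of_int a * pi) / 2"
    "dirichlet L (of_int a * pi / L) + cos (of_int a * pi) / 2 = 0"
proof -
  define x where "x = of_int a * pi / (2 * real L)"
  have "sin \<bar>x\<bar> > 0"
  proof (rule sin_gt_zero)
    show "0 < \<bar>x\<bar>" using a L by (simp add: x_def)
    have "real_of_int \<bar>a\<bar> < 2 * real L" using a by linarith
    hence "real_of_int \<bar>a\<bar> * pi < 2 * real L * pi" by simp
    thus "\<bar>x\<bar> < pi" using L by (simp add: x_def abs_mult field_simps)
  qed
  hence s: "sin x \<noteq> 0" by (auto simp: abs_if split: if_splits)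
  have "(real L - 1 / 2) * (of_int a * pi / L) = of_int a * pi - x"
    using L by (simp add: x_def field_simps)
  moreover have "sin (of_int a * pi - x) = - (cos (of_int a * pi) * sin x)"
    using sin_zero_iff_int2[of "of_int a * pi"] by (auto simp: sin_diff)
  moreover have "of_int a * pi / L / 2 = x" by (simp add: x_def)
  ultimately have "2 * sin x * dirichlet L (of_int a * pi / L) = - (cos (of_int a * pi) * sin x)"
    using dirichlet_mult_sin[OF L, of "of_int a * pi / L"] by simp
  hence "sin x * (2 * dirichlet L (of_int a * pi / L) + cos (of_int a * pi)) = 0" by algebra
  hence "2 * dirichlet L (of_int a * pi / L) + cos (of_int a * pi) = 0" using s by (simp only: mult_eq_0_iff simp_thms)
  thus 1: "dirichlet L (of_int a * pi / L) = - cos (of_int a * pi) / 2" by algebra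
  show "dirichlet L (of_int a * pi / L) + cos (of_int a * pi) / 2 = 0" unfolding 1 by simp
qed

text \<open>Nodes increase with their index while the cosines may decrease, so angles and nodes are
  matched through the node set. The test polynomial is a positive multiple of a Lagrange polynomial
  on the nodes.\<close>

lemma positive_of_angles:
  assumes Q: "quadrature_formula n Q" and ex: "exact_to_degree (\<lambda>_. 1) d Q"
    and nodes: "node_set Q = (\<lambda>j. cos (\<theta> j)) ` {1..n}"
    and p: "\<And>m. m \<in> {1..n} \<Longrightarrow> \<exists>p. degree p \<le> d \<and> (\<forall>i\<in>{1..n}. i \<noteq> m \<longrightarrow> poly p (cos (\<theta> i)) = 0) \<and>
       poly p (cos (\<theta> m)) > 0 \<and> 0 \<le> weighted_integral (\<lambda>_. 1) (poly p)"
  shows "positive_quadrature Q"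
  unfolding positive_quadrature_def
proof
  fix j assume j: "j \<in> {1..num_nodes Q}"
  have n: "num_nodes Q = n" using Q by (simp add: quadrature_formula_def)
  have ang: "\<exists>i\<in>{1..n}. node Q k = cos (\<theta> i)" if "k \<in> {1..n}" for k
    using nodes that n by (auto simp: node_set_def)
  then obtain m where m: "m \<in> {1..n}" "node Q j = cos (\<theta> m)" using j n by blast
  then obtain p where p': "degree p \<le> d" "\<forall>i\<in>{1..n}. i \<noteq> m \<longrightarrow> poly p (cos (\<theta> i)) = 0"
       "poly p (cos (\<theta> m)) > 0" "0 \<le> weighted_integral (\<lambda>_. 1) (poly p)" using p by blast
  show "0 \<le> coefficient Q j"
  proof (rule coefficient_nonneg_of_test_poly[OF ex p'(1) j])
    fix i assume i: "i \<in> {1..num_nodes Q}" "i \<noteq> j"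
    obtain m' where m': "m' \<in> {1..n}" "node Q i = cos (\<theta> m')" using ang i n by blast
    have "node Q i \<noteq> node Q j" using quadrature_formula_node_inj[OF Q] i j n by auto
    hence "m' \<noteq> m" using m m' by auto
    thus "poly p (node Q i) = 0" using p'(2) m' by simp
  qed (use p' m in auto)
qed

lemma sum_cos_product:
  "1 / 2 + (\<Sum>k=1..<L. cos (real k * a) * cos (real k * b)) = (dirichlet L (a - b) + dirichlet L (a + b)) / 2"
proof -
  have "(\<Sum>k=1..<L. cos (real k * a) * cos (real k * b)) =
      (\<Sum>k=1..<L. (cos (real k * (a - b)) + cos (real k * (a + b))) / 2)"
    by (intro sum.cong refl) (simp add: cos_times_cos algebra_simps)
  thus ?thesis by (simp add: dirichlet_def sum.distrib flip: sum_divide_distrib)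
qed

lemma sum_sin_product:
  "(\<Sum>k=1..<L. sin (real k * a) * sin (real k * b)) = (dirichlet L (a - b) - dirichlet L (a + b)) / 2"
proof -
  have "(\<Sum>k=1..<L. sin (real k * a) * sin (real k * b)) =
      (\<Sum>k=1..<L. (cos (real k * (a - b)) - cos (real k * (a + b))) / 2)"
    by (intro sum.cong refl) (simp add: sin_times_sin algebra_simps)
  thus ?thesis by (simp add: dirichlet_def sum_subtractf flip: sum_divide_distrib)
qed

lemma cos_int_pi_cong: "even (a - b) \<Longrightarrow> cos (of_int a * pi) = cos (of_int b * pi)"
  "odd (a - b) \<Longrightarrow> cos (of_int a * pi) = - cos (of_int b * pi)"
proof -
  have cos_int_pi: "cos (of_int c * pi) = (if even c then 1 else -1)" for c :: int
  proof (cases c rule: int_cases2)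
    case (nonneg n)
    thus ?thesis by (simp add: cos_npi minus_one_power_iff)
  next
    case (nonpos n)
    hence "cos (of_int c * pi) = cos (real n * pi)" by simp
    thus ?thesis using nonpos by (simp add: cos_npi minus_one_power_iff)
  qed
  show "even (a - b) \<Longrightarrow> cos (of_int a * pi) = cos (of_int b * pi)"
    "odd (a - b) \<Longrightarrow> cos (of_int a * pi) = - cos (of_int b * pi)"
    unfolding cos_int_pi by auto
qed

lemma polya_positive:
  assumes Q: "polya_formula (\<lambda>_. 1) n Q" and n: "n \<ge> 1"
  shows "positive_quadrature Q"
proof (rule positive_of_angles)
  show "quadrature_formula n Q" "exact_to_degree (\<lambda>_. 1) (n - 1) Q"
    "node_set Q = (\<lambda>j. cos ((2 * real j - 1) * pi / (2 * real n))) ` {1..n}"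
    using Q by (auto simp: polya_formula_def interpolatory_def quadrature_formula_def)
  fix m assume m: "m \<in> {1..n}"
  define \<theta> where "\<theta> = (\<lambda>j. (2 * real j - 1) * pi / (2 * real n))"
  \<comment> \<open>Discrete orthogonality of the cosines makes p a positive multiple of the
    Lagrange polynomial at the node of \<open>\<theta> m\<close>.\<close>
  define p where "p = [:1/2:] + (\<Sum>k=1..<n. smult (cos (real k * \<theta> m)) (cheb_T k))"
  have "degree p \<le> n - 1" unfolding p_def
    by (intro degree_add_le degree_sum_le) (auto intro: order.trans[OF degree_smult_le] order.trans[OF degree_cheb_T_le])
  moreover have val: "poly p (cos t) = (dirichlet n (\<theta> m - t) + dirichlet n (\<theta> m + t)) / 2" for t
    unfolding sum_cos_product[symmetric] by (simp add: p_def poly_sum poly_cheb_T_cos)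
  have "poly p (cos (\<theta> i)) = 0" if i: "i \<in> {1..n}" "i \<noteq> m" for i
  proof -
    have "\<theta> m - \<theta> i = of_int (int m - int i) * pi / n" "\<theta> m + \<theta> i = of_int (int m + int i - 1) * pi / n"
      using n by (auto simp: \<theta>_def field_simps)
    moreover have "dirichlet n (of_int (int m - int i) * pi / n) = - cos (of_int (int m - int i) * pi) / 2"
      by (rule dirichlet_at_multiple) (use m i n in auto)
    moreover have "dirichlet n (of_int (int m + int i - 1) * pi / n) = - cos (of_int (int m + int i - 1) * pi) / 2"
      by (rule dirichlet_at_multiple) (use m i n in auto)
    \<comment> \<open>The two integers have opposite parity, so the two Dirichlet values
      cancel.\<close>
    moreover have "cos (of_int (int m - int i) * pi) = - cos (of_int (int m + int i - 1) * pi)"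
      by (rule cos_int_pi_cong) simp
    ultimately show ?thesis unfolding val by simp
  qed
  moreover have "0 \<le> (\<Sum>k=1..<n. cos (real k * \<theta> m) * cos (real k * \<theta> m))" by (intro sum_nonneg) simp
  hence "poly p (cos (\<theta> m)) > 0" by (simp add: p_def poly_sum poly_cheb_T_cos)
  moreover have "0 \<le> weighted_integral (\<lambda>_. 1) (poly p)"
  proof -
    have "weighted_integral (\<lambda>_. 1) (poly [:1/2:]) = 1"
      using cheb_int_simps(1) weighted_integral_poly_smult[of "\<lambda>_. 1" "1/2" 1] by (simp add: cheb_int_def one_pCons)
    hence "weighted_integral (\<lambda>_. 1) (poly p) = 1 + (\<Sum>k=1..<n. cos (real k * \<theta> m) * cheb_int k)"
      unfolding p_def
      by (simp add: weighted_integral_poly_add weighted_integral_poly_sum weighted_integral_poly_smult weight_function_one cheb_int_def)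
    moreover have "\<bar>\<Sum>k=1..<n. cos (real k * \<theta> m) * cheb_int k\<bar> \<le> (\<Sum>k=1..n. \<bar>cheb_int k\<bar>)"
    proof (rule order.trans[OF sum_abs])
      have "(\<Sum>k=1..<n. \<bar>cos (real k * \<theta> m) * cheb_int k\<bar>) \<le> (\<Sum>k=1..<n. \<bar>cheb_int k\<bar>)"
        by (intro sum_mono) (simp add: abs_mult mult_left_le_one_le)
      also have "\<dots> \<le> (\<Sum>k=1..n. \<bar>cheb_int k\<bar>)" by (intro sum_mono2) auto
      finally show "(\<Sum>k=1..<n. \<bar>cos (real k * \<theta> m) * cheb_int k\<bar>) \<le> (\<Sum>k=1..n. \<bar>cheb_int k\<bar>)" .
    qed
    ultimately show ?thesis using sum_abs_cheb_int_le[of n] by linarith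
  qed
  ultimately show "\<exists>p. degree p \<le> n - 1 \<and> (\<forall>i\<in>{1..n}. i \<noteq> m \<longrightarrow> poly p (cos ((2 * real i - 1) * pi / (2 * real n))) = 0) \<and>
       poly p (cos ((2 * real m - 1) * pi / (2 * real n))) > 0 \<and> 0 \<le> weighted_integral (\<lambda>_. 1) (poly p)"
    unfolding \<theta>_def by blast
qed

lemma clenshaw_curtis_positive:
  assumes Q: "clenshaw_curtis_formula (\<lambda>_. 1) n Q" and n: "n \<ge> 2"
  shows "positive_quadrature Q"
proof (rule positive_of_angles)
  show "quadrature_formula n Q" "exact_to_degree (\<lambda>_. 1) (n - 1) Q"
    "node_set Q = (\<lambda>j. cos ((real j - 1) * pi / (real n - 1))) ` {1..n}"
    using Q by (auto simp: clenshaw_curtis_formula_def interpolatory_def quadrature_formula_def)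
  fix m assume m: "m \<in> {1..n}"
  define L where "L = n - 1"
  have L: "L \<ge> 1" "real n - 1 = real L" using n by (auto simp: L_def)
  define \<theta> where "\<theta> = (\<lambda>j. (real j - 1) * pi / real L)"
  \<comment> \<open>Halving the end frequency L turns both Dirichlet kernels into their trapezoidal
    form, and each of them vanishes separately at the other nodes.\<close>
  define p where "p = [:1/2:] + (\<Sum>k=1..<L. smult (cos (real k * \<theta> m)) (cheb_T k)) + smult (cos (real L * \<theta> m) / 2) (cheb_T L)"
  have "degree p \<le> n - 1" unfolding p_def using L_def
    by (intro degree_add_le degree_sum_le) (auto intro: order.trans[OF degree_smult_le] order.trans[OF degree_cheb_T_le])
  moreover have val: "poly p (cos t) = (dirichlet L (\<theta> m - t) + dirichlet L (\<theta> m + t)) / 2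
      + (cos (real L * (\<theta> m - t)) + cos (real L * (\<theta> m + t))) / 4" for t
    unfolding sum_cos_product[symmetric]
    by (simp add: p_def poly_sum poly_cheb_T_cos cos_diff cos_add algebra_simps)
  have "poly p (cos (\<theta> i)) = 0" if i: "i \<in> {1..n}" "i \<noteq> m" for i
  proof -
    have *: "\<theta> m - \<theta> i = of_int (int m - int i) * pi / L" "\<theta> m + \<theta> i = of_int (int m + int i - 2) * pi / L"
      using L by (auto simp: \<theta>_def field_simps)
    have **: "real L * (\<theta> m - \<theta> i) = of_int (int m - int i) * pi" "real L * (\<theta> m + \<theta> i) = of_int (int m + int i - 2) * pi"
      using L unfolding * by auto
    have "dirichlet L (of_int (int m - int i) * pi / L) + cos (of_int (int m - int i) * pi) / 2 = 0"
      by (rule dirichlet_at_multiple) (use m i n L L_def in auto)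
    moreover have "dirichlet L (of_int (int m + int i - 2) * pi / L) + cos (of_int (int m + int i - 2) * pi) / 2 = 0"
      by (rule dirichlet_at_multiple) (use m i n L L_def in auto)
    moreover have "D + c / 2 = 0 \<Longrightarrow> D' + c' / 2 = 0 \<Longrightarrow> (D + D') / 2 + (c + c') / 4 = 0" for D D' c c' :: real
    proof -
      assume "D + c / 2 = 0" "D' + c' / 2 = 0"
      hence "D = - (c / 2)" "D' = - (c' / 2)" by simp_all
      thus ?thesis by (simp add: field_simps)
    qed
    ultimately show ?thesis unfolding val ** unfolding * by blast
  qed
  moreover have "0 \<le> (\<Sum>k=1..<L. cos (real k * \<theta> m) * cos (real k * \<theta> m))" by (intro sum_nonneg) simp
  hence "poly p (cos (\<theta> m)) > 0" by (simp add: p_def poly_sum poly_cheb_T_cos add_pos_nonneg)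
  moreover have "0 \<le> weighted_integral (\<lambda>_. 1) (poly p)"
  proof -
    have "weighted_integral (\<lambda>_. 1) (poly [:1/2:]) = 1"
      using cheb_int_simps(1) weighted_integral_poly_smult[of "\<lambda>_. 1" "1/2" 1] by (simp add: cheb_int_def one_pCons)
    hence "weighted_integral (\<lambda>_. 1) (poly p) = 1 + (\<Sum>k=1..<L. cos (real k * \<theta> m) * cheb_int k) + cos (real L * \<theta> m) / 2 * cheb_int L"
      unfolding p_def
      by (simp add: weighted_integral_poly_add weighted_integral_poly_sum weighted_integral_poly_smult weight_function_one cheb_int_def)
    moreover have "\<bar>\<Sum>k=1..<L. cos (real k * \<theta> m) * cheb_int k\<bar> \<le> (\<Sum>k=1..<L. \<bar>cheb_int k\<bar>)"
      by (rule order.trans[OF sum_abs], intro sum_mono) (simp add: abs_mult mult_left_le_one_le)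
    moreover have "\<bar>cos (real L * \<theta> m) / 2 * cheb_int L\<bar> \<le> 1 * \<bar>cheb_int L\<bar>"
      unfolding abs_mult
    proof (intro mult_right_mono)
      have "\<bar>cos (real L * \<theta> m)\<bar> \<le> 1" by simp
      thus "\<bar>cos (real L * \<theta> m) / 2\<bar> \<le> 1" by linarith
    qed simp
    moreover have "(\<Sum>k=1..L. \<bar>cheb_int k\<bar>) = (\<Sum>k=1..<L. \<bar>cheb_int k\<bar>) + \<bar>cheb_int L\<bar>"
      using L(1) by (simp add: sum.last_plus add.commute)
    ultimately show ?thesis using sum_abs_cheb_int_le[of L] by linarith
  qed
  ultimately show "\<exists>p. degree p \<le> n - 1 \<and> (\<forall>i\<in>{1..n}. i \<noteq> m \<longrightarrow> poly p (cos ((real i - 1) * pi / (real n - 1))) = 0) \<and>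
       poly p (cos ((real m - 1) * pi / (real n - 1))) > 0 \<and> 0 \<le> weighted_integral (\<lambda>_. 1) (poly p)"
    unfolding \<theta>_def L(2) by blast
qed

lemma abel_sum_ge:
  fixes d s :: "nat \<Rightarrow> real"
  assumes "\<And>m. d (Suc m) \<le> d m" "\<And>m. 0 \<le> (\<Sum>j<m. s j)"
  shows "d m * (\<Sum>j<m. s j) \<le> (\<Sum>j<m. d j * s j)"
proof (induction m)
  case (Suc m)
  have "d (Suc m) * (\<Sum>j<Suc m. s j) \<le> d m * (\<Sum>j<Suc m. s j)"
    by (intro mult_right_mono assms)
  also have "\<dots> \<le> (\<Sum>j<Suc m. d j * s j)" using Suc by (simp add: distrib_left)
  finally show ?case .
qed simp

text \<open>Summation by parts: the partial sums of \<open>sin ((2 j + 1) t) sin t\<close> are squares.\<close>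

lemma sum_odd_sin_nonneg:
  "0 \<le> (\<Sum>k=1..n. (1 - (-1) ^ k) / real k * (sin (real k * t) * sin t))"
proof -
  define s where "s = (\<lambda>j :: nat. sin (real (2 * j + 1) * t) * sin t)"
  have ps: "(\<Sum>j<m. s j) = (sin (real m * t))\<^sup>2" for m
  proof (induction m)
    case (Suc m)
    have "s m = (cos (real (2 * m) * t) - cos (real (2 * m + 2) * t)) / 2"
      unfolding s_def by (simp add: sin_times_sin algebra_simps)
    moreover have "cos (real (2 * m) * t) = 1 - 2 * (sin (real m * t))\<^sup>2"
      using cos_double_sin[of "real m * t"] by (simp add: mult_ac)
    moreover have "cos (real (2 * m + 2) * t) = 1 - 2 * (sin (real (Suc m) * t))\<^sup>2"
      using cos_double_sin[of "real (Suc m) * t"] by (simp add: algebra_simps)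
    ultimately show ?case using Suc by simp
  qed simp
  have "(\<Sum>k=1..n. (1 - (-1) ^ k) / real k * (sin (real k * t) * sin t)) =
      (\<Sum>j<(n + 1) div 2. 2 / real (2 * j + 1) * s j)"
  proof (induction n)
    case (Suc n)
    show ?case
    proof (cases "even n")
      case True
      then obtain m where "n = 2 * m" by (elim evenE)
      thus ?thesis using Suc by (simp add: s_def)
    next
      case False
      then obtain m where "n = 2 * m + 1" by (elim oddE)
      thus ?thesis using Suc by simp
    qed
  qed simp
  also have "\<dots> \<ge> 2 / real (2 * ((n + 1) div 2) + 1) * (\<Sum>j<(n + 1) div 2. s j)"
    by (rule abel_sum_ge) (auto simp: ps intro!: divide_left_mono)
  also have "2 / real (2 * ((n + 1) div 2) + 1) * (\<Sum>j<(n + 1) div 2. s j) \<ge> 0"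
    unfolding ps by (intro mult_nonneg_nonneg) auto
  finally show ?thesis by simp
qed

lemma filippi_positive:
  assumes Q: "filippi_formula (\<lambda>_. 1) n Q" and n: "n \<ge> 1"
  shows "positive_quadrature Q"
proof (rule positive_of_angles)
  show "quadrature_formula n Q" "exact_to_degree (\<lambda>_. 1) (n - 1) Q"
    "node_set Q = (\<lambda>j. cos (real j * pi / (real n + 1))) ` {1..n}"
    using Q by (auto simp: filippi_formula_def interpolatory_def quadrature_formula_def)
  fix m assume m: "m \<in> {1..n}"
  define L where "L = n + 1"
  have L: "L \<ge> 1" "real n + 1 = real L" by (auto simp: L_def)
  define \<theta> where "\<theta> = (\<lambda>j. real j * pi / real L)"
  have sin_pos: "sin (\<theta> i) > 0" if "i \<in> {1..n}" for i
    using that mult_strict_right_mono[of "real i" "real L" pi] by (intro sin_gt_zero) (auto simp: \<theta>_def L_def field_simps)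
  \<comment> \<open>Multiplied by sin t this becomes a sine sum. The extra positive factor
    \<open>sin (\<theta> m)\<close> gives the integral of p the form of
    \<open>sum_odd_sin_nonneg\<close>.\<close>
  define p where "p = (\<Sum>k=1..<L. smult (sin (real k * \<theta> m) * sin (\<theta> m)) (cheb_U (k - 1)))"
  have "degree p \<le> n - 1" unfolding p_def using L_def
    by (intro degree_sum_le) (auto intro: order.trans[OF degree_smult_le] order.trans[OF degree_cheb_U_le])
  moreover have val: "poly p (cos t) * sin t = sin (\<theta> m) * (dirichlet L (\<theta> m - t) - dirichlet L (\<theta> m + t)) / 2" for t
  proof -
    have "poly p (cos t) * sin t = (\<Sum>k=1..<L. sin (\<theta> m) * (sin (real k * \<theta> m) * sin (real k * t)))"
      unfolding p_def poly_sum sum_distrib_right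
    proof (intro sum.cong refl)
      fix k assume "k \<in> {1..<L}"
      hence "poly (cheb_U (k - 1)) (cos t) * sin t = sin (real k * t)" using poly_cheb_U_cos[of "k - 1" t] by simp
      thus "poly (smult (sin (real k * \<theta> m) * sin (\<theta> m)) (cheb_U (k - 1))) (cos t) * sin t =
          sin (\<theta> m) * (sin (real k * \<theta> m) * sin (real k * t))" by (simp add: mult_ac)
    qed
    thus ?thesis unfolding sum_distrib_left[symmetric] sum_sin_product by simp
  qed
  have "poly p (cos (\<theta> i)) = 0" if i: "i \<in> {1..n}" "i \<noteq> m" for i
  proof -
    have "\<theta> m - \<theta> i = of_int (int m - int i) * pi / L" "\<theta> m + \<theta> i = of_int (int m + int i) * pi / L"
      using L by (auto simp: \<theta>_def field_simps)
    moreover have "dirichlet L (of_int (int m - int i) * pi / L) = - cos (of_int (int m - int i) * pi) / 2"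
      by (rule dirichlet_at_multiple) (use m i n L_def in auto)
    moreover have "dirichlet L (of_int (int m + int i) * pi / L) = - cos (of_int (int m + int i) * pi) / 2"
      by (rule dirichlet_at_multiple) (use m i n L_def in auto)
    moreover have "cos (of_int (int m - int i) * pi) = cos (of_int (int m + int i) * pi)"
      by (rule cos_int_pi_cong) simp
    ultimately have "poly p (cos (\<theta> i)) * sin (\<theta> i) = 0" unfolding val by simp
    thus ?thesis using sin_pos[OF i(1)] by simp
  qed
  moreover have "poly p (cos (\<theta> m)) > 0"
  proof -
    have "sin (real 1 * \<theta> m) * sin (real 1 * \<theta> m) \<le> (\<Sum>k=1..<L. sin (real k * \<theta> m) * sin (real k * \<theta> m))"
      by (rule member_le_sum) (use L_def n in auto)
    hence "0 < sin (\<theta> m) * (\<Sum>k=1..<L. sin (real k * \<theta> m) * sin (real k * \<theta> m))"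
      using sin_pos[OF m] by (intro mult_pos_pos) (auto intro: order.strict_trans2[rotated])
    hence "poly p (cos (\<theta> m)) * sin (\<theta> m) > 0"
      unfolding sum_sin_product val by simp
    thus ?thesis using sin_pos[OF m] by (simp add: zero_less_mult_iff)
  qed
  moreover have "0 \<le> weighted_integral (\<lambda>_. 1) (poly p)"
  proof -
    have "weighted_integral (\<lambda>_. 1) (poly p) = (\<Sum>k=1..n. (1 - (-1) ^ k) / real k * (sin (real k * \<theta> m) * sin (\<theta> m)))"
      unfolding p_def weighted_integral_poly_sum[OF weight_function_one] weighted_integral_poly_smult integral_cheb_U
      by (intro sum.cong) (auto simp: L_def)
    thus ?thesis using sum_odd_sin_nonneg[where n = n and t = "\<theta> m"] by simp
  qed
  ultimately show "\<exists>p. degree p \<le> n - 1 \<and> (\<forall>i\<in>{1..n}. i \<noteq> m \<longrightarrow> poly p (cos (real i * pi / (real n + 1))) = 0) \<and>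
       poly p (cos (real m * pi / (real n + 1))) > 0 \<and> 0 \<le> weighted_integral (\<lambda>_. 1) (poly p)"
    unfolding \<theta>_def L(2) by blast
qed

section \<open>Ultraspherical weights\<close>

lemma weighted_integral_pos:
  fixes p :: "real poly"
  assumes w: "weight_function w" "\<And>x. x \<in> {-1<..<1} \<Longrightarrow> 0 < w x"
    and p: "p \<noteq> 0" "\<And>x. x \<in> {-1<..<1} \<Longrightarrow> 0 \<le> poly p x"
  shows "0 < weighted_integral w (poly p)"
proof (rule ccontr)
  define g where "g = (\<lambda>x. indicator {-1<..<1} x *\<^sub>R (w x * poly p x))"
  assume "\<not> 0 < weighted_integral w (poly p)"
  moreover have "0 \<le> weighted_integral w (poly p)" using w p by (intro weighted_integral_nonneg) auto
  ultimately have "integral\<^sup>L lebesgue g = 0"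
    by (simp add: weighted_integral_def set_lebesgue_integral_def g_def)
  moreover have "integrable lebesgue g"
    using weighted_integrable_poly[OF w(1), of p] by (simp add: set_integrable_def g_def)
  moreover have "AE x in lebesgue. 0 \<le> g x"
  proof (rule AE_I2)
    fix x
    show "0 \<le> g x" using w(2)[of x] p(2)[of x] by (cases "x \<in> {-1<..<1}") (simp_all add: g_def)
  qed
  ultimately have A1: "AE x in lebesgue. g x = 0" using integral_nonneg_eq_0_iff_AE by blast
  have "finite {x. poly p x = 0}" using p(1) by (rule poly_roots_finite)
  hence "{x. poly p x = 0} \<in> null_sets lebesgue"
    by (simp add: negligible_finite flip: negligible_iff_null_sets)
  hence A2: "AE x in lebesgue. x \<notin> {x. poly p x = 0}" by (rule AE_not_in)
  have "AE x in lebesgue. x \<notin> {-1<..<1::real}"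
  proof (rule AE_mp[OF A2], rule AE_mp[OF A1], rule AE_I2)
    fix x :: real
    show "g x = 0 \<longrightarrow> x \<notin> {x. poly p x = 0} \<longrightarrow> x \<notin> {-1<..<1}"
      using w(2)[of x] by (auto simp: g_def)
  qed
  hence "{-1<..<1::real} \<in> null_sets lebesgue" by (simp add: AE_iff_null_sets)
  thus False by (simp add: null_sets_def emeasure_completion)
qed

lemma ultraspherical_weight_pos:
  assumes "x \<in> {-1<..<1}"
  shows "0 < ultraspherical_weight l x"
proof -
  have "x\<^sup>2 < 1" using assms by (auto simp: abs_square_less_1 abs_if)
  thus ?thesis by (simp add: ultraspherical_weight_def)
qed

lemma ultraspherical_weight_le:
  assumes "0 \<le> l" "x \<in> {-1<..<1}"
  shows "ultraspherical_weight l x \<le> arcsine_weight x"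
proof -
  have "x\<^sup>2 < 1" using assms(2) by (auto simp: abs_square_less_1 abs_if)
  thus ?thesis unfolding ultraspherical_weight_def
    using assms(1) by (intro powr_mono') auto
qed

lemma weight_function_ultraspherical:
  assumes "0 \<le> l"
  shows "weight_function (ultraspherical_weight l)"
  unfolding weight_function_def
proof
  show "\<forall>x\<in>{-1<..<1}. 0 \<le> ultraspherical_weight l x"
    using ultraspherical_weight_pos less_imp_le by blast
  have "set_integrable lebesgue {-1..1} arcsine_weight"
    using arcsine_weight_arc(1)[of 0 1] by (simp add: cos_arc_def)
  hence arcsine: "set_integrable lebesgue {-1<..<1} arcsine_weight"
    by (rule set_integrable_subset) auto
  show "set_integrable lebesgue {-1<..<1} (ultraspherical_weight l)"
    unfolding set_integrable_def
  proof (rule Bochner_Integration.integrable_bound)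
    show "integrable lebesgue (\<lambda>x. indicator {-1<..<1} x *\<^sub>R arcsine_weight x)"
      using arcsine by (simp add: set_integrable_def)
    have "(\<lambda>x. indicator {-1<..<1} x *\<^sub>R ultraspherical_weight l x) \<in> borel_measurable borel"
      unfolding ultraspherical_weight_def by measurable
    thus "(\<lambda>x. indicator {-1<..<1} x *\<^sub>R ultraspherical_weight l x) \<in> borel_measurable lebesgue"
      by (intro measurable_completion) simp
    show "AE x in lebesgue. norm (indicator {-1<..<1} x *\<^sub>R ultraspherical_weight l x)
        \<le> norm (indicator {-1<..<1} x *\<^sub>R arcsine_weight x)"
    proof (rule AE_I2)
      fix x :: real
      show "norm (indicator {-1<..<1} x *\<^sub>R ultraspherical_weight l x)
        \<le> norm (indicator {-1<..<1} x *\<^sub>R arcsine_weight x)"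
        using ultraspherical_weight_le[OF assms, of x] ultraspherical_weight_pos[of x l]
        by (cases "x \<in> {-1<..<1}") simp_all
    qed
  qed
qed

lemma admissible_ultraspherical:
  assumes "0 \<le> l"
  shows "admissible (ultraspherical_weight l)"
  unfolding admissible_def using weight_function_ultraspherical ultraspherical_weight_le assms
  by (auto intro!: exI[of _ 1])

text \<open>The Gegenbauer differential operator. Its eigenfunctions are the ultraspherical
  polynomials, with eigenvalue - n (n + 2 l) in degree n.\<close>

definition gegenbauer_op :: "real \<Rightarrow> real poly \<Rightarrow> real poly" where
  "gegenbauer_op l q = [:1, 0, -1:] * pderiv (pderiv q) - smult (2 * l + 1) ([:0, 1:] * pderiv q)"

lemma coeff_gegenbauer_op:
  "coeff (gegenbauer_op l q) m =
     (real m + 1) * (real m + 2) * coeff q (m + 2) - real m * (real m + 2 * l) * coeff q m"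
proof -
  have "[:1, 0, -1:] * p = p - pCons 0 (pCons 0 p)" for p :: "real poly" by simp
  moreover have "[:0, 1:] * p = pCons 0 p" for p :: "real poly" by simp
  ultimately have eq: "gegenbauer_op l q = pderiv (pderiv q) - pCons 0 (pCons 0 (pderiv (pderiv q)))
       - smult (2 * l + 1) (pCons 0 (pderiv q))" unfolding gegenbauer_op_def by simp
  show ?thesis
  proof (cases m)
    case (Suc k)
    thus ?thesis unfolding eq by (cases k) (simp_all add: coeff_pderiv algebra_simps)
  qed (simp add: eq coeff_pderiv)
qed

lemma degree_gegenbauer_op_le: "degree (gegenbauer_op l q) \<le> degree q"
  by (rule degree_le) (simp add: coeff_gegenbauer_op coeff_eq_0)

text \<open>The weighted difference of the two integrands is the derivative of
  \<open>(1 - x^2) powr (l + 1/2)\<close> times the Wronskian p q' - q p', which vanishes at both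
  ends because l + 1/2 > 0.\<close>

lemma gegenbauer_op_selfadjoint:
  assumes l: "0 \<le> l"
  shows "weighted_integral (ultraspherical_weight l) (poly (p * gegenbauer_op l q)) =
         weighted_integral (ultraspherical_weight l) (poly (q * gegenbauer_op l p))"
proof -
  let ?w = "ultraspherical_weight l"
  define r where "r = p * gegenbauer_op l q - q * gegenbauer_op l p"
  define d where "d = p * pderiv q - q * pderiv p"
  define H where "H = (\<lambda>x. (1 - x\<^sup>2) powr (l + 1/2) * poly d x)"
  have "((\<lambda>x. ?w x * poly r x) has_integral (H 1 - H (-1))) {-1..1}"
  proof (rule fundamental_theorem_of_calculus_interior)
    show "continuous_on {-1..1} H" unfolding H_def
    proof (intro continuous_on_mult continuous_on_powr' continuous_on_const)
      show "continuous_on {-1..1} (\<lambda>x :: real. 1 - x\<^sup>2)" by (intro continuous_intros)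
      show "\<forall>x\<in>{-1..1::real}. 0 \<le> 1 - x\<^sup>2 \<and> (1 - x\<^sup>2 = 0 \<longrightarrow> 0 < l + 1 / 2)"
      proof
        fix x :: real assume "x \<in> {-1..1}"
        hence "x\<^sup>2 \<le> 1" by (auto simp: abs_square_le_1 abs_le_iff)
        thus "0 \<le> 1 - x\<^sup>2 \<and> (1 - x\<^sup>2 = 0 \<longrightarrow> 0 < l + 1 / 2)" using l by simp
      qed
      show "continuous_on {-1..1} (poly d)"
        by (rule continuous_at_imp_continuous_on) (simp add: poly_isCont)
    qed
    fix x :: real assume x: "x \<in> {-1<..<1}"
    hence x1: "1 - x\<^sup>2 > 0" by (auto simp: abs_square_less_1 abs_if)
    have "(H has_real_derivative ((l + 1/2) * (1 - x\<^sup>2) powr (l + 1/2 - 1) * (- 2 * x) * poly d x +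
         (1 - x\<^sup>2) powr (l + 1/2) * poly (pderiv d) x)) (at x)"
      unfolding H_def using x1
      by (auto intro!: derivative_eq_intros poly_DERIV simp: powr_diff field_simps)
    moreover have "(1 - x\<^sup>2) powr (l + 1/2) = (1 - x\<^sup>2) powr (l - 1/2) * (1 - x\<^sup>2)"
    proof -
      have "l + 1/2 = (l - 1/2) + 1" by simp
      thus ?thesis using x1 by (simp only: powr_add) simp
    qed
    moreover have pd: "pderiv d = p * pderiv (pderiv q) - q * pderiv (pderiv p)"
      by (simp add: d_def pderiv_diff pderiv_mult algebra_simps)
    have "?w x * poly r x = (l + 1/2) * (1 - x\<^sup>2) powr (l - 1/2) * (- 2 * x) * poly d x +
         ((1 - x\<^sup>2) powr (l - 1/2) * (1 - x\<^sup>2)) * poly (pderiv d) x"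
      unfolding pd by (simp add: ultraspherical_weight_def r_def d_def gegenbauer_op_def algebra_simps power2_eq_square)
    ultimately have "(H has_real_derivative ?w x * poly r x) (at x)" by simp
    thus "(H has_vector_derivative ?w x * poly r x) (at x)"
      by (simp add: has_real_derivative_iff_has_vector_derivative)
  qed simp
  hence "((\<lambda>x. ?w x * poly r x) has_integral 0) {-1<..<1}"
    by (simp add: has_integral_Icc_iff_Ioo H_def)
  hence "weighted_integral ?w (poly r) = 0"
    unfolding weighted_integral_def
    using set_lebesgue_integral_eq_integral(2)[OF weighted_integrable_poly[OF weight_function_ultraspherical[OF l], of r]]
    by (simp add: integral_unique)
  thus ?thesis unfolding r_def
    by (simp add: weighted_integral_poly_diff[OF weight_function_ultraspherical[OF l]] del: poly_diff poly_mult)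
qed

lemma pderiv_cheb_U:
  "[:1, 0, -1:] * pderiv (cheb_U m) = [:0, 1:] * cheb_U m - smult (real (Suc m)) (cheb_T (Suc m))"
proof (rule poly_eqI_cos)
  fix t :: real assume "0 < t" "t < pi"
  have "((\<lambda>t. poly (cheb_U m) (cos t) * sin t) has_real_derivative
      poly (pderiv (cheb_U m)) (cos t) * (- sin t) * sin t + cos t * poly (cheb_U m) (cos t)) (at t)"
    by (auto intro!: derivative_eq_intros DERIV_chain2[OF poly_DERIV])
  moreover have "((\<lambda>t. sin (real (Suc m) * t)) has_real_derivative real (Suc m) * cos (real (Suc m) * t)) (at t)"
    by (auto intro!: derivative_eq_intros)
  ultimately have "poly (pderiv (cheb_U m)) (cos t) * (- sin t) * sin t + cos t * poly (cheb_U m) (cos t)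
      = real (Suc m) * cos (real (Suc m) * t)"
    unfolding poly_cheb_U_cos by (rule DERIV_unique)
  moreover have "poly ([:1, 0, -1:] * pderiv (cheb_U m)) (cos t) = sin t * sin t * poly (pderiv (cheb_U m)) (cos t)"
  proof -
    have "poly ([:1, 0, -1:] * pderiv (cheb_U m)) (cos t) = (1 - (cos t)\<^sup>2) * poly (pderiv (cheb_U m)) (cos t)"
      by (simp add: power2_eq_square algebra_simps)
    also have "1 - (cos t)\<^sup>2 = sin t * sin t" using sin_squared_eq[of t] by (simp add: power2_eq_square)
    finally show ?thesis .
  qed
  ultimately have "poly ([:1, 0, -1:] * pderiv (cheb_U m)) (cos t) =
      poly ([:0, 1:] * cheb_U m - smult (real (Suc m)) (cheb_T (Suc m))) (cos t)"
    by (simp add: poly_cheb_T_cos algebra_simps del: cheb_T.simps of_nat_Suc)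
  thus "poly ([:1, 0, -1:] * pderiv (cheb_U m)) (cos t) * sin t =
      poly ([:0, 1:] * cheb_U m - smult (real (Suc m)) (cheb_T (Suc m))) (cos t) * sin t" by simp
qed

text \<open>Only \<open>cheb_U k\<close> and \<open>cheb_U m\<close> occur, and this makes the
  recurrence for the moments \<open>b\<close> a two-term one.\<close>

lemma gegenbauer_op_cheb_T:
  assumes k_def: "k = Suc (Suc m)"
  shows "smult 2 (gegenbauer_op l (cheb_T k)) =
    - smult (2 * l * real k) (cheb_U k + cheb_U m) - smult ((real k)\<^sup>2) (cheb_U k - cheb_U m)"
proof -
  have x2: "smult 2 ([:0, 1:] * cheb_U (Suc m)) = cheb_U k + cheb_U m" by (simp add: k_def)
  have T2: "smult 2 (cheb_T k) = cheb_U k - cheb_U m" unfolding k_def by (rule cheb_T_eq_diff_cheb_U)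
  define A where "A = [:0, 1:] * cheb_U (Suc m)"
  have d1: "pderiv (cheb_T k) = smult (real k) (cheb_U (Suc m))"
    unfolding k_def by (rule pderiv_cheb_T)
  have dU: "[:1, 0, -1:] * pderiv (cheb_U (Suc m)) = A - smult (real k) (cheb_T k)"
    unfolding A_def k_def by (rule pderiv_cheb_U)
  have "gegenbauer_op l (cheb_T k) = smult (real k) ([:1, 0, -1:] * pderiv (cheb_U (Suc m))) - smult (2 * l + 1) (smult (real k) A)"
    unfolding gegenbauer_op_def d1 pderiv_smult A_def by (simp only: mult_smult_right)
  also have "\<dots> = - smult (2 * l * real k) A - smult ((real k)\<^sup>2) (cheb_T k)"
    unfolding dU by (intro poly_eqI) (simp add: algebra_simps power2_eq_square)
  finally have "smult 2 (gegenbauer_op l (cheb_T k)) =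
      - smult (2 * l * real k) (smult 2 A) - smult ((real k)\<^sup>2) (smult 2 (cheb_T k))"
    by (simp add: smult_diff_right mult_ac)
  thus ?thesis unfolding A_def x2 T2 .
qed

lemma coeff_cheb_U_top: "coeff (cheb_U n) n = 2 ^ n"
proof (induction n rule: cheb_U.induct)
  case (3 n)
  have "coeff (cheb_U n) (Suc (Suc n)) = 0"
    by (rule coeff_eq_0) (use degree_cheb_U_le[of n] in linarith)
  with 3 show ?case by simp
qed auto

lemma coeff_cheb_T_top: "coeff (cheb_T (Suc n)) (Suc n) = 2 ^ n"
proof -
  have "real (Suc n) * coeff (cheb_T (Suc n)) (Suc n) = coeff (pderiv (cheb_T (Suc n))) n"
    by (simp add: coeff_pderiv)
  also have "\<dots> = real (Suc n) * 2 ^ n" unfolding pderiv_cheb_T by (simp add: coeff_cheb_U_top)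
  finally show ?thesis by (simp del: of_nat_Suc)
qed

text \<open>All four are 2 T_a U_j = U_(j+a) + U_(j-a) with the conventions U_(-1) = 0 and U_(-k-2)
  = - U_k, separated because the indices are natural numbers.\<close>

lemma two_cheb_T_mult_cheb_U:
  shows "smult 2 (cheb_T 0) * cheb_U j = cheb_U j + cheb_U j"
    "a \<ge> 1 \<Longrightarrow> a \<le> j \<Longrightarrow> smult 2 (cheb_T a) * cheb_U j = cheb_U (j + a) + cheb_U (j - a)"
    "smult 2 (cheb_T (Suc j)) * cheb_U j = cheb_U (j + Suc j)"
    "a \<ge> j + 2 \<Longrightarrow> smult 2 (cheb_T a) * cheb_U j = cheb_U (j + a) - cheb_U (a - j - 2)"
proof -
  have key: "poly (smult 2 (cheb_T a) * cheb_U j) (cos t) * sin t = sin (real (j + a + 1) * t) + sin ((real j + 1 - real a) * t)" for a t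
  proof -
    have "poly (smult 2 (cheb_T a) * cheb_U j) (cos t) * sin t = 2 * cos (real a * t) * sin (real (Suc j) * t)"
      using poly_cheb_U_cos[of j t] by (simp add: poly_cheb_T_cos)
    also have "\<dots> = sin (real (Suc j) * t + real a * t) + sin (real (Suc j) * t - real a * t)"
      by (simp only: sin_add sin_diff) simp
    finally show ?thesis by (simp add: algebra_simps)
  qed
  show "smult 2 (cheb_T 0) * cheb_U j = cheb_U j + cheb_U j"
    using smult_add_left[of 1 1 "cheb_U j"]
    by (simp only: one_add_one smult_1_left cheb_T.simps mult_smult_left mult_1_left)
  show "smult 2 (cheb_T a) * cheb_U j = cheb_U (j + a) + cheb_U (j - a)" if "a \<ge> 1" "a \<le> j"
  proof (rule poly_eqI_cos)
    fix t :: real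
    have e: "real j + 1 - real a = real (Suc (j - a))" using that by (simp add: of_nat_diff)
    show "poly (smult 2 (cheb_T a) * cheb_U j) (cos t) * sin t = poly (cheb_U (j + a) + cheb_U (j - a)) (cos t) * sin t"
      unfolding key e using poly_cheb_U_cos[of "j + a" t] poly_cheb_U_cos[of "j - a" t]
      by (simp add: distrib_right del: of_nat_Suc)
  qed
  show "smult 2 (cheb_T (Suc j)) * cheb_U j = cheb_U (j + Suc j)"
  proof (rule poly_eqI_cos)
    fix t :: real
    show "poly (smult 2 (cheb_T (Suc j)) * cheb_U j) (cos t) * sin t = poly (cheb_U (j + Suc j)) (cos t) * sin t"
      unfolding key using poly_cheb_U_cos[of "j + Suc j" t] by (simp del: cheb_U.simps)
  qed
  show "smult 2 (cheb_T a) * cheb_U j = cheb_U (j + a) - cheb_U (a - j - 2)" if "a \<ge> j + 2"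
  proof (rule poly_eqI_cos)
    fix t :: real
    have "real (Suc (a - j - 2)) = - (real j + 1 - real a)" using that by (simp add: of_nat_diff)
    hence "sin ((real j + 1 - real a) * t) = - (poly (cheb_U (a - j - 2)) (cos t) * sin t)"
      unfolding poly_cheb_U_cos by (metis minus_equation_iff mult_minus_left sin_minus)
    thus "poly (smult 2 (cheb_T a) * cheb_U j) (cos t) * sin t = poly (cheb_U (j + a) - cheb_U (a - j - 2)) (cos t) * sin t"
      unfolding key using poly_cheb_U_cos[of "j + a" t] by (simp add: left_diff_distrib)
  qed
qed

text \<open>P is the monic orthogonal polynomial of degree n, given by its zeros Y. Of the Gauss
  formula only the nodes and this orthogonality are carried along.\<close>

locale ultraspherical_gauss =
  fixes l :: real and n :: nat and Y :: "real set" and P :: "real poly"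
  assumes l: "0 \<le> l" and n: "1 \<le> n" and fin_Y: "finite Y" and card_Y: "card Y = n" and Y_Icc: "Y \<subseteq> {-1..1}"
    and P_def: "P = (\<Prod>y\<in>Y. [:- y, 1:])"
    and orth: "\<And>s. degree s < n \<Longrightarrow> weighted_integral (ultraspherical_weight l) (poly (P * s)) = 0"
begin

abbreviation wi :: "real poly \<Rightarrow> real" where
  "wi p \<equiv> weighted_integral (ultraspherical_weight l) (poly p)"

lemmas wi_linear = weighted_integral_poly_add[OF weight_function_ultraspherical[OF l]]
  weighted_integral_poly_diff[OF weight_function_ultraspherical[OF l]]
  weighted_integral_poly_smult weighted_integral_poly_sum[OF weight_function_ultraspherical[OF l]]

lemma wi_minus: "wi (- p) = - wi p"
  using weighted_integral_poly_smult[of "ultraspherical_weight l" "-1" p] by simp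

lemma wi_pos: "p \<noteq> 0 \<Longrightarrow> (\<And>x. x \<in> {-1<..<1} \<Longrightarrow> 0 \<le> poly p x) \<Longrightarrow> 0 < wi p"
  using weighted_integral_pos[OF weight_function_ultraspherical[OF l] ultraspherical_weight_pos] .

lemma degree_P: "degree P = n" and P_nz: "P \<noteq> 0" and coeff_P: "coeff P n = 1"
proof -
  show d: "degree P = n" unfolding P_def using card_Y by (subst degree_prod_eq_sum_degree) auto
  have "lead_coeff P = 1" unfolding P_def by (simp add: lead_coeff_prod)
  thus "coeff P n = 1" using d by simp
  thus "P \<noteq> 0" by auto
qed

lemma wi_P_top:
  assumes "degree s \<le> n"
  shows "wi (P * s) = coeff s n * wi (P * P)"
proof -
  have "degree (s - smult (coeff s n) P) < n"
  proof (rule degree_lessI)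
    show "s - smult (coeff s n) P \<noteq> 0 \<or> 0 < n" using n by simp
    show "\<forall>k\<ge>n. coeff (s - smult (coeff s n) P) k = 0"
    proof (intro allI impI)
      fix k assume "n \<le> k"
      thus "coeff (s - smult (coeff s n) P) k = 0"
        using assms degree_P coeff_P by (cases "k = n") (auto simp: coeff_eq_0)
    qed
  qed
  from orth[OF this] have "wi (P * s - smult (coeff s n) (P * P)) = 0"
    by (simp only: right_diff_distrib mult_smult_right)
  thus ?thesis by (simp only: wi_linear)
qed

lemma wi_PP_pos: "wi (P * P) > 0"
  by (rule wi_pos) (use P_nz in auto)

text \<open>The residual R has degree below n because the leading coefficients cancel.
  Self-adjointness moves the operator from P to R without raising the degree, so orthogonality makes
  the integral of w R^2 vanish.\<close>

lemma gegenbauer_op_P: "gegenbauer_op l P = smult (- (real n * (real n + 2 * l))) P"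
proof -
  define R where "R = gegenbauer_op l P + smult (real n * (real n + 2 * l)) P"
  have deg: "degree R < n"
  proof (rule degree_lessI)
    show "R \<noteq> 0 \<or> 0 < n" using n by simp
    show "\<forall>k\<ge>n. coeff R k = 0"
    proof (intro allI impI)
      fix k assume "n \<le> k"
      thus "coeff R k = 0" unfolding R_def
        using degree_P by (cases "k = n") (auto simp: coeff_gegenbauer_op coeff_eq_0)
    qed
  qed
  have "wi (R * R) = wi (R * gegenbauer_op l P) + real n * (real n + 2 * l) * wi (P * R)"
    by (subst (2) R_def) (simp only: distrib_left mult_smult_right wi_linear mult.commute[of R P])
  also have "wi (R * gegenbauer_op l P) = wi (P * gegenbauer_op l R)"
    by (rule gegenbauer_op_selfadjoint[OF l])
  also have "\<dots> = 0" using deg degree_gegenbauer_op_le[of l R] by (intro orth) linarith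
  also have "wi (P * R) = 0" by (rule orth[OF deg])
  finally have "wi (R * R) = 0" by (simp only: mult_zero_right add_0)
  hence "R = 0" using wi_pos[of "R * R"] by fastforce
  thus ?thesis unfolding R_def by (simp add: eq_neg_iff_add_eq_0)
qed

text \<open>The Chebyshev moments of w P; they are the expansion coefficients of the function of the
  second kind belonging to P.\<close>

definition b :: "nat \<Rightarrow> real" where "b k = wi (P * cheb_U k)"
definition kappa :: real where "kappa = b n"

lemma b_low: "k < n \<Longrightarrow> b k = 0"
  unfolding b_def using degree_cheb_U_le[of k] by (intro orth) linarith

lemma kappa_eq: "kappa = 2 ^ n * wi (P * P)"
  unfolding kappa_def b_def using wi_P_top[OF degree_cheb_U_le] by (simp add: coeff_cheb_U_top)

lemma kappa_pos: "kappa > 0"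
  using wi_PP_pos by (simp add: kappa_eq)

text \<open>The operator applied to \<open>cheb_T k\<close> is integrated against w P in two ways:
  directly, and after moving it to the eigenfunction P.\<close>

lemma b_rec:
  assumes "k = Suc (Suc m)"
  shows "b k * (real n - real k) * (real n + real k + 2 * l) = b m * (real n + real k) * (real n - real k + 2 * l)"
proof -
  have "2 * wi (P * gegenbauer_op l (cheb_T k)) = wi (P * smult 2 (gegenbauer_op l (cheb_T k)))"
    by (simp only: mult_smult_right wi_linear)
  also have "\<dots> = - (2 * l * real k) * (b k + b m) - (real k)\<^sup>2 * (b k - b m)"
    unfolding gegenbauer_op_cheb_T[OF assms] b_def
    by (simp only: right_diff_distrib[of P] distrib_left[of P] mult_smult_right wi_linear wi_minus mult_minus_right)
       (simp only: mult_minus_left)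
  finally have 1: "2 * wi (P * gegenbauer_op l (cheb_T k)) = - (2 * l * real k) * (b k + b m) - (real k)\<^sup>2 * (b k - b m)" .
  have "wi (P * gegenbauer_op l (cheb_T k)) = wi (cheb_T k * gegenbauer_op l P)"
    by (rule gegenbauer_op_selfadjoint[OF l])
  also have "2 * \<dots> = - (real n * (real n + 2 * l)) * wi (P * smult 2 (cheb_T k))"
    unfolding gegenbauer_op_P by (simp only: mult_smult_right wi_linear mult.commute[of P])
  also have "wi (P * smult 2 (cheb_T k)) = b k - b m"
    unfolding assms cheb_T_eq_diff_cheb_U by (simp only: b_def right_diff_distrib wi_linear)
  finally have 2: "2 * wi (P * gegenbauer_op l (cheb_T k)) = - (real n * (real n + 2 * l)) * (b k - b m)" .
  have "- (real n * (real n + 2 * l)) * (b k - b m) = - (2 * l * real k) * (b k + b m) - (real k)\<^sup>2 * (b k - b m)"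
    using trans[OF 2[symmetric] 1] .
  thus ?thesis by (simp add: power2_eq_square) algebra
qed

text \<open>Ratio of consecutive coefficients of the hypergeometric series 2F1(1 - l, n + 1; n + 1 +
  l; z), whose coefficients are \<open>fc\<close>.\<close>

definition rho :: "nat \<Rightarrow> real" where
  "rho v = (real v - l) * (real n + real v) / (real v * (real n + real v + l))"

primrec fc :: "nat \<Rightarrow> real" where
  "fc 0 = 1"
| "fc (Suc v) = rho (Suc v) * fc v"

lemma b_even: "b (n + 2 * v) = kappa * fc v"
proof (induction v)
  case (Suc v)
  let ?k = "n + 2 * Suc v"
  have "b ?k * (real n - real ?k) * (real n + real ?k + 2 * l) = b (n + 2 * v) * (real n + real ?k) * (real n - real ?k + 2 * l)"
    by (rule b_rec) simp
  hence "b ?k * (- 4 * real (Suc v) * (real n + real (Suc v) + l)) = - 4 * (real (Suc v) - l) * (real n + real (Suc v)) * b (n + 2 * v)"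
    by (simp add: algebra_simps)
  hence "b ?k * (real (Suc v) * (real n + real (Suc v) + l)) = (real (Suc v) - l) * (real n + real (Suc v)) * b (n + 2 * v)"
    by (simp add: algebra_simps)
  moreover have "real (Suc v) * (real n + real (Suc v) + l) > 0" using l by (intro mult_pos_pos) auto
  ultimately have "b ?k = rho (Suc v) * b (n + 2 * v)" unfolding rho_def
    by (simp add: field_simps)
  thus ?case using Suc by simp
qed (simp add: kappa_def)

text \<open>The recurrence has step two, so everything follows from b (n - 1) = 0, which is
  orthogonality.\<close>

lemma b_odd: "b (n + 2 * v + 1) = 0"
proof (induction v)
  case 0
  have "b (n + 1) * (real n - real (n + 1)) * (real n + real (n + 1) + 2 * l) = b (n - 1) * (real n + real (n + 1)) * (real n - real (n + 1) + 2 * l)"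
    using n by (intro b_rec) simp
  moreover have "real n + real (n + 1) + 2 * l > 0" using l by simp
  ultimately show ?case using b_low[of "n - 1"] n by simp
next
  case (Suc v)
  let ?k = "n + 2 * Suc v + 1"
  have "b ?k * (real n - real ?k) * (real n + real ?k + 2 * l) = b (n + 2 * v + 1) * (real n + real ?k) * (real n - real ?k + 2 * l)"
    by (rule b_rec) simp
  moreover have "real n + real ?k + 2 * l > 0" "real n - real ?k < 0" using l by simp_all
  ultimately show ?case using Suc by simp
qed

end

section \<open>Stieltjes polynomials\<close>

lemma abs_cheb_U_le:
  assumes "x \<in> {-1<..<1}"
  shows "\<bar>poly (cheb_U k) x\<bar> \<le> real (Suc k)"
proof -
  define t where "t = arccos x"
  have t: "0 < t" "t < pi" "x = cos t" using assms arccos_lt_bounded[of x] by (auto simp: t_def)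
  have sin_le: "\<bar>sin (real m * t)\<bar> \<le> real m * \<bar>sin t\<bar>" for m
  proof (induction m)
    case (Suc m)
    have "\<bar>sin (real (Suc m) * t)\<bar> = \<bar>sin (real m * t) * cos t + cos (real m * t) * sin t\<bar>"
    proof -
      have "real (Suc m) * t = real m * t + t" by (simp add: algebra_simps)
      thus ?thesis by (simp only: sin_add)
    qed
    also have "\<dots> \<le> \<bar>sin (real m * t)\<bar> * \<bar>cos t\<bar> + \<bar>cos (real m * t)\<bar> * \<bar>sin t\<bar>"
      by (metis abs_mult abs_triangle_ineq)
    also have "\<dots> \<le> \<bar>sin (real m * t)\<bar> * 1 + 1 * \<bar>sin t\<bar>"
      by (intro add_mono mult_left_mono mult_right_mono) auto
    finally show ?case using Suc by (simp add: algebra_simps)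
  qed simp
  have s: "sin t > 0" using t by (intro sin_gt_zero)
  have "\<bar>poly (cheb_U k) x\<bar> * sin t = \<bar>poly (cheb_U k) (cos t) * sin t\<bar>" using s t by (simp add: abs_mult)
  also have "\<dots> \<le> real (Suc k) * sin t" unfolding poly_cheb_U_cos using sin_le[of "Suc k"] s by simp
  finally show ?thesis using s by simp
qed

lemma cheb_U_generating_function:
  fixes \<zeta> :: complex
  assumes "x \<in> {-1<..<1}" "norm \<zeta> < 1"
  shows "(\<lambda>k. of_real (poly (cheb_U k) x) * \<zeta> ^ Suc k) sums (\<zeta> / (1 - 2 * of_real x * \<zeta> + \<zeta>\<^sup>2))"
    "summable (\<lambda>k. norm (of_real (poly (cheb_U k) x) * \<zeta> ^ Suc k))"
proof -
  let ?u = "\<lambda>k. complex_of_real (poly (cheb_U k) x) * \<zeta> ^ k"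
  have "(\<lambda>k. of_nat (Suc k) * norm \<zeta> ^ k) sums (1 / (1 - norm \<zeta>)\<^sup>2)"
    by (rule geometric_deriv_sums) (use assms in simp)
  hence sm: "summable (\<lambda>k. real (Suc k) * norm \<zeta> ^ k)" by (simp add: sums_iff)
  have le: "norm (?u k) \<le> real (Suc k) * norm \<zeta> ^ k" for k
    unfolding norm_mult norm_power norm_of_real using abs_cheb_U_le[OF assms(1)] by (intro mult_right_mono) auto
  have sn: "summable (\<lambda>k. norm (?u k))"
    by (rule summable_comparison_test'[OF sm]) (use le in simp)
  hence su: "summable ?u" by (rule summable_norm_cancel)
  let ?D = "1 - 2 * of_real x * \<zeta> + \<zeta>\<^sup>2"
  have fin: "(\<Sum>k<Suc K. ?u k) * ?D = 1 - ?u (Suc K) + ?u K * \<zeta>\<^sup>2" for K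
  proof (induction K)
    case 0
    show ?case by (simp add: algebra_simps)
  next
    case (Suc K)
    have rec: "?u (Suc (Suc K)) = 2 * of_real x * \<zeta> * ?u (Suc K) - \<zeta>\<^sup>2 * ?u K"
      by (simp add: algebra_simps power2_eq_square)
    have "(\<Sum>k<Suc (Suc K). ?u k) * ?D = (\<Sum>k<Suc K. ?u k) * ?D + ?u (Suc K) * ?D"
      by (simp only: sum.lessThan_Suc[of ?u "Suc K"] distrib_right)
    thus ?case unfolding Suc.IH rec by (simp add: algebra_simps del: cheb_U.simps)
  qed
  have "(\<lambda>K. (\<Sum>k<Suc K. ?u k) * ?D) \<longlonglongrightarrow> suminf ?u * ?D"
    using summable_LIMSEQ[OF su] by (intro tendsto_mult_right) (rule LIMSEQ_Suc)
  moreover have "(\<lambda>K. 1 - ?u (Suc K) + ?u K * \<zeta>\<^sup>2) \<longlonglongrightarrow> 1 - 0 + 0 * \<zeta>\<^sup>2"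
    by (intro tendsto_intros LIMSEQ_Suc[OF summable_LIMSEQ_zero[OF su]] summable_LIMSEQ_zero[OF su])
  ultimately have SD: "suminf ?u * ?D = 1" unfolding fin using LIMSEQ_unique by fastforce
  hence "?D \<noteq> 0" by auto
  hence "suminf ?u = 1 / ?D" using SD by (simp add: field_simps)
  hence "?u sums (1 / ?D)" using su by (simp add: sums_iff)
  from sums_mult2[OF this, of \<zeta>] show "(\<lambda>k. of_real (poly (cheb_U k) x) * \<zeta> ^ Suc k) sums (\<zeta> / ?D)"
    by (simp add: mult_ac)
  show "summable (\<lambda>k. norm (of_real (poly (cheb_U k) x) * \<zeta> ^ Suc k))"
    using summable_mult2[OF sn, of "norm \<zeta>"] by (simp add: norm_mult norm_power mult_ac)
qed

text \<open>Supplies the majorant for dominated convergence as r tends to 1. After rotation by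
  \<open>cis (- \<theta>)\<close> the imaginary part shows |D x| >= (1 - r) sin \<theta>, while |D
  (cos \<theta>)| <= 2 (1 - r); the difference of the two denominators is 2 (x - cos \<theta>)
  \<zeta>.\<close>

lemma generating_denominator_ge:
  fixes r \<theta> x :: real
  assumes r: "0 \<le> r" "r < 1" and \<theta>: "0 < \<theta>" "\<theta> < pi"
  defines "\<zeta> \<equiv> of_real r * cis \<theta>"
  shows "2 * \<bar>x - cos \<theta>\<bar> * norm \<zeta> \<le> (1 + 2 / sin \<theta>) * norm (1 - 2 * of_real x * \<zeta> + \<zeta>\<^sup>2)"
proof -
  define D where "D = (\<lambda>x. 1 - 2 * complex_of_real x * \<zeta> + \<zeta>\<^sup>2)"
  have s: "sin \<theta> > 0" using \<theta> by (rule sin_gt_zero)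
  have "(1 - r) * 1 \<le> (1 - r) * (1 + r)" using r by (intro mult_left_mono) auto
  hence "(1 - r) * sin \<theta> \<le> (1 - r) * (1 + r) * sin \<theta>" using s by (intro mult_right_mono) auto
  also have "\<dots> = - Im (D x * cis (- \<theta>))"
  proof -
    have c: "cis \<theta> * cis (- \<theta>) = 1" by (simp add: cis_mult)
    have "D x * cis (- \<theta>) = cis (- \<theta>) - 2 * of_real (x * r) * (cis \<theta> * cis (- \<theta>)) + of_real (r\<^sup>2) * cis \<theta> * (cis \<theta> * cis (- \<theta>))"
      by (simp add: D_def \<zeta>_def algebra_simps power2_eq_square)
    also have "Im \<dots> = - sin \<theta> + r\<^sup>2 * sin \<theta>" unfolding c by simp
    finally show ?thesis by (simp add: algebra_simps power2_eq_square)
  qed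
  also have "\<dots> \<le> norm (D x * cis (- \<theta>))" using abs_Im_le_cmod[of "D x * cis (- \<theta>)"] by linarith
  also have "\<dots> = norm (D x)" by (simp add: norm_mult)
  finally have 1: "2 * (1 - r) \<le> 2 / sin \<theta> * norm (D x)" using s by (simp add: field_simps)
  have "of_real (2 * cos \<theta>) = cis \<theta> + cis (- \<theta>)" by (simp add: complex_eq_iff)
  hence "D (cos \<theta>) = 1 - of_real r * (cis \<theta> + cis (- \<theta>)) * cis \<theta> + (of_real r * cis \<theta>)\<^sup>2"
    by (simp add: D_def \<zeta>_def mult_ac)
  also have "\<dots> = 1 - of_real r * (cis \<theta> * cis \<theta>) - of_real r * (cis (- \<theta>) * cis \<theta>) + of_real r * of_real r * (cis \<theta> * cis \<theta>)"
    by (simp add: algebra_simps power2_eq_square)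
  also have "cis (- \<theta>) * cis \<theta> = 1" by (simp add: cis_mult)
  also have "1 - of_real r * (cis \<theta> * cis \<theta>) - of_real r * 1 + of_real r * of_real r * (cis \<theta> * cis \<theta>) =
      of_real (1 - r) * (1 - of_real r * (cis \<theta> * cis \<theta>))" by (simp add: algebra_simps)
  finally have Dc: "D (cos \<theta>) = of_real (1 - r) * (1 - of_real r * (cis \<theta> * cis \<theta>))" .
  have "\<bar>1 - r\<bar> = 1 - r" using r by simp
  hence "norm (D (cos \<theta>)) = (1 - r) * norm (1 - of_real r * (cis \<theta> * cis \<theta>))"
    by (simp only: Dc norm_mult norm_of_real)
  also have "\<dots> \<le> (1 - r) * (norm (1 :: complex) + norm (of_real r * (cis \<theta> * cis \<theta>)))"
    using r by (intro mult_left_mono norm_triangle_ineq4) auto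
  also have "\<dots> \<le> (1 - r) * 2" using r by (intro mult_left_mono) (auto simp: norm_mult)
  finally have 2: "norm (D (cos \<theta>)) \<le> 2 * (1 - r)" by simp
  have Dd: "D (cos \<theta>) - D x = of_real (2 * (x - cos \<theta>)) * \<zeta>" by (simp add: D_def algebra_simps)
  have "2 * \<bar>x - cos \<theta>\<bar> * norm \<zeta> = norm (D (cos \<theta>) - D x)"
    by (simp only: Dd norm_mult norm_of_real abs_mult abs_numeral)
  also have "\<dots> \<le> norm (D (cos \<theta>)) + norm (D x)" by (rule norm_triangle_ineq4)
  also have "\<dots> \<le> (1 + 2 / sin \<theta>) * norm (D x)" using 1 2 by (simp add: distrib_right)
  finally show ?thesis by (simp add: D_def)
qed

context ultraspherical_gauss
begin

fun al :: "nat \<Rightarrow> real" where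
  "al m = (if m = 0 then 1 else - (\<Sum>k<m. al k * fc (m - k)))"

declare al.simps [simp del]

lemma al_0 [simp]: "al 0 = 1" by (simp add: al.simps)

lemma al_conv: "m \<ge> 1 \<Longrightarrow> (\<Sum>k\<le>m. al k * fc (m - k)) = 0"
  by (subst lessThan_Suc_atMost[symmetric], subst sum.lessThan_Suc) (simp add: al.simps[of m])

text \<open>The generating function of \<open>al\<close> is the reciprocal of that of \<open>fc\<close>.  In the Stieltjes polynomial
  \<open>Ehat\<close> (normalised to leading coefficient \<open>2 ^ (n + 1)\<close>) the constant term, present for odd \<open>n\<close> only,
  is halved.\<close>

definition eta :: "nat \<Rightarrow> real" where
  "eta \<mu> = (if 2 * \<mu> < n + 1 then 1 else if 2 * \<mu> = n + 1 then 1 / 2 else 0)"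

definition Ehat :: "real poly" where
  "Ehat = (\<Sum>\<mu>\<le>(n + 1) div 2. smult (2 * (eta \<mu> * al \<mu>)) (cheb_T (n + 1 - 2 * \<mu>)))"

lemma poly_Ehat_cos:
  "poly Ehat (cos t) = 2 * (\<Sum>\<mu>\<le>(n + 1) div 2. eta \<mu> * al \<mu> * cos (real (n + 1 - 2 * \<mu>) * t))"
  by (simp add: Ehat_def poly_sum poly_cheb_T_cos sum_distrib_left mult.assoc)

lemma degree_Ehat_le: "degree Ehat \<le> n + 1"
  unfolding Ehat_def by (intro degree_sum_le) (auto intro!: order.trans[OF degree_smult_le] order.trans[OF degree_cheb_T_le])

lemma coeff_Ehat_top: "coeff Ehat (n + 1) = 2 ^ (n + 1)"
proof -
  have "coeff Ehat (n + 1) = (\<Sum>\<mu>\<in>{0}. coeff (smult (2 * (eta \<mu> * al \<mu>)) (cheb_T (n + 1 - 2 * \<mu>))) (n + 1))"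
    unfolding Ehat_def coeff_sum
  proof (rule sum.mono_neutral_right)
    show "\<forall>\<mu>\<in>{..(n + 1) div 2} - {0}. coeff (smult (2 * (eta \<mu> * al \<mu>)) (cheb_T (n + 1 - 2 * \<mu>))) (n + 1) = 0"
    proof
      fix \<mu> assume "\<mu> \<in> {..(n + 1) div 2} - {0}"
      hence "degree (cheb_T (n + 1 - 2 * \<mu>)) < n + 1" using degree_cheb_T_le[of "n + 1 - 2 * \<mu>"] by auto
      thus "coeff (smult (2 * (eta \<mu> * al \<mu>)) (cheb_T (n + 1 - 2 * \<mu>))) (n + 1) = 0" by (simp add: coeff_eq_0)
    qed
  qed auto
  also have "\<dots> = 2 ^ (n + 1)" using coeff_cheb_T_top[of n] by (simp add: eta_def del: cheb_T.simps)
  finally show ?thesis .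
qed

text \<open>In 2 T_a U_j with a >= 1 the second term, if present, has index below n and is killed by
  orthogonality. For a = 0 both terms coincide, which is what the value 1/2 of \<open>eta\<close>
  corrects.\<close>

lemma wi_Ehat_term:
  assumes j: "j \<le> n" and \<mu>: "2 * \<mu> \<le> n + 1"
  shows "wi (P * (smult (2 * (eta \<mu> * al \<mu>)) (cheb_T (n + 1 - 2 * \<mu>)) * cheb_U j)) = al \<mu> * b (j + (n + 1 - 2 * \<mu>))"
proof -
  define a where "a = n + 1 - 2 * \<mu>"
  have "wi (P * (smult (2 * (eta \<mu> * al \<mu>)) (cheb_T a) * cheb_U j)) =
      wi (smult (eta \<mu> * al \<mu>) (P * (smult 2 (cheb_T a) * cheb_U j)))"
    by (intro arg_cong[of _ _ wi]) (simp add: mult_ac)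
  also have "\<dots> = eta \<mu> * al \<mu> * wi (P * (smult 2 (cheb_T a) * cheb_U j))"
    by (rule weighted_integral_poly_smult)
  also have "\<dots> = al \<mu> * b (j + a)"
  proof -
    consider "a = 0" | "a \<ge> 1" "a \<le> j" | "a = Suc j" | "a \<ge> j + 2" by linarith
    thus ?thesis
    proof cases
      case 1
      hence "eta \<mu> = 1 / 2" using \<mu> by (auto simp: eta_def a_def)
      thus ?thesis unfolding 1 two_cheb_T_mult_cheb_U(1)
        by (simp only: distrib_left wi_linear b_def[symmetric]) simp
    next
      case 2
      hence "eta \<mu> = 1" "b (j - a) = 0" using \<mu> j n by (auto simp: eta_def a_def intro: b_low)
      thus ?thesis unfolding two_cheb_T_mult_cheb_U(2)[OF 2]
        by (simp only: distrib_left wi_linear b_def[symmetric])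
    next
      case 3
      hence "eta \<mu> = 1" by (auto simp: eta_def a_def)
      thus ?thesis unfolding 3 two_cheb_T_mult_cheb_U(3) b_def by simp
    next
      case 4
      hence "eta \<mu> = 1" "b (a - j - 2) = 0" using \<mu> j n by (auto simp: eta_def a_def intro: b_low)
      thus ?thesis unfolding two_cheb_T_mult_cheb_U(4)[OF 4]
        by (simp only: right_diff_distrib wi_linear b_def[symmetric])
    qed
  qed
  finally show ?thesis unfolding a_def .
qed

text \<open>For j + 1 = 2 J the moments are \<open>kappa * fc (J - \<mu>)\<close>, so the sum is a
  coefficient of the product of a series with its reciprocal, hence zero. For even j only vanishing
  moments occur.\<close>

lemma wi_P_Ehat_cheb_U:
  assumes j: "j \<le> n"
  shows "wi (P * (Ehat * cheb_U j)) = 0"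
proof -
  have "wi (P * (Ehat * cheb_U j)) = (\<Sum>\<mu>\<le>(n + 1) div 2. al \<mu> * b (j + (n + 1 - 2 * \<mu>)))"
    unfolding Ehat_def sum_distrib_right sum_distrib_left wi_linear(4)
    by (intro sum.cong refl wi_Ehat_term j) auto
  also have "\<dots> = (\<Sum>\<mu>\<le>(n + 1) div 2. if even (j + 1) \<and> \<mu> \<le> (j + 1) div 2 then al \<mu> * (kappa * fc ((j + 1) div 2 - \<mu>)) else 0)"
  proof (intro sum.cong refl)
    fix \<mu> assume "\<mu> \<in> {..(n + 1) div 2}"
    hence \<mu>: "2 * \<mu> \<le> n + 1" by auto
    show "al \<mu> * b (j + (n + 1 - 2 * \<mu>)) = (if even (j + 1) \<and> \<mu> \<le> (j + 1) div 2 then al \<mu> * (kappa * fc ((j + 1) div 2 - \<mu>)) else 0)"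
    proof (cases "2 * \<mu> \<le> j + 1")
      case True
      hence e: "j + (n + 1 - 2 * \<mu>) = n + (j + 1 - 2 * \<mu>)" using \<mu> by simp
      show ?thesis
      proof (cases "even (j + 1)")
        case True
        then obtain J where J: "j + 1 = 2 * J" by (elim evenE)
        hence "j + (n + 1 - 2 * \<mu>) = n + 2 * (J - \<mu>)" unfolding e by simp
        thus ?thesis using J True \<open>2 * \<mu> \<le> j + 1\<close> by (simp only: b_even) auto
      next
        case False
        then obtain J where J: "j + 1 = 2 * J + 1" by (elim oddE)
        hence "j + (n + 1 - 2 * \<mu>) = n + 2 * (J - \<mu>) + 1" unfolding e using \<open>2 * \<mu> \<le> j + 1\<close> by simp
        thus ?thesis using False by (simp only: b_odd) auto
      qed
    next
      case False
      hence "j + (n + 1 - 2 * \<mu>) < n" using \<mu> by linarith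
      moreover have "\<not> \<mu> \<le> (j + 1) div 2" using False by linarith
      ultimately show ?thesis by (simp only: b_low) simp
    qed
  qed
  also have "\<dots> = 0"
  proof (cases "even (j + 1)")
    case True
    define J where "J = (j + 1) div 2"
    have J: "J \<ge> 1" "J \<le> (n + 1) div 2"
      unfolding J_def using True j by (auto intro: div_le_mono elim: oddE)
    have "(\<Sum>\<mu>\<le>(n + 1) div 2. if even (j + 1) \<and> \<mu> \<le> J then al \<mu> * (kappa * fc (J - \<mu>)) else 0) =
        (\<Sum>\<mu>\<le>J. al \<mu> * (kappa * fc (J - \<mu>)))"
      using True J by (intro sum.mono_neutral_cong_right) auto
    also have "\<dots> = kappa * (\<Sum>\<mu>\<le>J. al \<mu> * fc (J - \<mu>))" by (simp add: sum_distrib_left mult_ac)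
    also have "\<dots> = 0" using al_conv[OF J(1)] by simp
    finally show ?thesis unfolding J_def .
  next
    case False
    thus ?thesis by (simp only: if_False simp_thms sum.neutral_const)
  qed
  finally show ?thesis .
qed

text \<open>Extends the orthogonality from the basis \<open>cheb_U j\<close>; it is the defining
  property of the Stieltjes polynomial.\<close>

lemma wi_P_Ehat:
  assumes "degree q \<le> n"
  shows "wi (P * (Ehat * q)) = 0"
proof -
  have "degree q \<le> m \<Longrightarrow> m \<le> n \<Longrightarrow> wi (P * (Ehat * q)) = 0" for m
  proof (induction m arbitrary: q rule: less_induct)
    case (less m)
    define c where "c = coeff q m / 2 ^ m"
    define r where "r = q - smult c (cheb_U m)"
    have "wi (P * (Ehat * q)) = wi (P * (Ehat * r)) + c * wi (P * (Ehat * cheb_U m))"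
    proof -
      have "P * (Ehat * q) = P * (Ehat * r) + smult c (P * (Ehat * cheb_U m))"
        by (simp add: r_def algebra_simps)
      thus ?thesis by (simp only: wi_linear)
    qed
    also have "wi (P * (Ehat * cheb_U m)) = 0" using less.prems by (intro wi_P_Ehat_cheb_U)
    also have "wi (P * (Ehat * r)) = 0"
    proof -
      have "coeff r k = 0" if "k \<ge> m" for k
        using that less.prems degree_cheb_U_le[of m]
        by (cases "k = m") (auto simp: r_def c_def coeff_cheb_U_top coeff_eq_0)
      hence "r = 0 \<or> degree r < m" by (metis degree_lessI le_cases linorder_not_less leading_coeff_0_iff)
      thus ?thesis
      proof
        assume "degree r < m"
        thus ?thesis by (rule less.IH) (use less.prems \<open>degree r < m\<close> in auto)
      qed (simp add: weighted_integral_def)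
    qed
    finally show ?case by simp
  qed
  thus ?thesis using assms by blast
qed

text \<open>Two monic solutions of the orthogonality conditions would differ by some \<open>D\<close> of degree at most
  \<open>n\<close>, and \<open>D * x ^ (n - degree D)\<close> has degree exactly \<open>n\<close>.\<close>

lemma Ehat_unique:
  assumes deg: "degree E = n + 1" and monic: "coeff E (n + 1) = 1"
    and E: "\<And>q. degree q \<le> n \<Longrightarrow> wi (P * (E * q)) = 0"
  shows "Ehat = smult (2 ^ (n + 1)) E"
proof (rule ccontr)
  define D where "D = Ehat - smult (2 ^ (n + 1)) E"
  assume "\<not> Ehat = smult (2 ^ (n + 1)) E"
  hence D: "D \<noteq> 0" by (simp add: D_def)
  have "coeff D k = 0" if "k \<ge> n + 1" for k
    using that deg monic coeff_Ehat_top degree_Ehat_le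
    by (cases "k = n + 1") (auto simp: D_def coeff_eq_0)
  hence "degree D < n + 1" by (intro degree_lessI) auto
  hence dD: "degree D \<le> n" by simp
  define q where "q = monom (1 :: real) (n - degree D)"
  have dq: "degree q \<le> n" unfolding q_def by (rule order.trans[OF degree_monom_le]) simp
  have "P * (D * q) = P * (Ehat * q) - smult (2 ^ (n + 1)) (P * (E * q))"
    by (simp add: D_def algebra_simps)
  hence "wi (P * (D * q)) = 0" by (simp only: wi_linear wi_P_Ehat[OF dq] E[OF dq])
  moreover have "coeff (D * q) n = lead_coeff D"
    using dD by (simp add: q_def mult.commute[of D] coeff_monom_mult)
  moreover have "degree (D * q) \<le> n"
    using dD by (intro order.trans[OF degree_mult_le]) (simp add: q_def degree_monom_eq)
  ultimately show False using wi_P_top[of "D * q"] wi_PP_pos D by simp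
qed

text \<open>With z = (\<zeta> + 1 / \<zeta>) / 2 the kernel is 1 / (2 (z - x)), so this is half the
  Stieltjes transform of w P, the function of the second kind, in the coordinate of the unit
  disc.\<close>

definition gen_int :: "complex \<Rightarrow> complex" where
  "gen_int \<zeta> = (\<integral>x. of_real (indicator {-1<..<1} x * (ultraspherical_weight l x * poly P x)) *
      (\<zeta> / (1 - 2 * of_real x * \<zeta> + \<zeta>\<^sup>2)) \<partial>lebesgue)"

lemma integrable_wi: "integrable lebesgue (\<lambda>x. indicator {-1<..<1} x * (ultraspherical_weight l x * poly p x))"
  using weighted_integrable_poly[OF weight_function_ultraspherical[OF l], of p] by (simp add: set_integrable_def)

lemma wi_eq: "wi p = (\<integral>x. indicator {-1<..<1} x * (ultraspherical_weight l x * poly p x) \<partial>lebesgue)"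
  by (simp add: weighted_integral_def set_lebesgue_integral_def)

lemma gen_int_sums:
  assumes \<zeta>: "norm \<zeta> < 1"
  shows "(\<lambda>k. of_real (b k) * \<zeta> ^ Suc k) sums gen_int \<zeta>"
proof -
  define g where "g = (\<lambda>x. indicator {-1<..<1} x * (ultraspherical_weight l x * poly P x))"
  define f where "f = (\<lambda>k x. complex_of_real (g x * poly (cheb_U k) x) * \<zeta> ^ Suc k)"
  have int: "integrable lebesgue (\<lambda>x. g x * poly (cheb_U k) x)" for k
    using integrable_wi[of "P * cheb_U k"] by (simp add: g_def mult.assoc)
  have intf: "integrable lebesgue (f k)" for k
    unfolding f_def by (intro integrable_mult_left integrable_of_real int)
  have bk: "integral\<^sup>L lebesgue (f k) = of_real (b k) * \<zeta> ^ Suc k" for k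
  proof -
    have "integral\<^sup>L lebesgue (\<lambda>x. g x * poly (cheb_U k) x) = b k"
      unfolding b_def wi_eq by (simp add: g_def mult.assoc)
    moreover have "integral\<^sup>L lebesgue (f k) = (\<integral>x. complex_of_real (g x * poly (cheb_U k) x) \<partial>lebesgue) * \<zeta> ^ Suc k"
      by (simp only: f_def integral_mult_left_zero)
    ultimately show ?thesis by (simp only: integral_complex_of_real)
  qed
  have intg: "integrable lebesgue g" unfolding g_def by (rule integrable_wi)
  have g0: "g x = 0" if "x \<notin> {-1<..<1}" for x using that by (simp add: g_def)
  have "(\<lambda>k. of_nat (Suc k) * norm \<zeta> ^ k) sums (1 / (1 - norm \<zeta>)\<^sup>2)"
    by (rule geometric_deriv_sums) (use \<zeta> in simp)
  hence sm: "summable (\<lambda>k. real (Suc k) * norm \<zeta> ^ k)" by (simp add: sums_iff)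
  have le: "norm (f k x) \<le> \<bar>g x\<bar> * (real (Suc k) * norm \<zeta> ^ k)" for k x
  proof (cases "x \<in> {-1<..<1}")
    case True
    have "norm (f k x) = \<bar>g x\<bar> * \<bar>poly (cheb_U k) x\<bar> * norm \<zeta> ^ Suc k"
      by (simp add: f_def norm_mult norm_power abs_mult)
    also have "\<dots> \<le> \<bar>g x\<bar> * real (Suc k) * norm \<zeta> ^ k"
      using \<zeta> by (intro mult_mono mult_left_mono abs_cheb_U_le[OF True] power_decreasing) auto
    finally show ?thesis by (simp add: mult.assoc)
  qed (simp add: f_def g0)
  have "(\<lambda>k. integral\<^sup>L lebesgue (f k)) sums (\<integral>x. (\<Sum>k. f k x) \<partial>lebesgue)"
  proof (rule sums_integral)
    show "integrable lebesgue (f k)" for k by (rule intf)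
    show "AE x in lebesgue. summable (\<lambda>k. norm (f k x))"
    proof (rule AE_I2)
      fix x :: real
      show "summable (\<lambda>k. norm (f k x))"
        by (rule summable_comparison_test'[OF summable_mult[OF sm, of "\<bar>g x\<bar>"]]) (use le in simp)
    qed
    show "summable (\<lambda>k. \<integral>x. norm (f k x) \<partial>lebesgue)"
    proof (rule summable_comparison_test'[OF summable_mult[OF sm, of "\<integral>x. \<bar>g x\<bar> \<partial>lebesgue"]])
      fix k
      have "(\<integral>x. norm (f k x) \<partial>lebesgue) \<le> (\<integral>x. \<bar>g x\<bar> * (real (Suc k) * norm \<zeta> ^ k) \<partial>lebesgue)"
        using le intf intg by (intro integral_mono) auto
      thus "norm (\<integral>x. norm (f k x) \<partial>lebesgue) \<le> (\<integral>x. \<bar>g x\<bar> \<partial>lebesgue) * (real (Suc k) * norm \<zeta> ^ k)"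
        by simp
    qed
  qed
  moreover have "(\<Sum>k. f k x) = of_real (g x) * (\<zeta> / (1 - 2 * of_real x * \<zeta> + \<zeta>\<^sup>2))" for x
  proof (cases "x \<in> {-1<..<1}")
    case True
    have "f k x = of_real (g x) * (of_real (poly (cheb_U k) x) * \<zeta> ^ Suc k)" for k by (simp add: f_def)
    thus ?thesis using sums_mult[OF cheb_U_generating_function(1)[OF True \<zeta>], of "of_real (g x)"]
      by (simp add: sums_iff)
  qed (simp add: f_def g0)
  ultimately show ?thesis unfolding bk gen_int_def g_def by simp
qed

lemma fc_sums:
  assumes \<zeta>: "norm \<zeta> < 1"
  shows "(\<lambda>v. of_real (fc v) * \<zeta> ^ (2 * v) * (of_real kappa * \<zeta> ^ (n + 1))) sums gen_int \<zeta>"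
proof -
  have "(\<lambda>v. of_real (b (n + 2 * v)) * \<zeta> ^ Suc (n + 2 * v)) sums gen_int \<zeta>"
  proof (subst sums_mono_reindex[of "\<lambda>v. n + 2 * v"])
    show "strict_mono (\<lambda>v. n + 2 * v)" by (simp add: strict_mono_def)
    show "of_real (b k) * \<zeta> ^ Suc k = 0" if "k \<notin> range (\<lambda>v. n + 2 * v)" for k
    proof (cases "k < n")
      case False
      have "odd (k - n)"
      proof
        assume "even (k - n)"
        then obtain v where "k - n = 2 * v" by (elim evenE)
        hence "k = n + 2 * v" using False by simp
        thus False using that by blast
      qed
      then obtain v where "k - n = 2 * v + 1" by (elim oddE)
      hence "k = n + 2 * v + 1" using False by simp
      thus ?thesis using b_odd by simp
    qed (simp add: b_low)
  qed (rule gen_int_sums[OF \<zeta>])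
  thus ?thesis unfolding b_even by (simp add: mult_ac power_add)
qed

text \<open>At a zero cos \<theta> of P the boundary singularity cancels: (x - cos \<theta>) times
  the kernel tends to -1/2. The limit is therefore real, which is the information exploited at the
  Gauss nodes.\<close>

lemma gen_int_limit:
  assumes P: "P = [:- cos \<theta>, 1:] * Py" and \<theta>: "0 < \<theta>" "\<theta> < pi"
  shows "(\<lambda>m. gen_int (of_real (1 - 1 / (real m + 2)) * cis \<theta>)) \<longlonglongrightarrow> of_real (- wi Py / 2)"
proof -
  define r where "r = (\<lambda>m. 1 - 1 / (real m + 2))"
  define \<zeta> where "\<zeta> = (\<lambda>m. of_real (r m) * cis \<theta>)"
  define D where "D = (\<lambda>m x. 1 - 2 * complex_of_real x * \<zeta> m + (\<zeta> m)\<^sup>2)"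
  define g where "g = (\<lambda>x. indicator {-1<..<1} x * (ultraspherical_weight l x * poly Py x))"
  have r: "0 \<le> r m" "r m < 1" for m by (auto simp: r_def field_simps)
  have r1: "r \<longlonglongrightarrow> 1" unfolding r_def by real_asymp
  have \<zeta>1: "\<zeta> \<longlonglongrightarrow> of_real 1 * cis \<theta>" unfolding \<zeta>_def by (intro tendsto_intros r1)
  have intg: "integrable lebesgue g" unfolding g_def by (rule integrable_wi)
  have gP: "indicator {-1<..<1} x * (ultraspherical_weight l x * poly P x) = g x * (x - cos \<theta>)" for x
    by (simp add: g_def P algebra_simps)
  define s where "s = (\<lambda>m x. complex_of_real (g x * (x - cos \<theta>)) * (\<zeta> m / D m x))"
  have gen: "gen_int (\<zeta> m) = integral\<^sup>L lebesgue (s m)" for m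
    by (simp add: gen_int_def gP s_def D_def)
  have "(\<lambda>m. integral\<^sup>L lebesgue (s m)) \<longlonglongrightarrow> integral\<^sup>L lebesgue (\<lambda>x. complex_of_real (- g x / 2))"
  proof (rule integral_dominated_convergence[where w = "\<lambda>x. (1 + 2 / sin \<theta>) / 2 * \<bar>g x\<bar>"])
    show "(\<lambda>x. complex_of_real (- g x / 2)) \<in> borel_measurable lebesgue"
      using borel_measurable_integrable[OF intg] by measurable
    have D_meas: "(\<lambda>x. complex_of_real (x - cos \<theta>) * (\<zeta> m / D m x)) \<in> borel_measurable lebesgue" for m
    proof (rule measurable_completion)
      show "(\<lambda>x. complex_of_real (x - cos \<theta>) * (\<zeta> m / D m x)) \<in> borel_measurable lborel"
        unfolding D_def by measurable
    qed
    show "s m \<in> borel_measurable lebesgue" for m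
    proof -
      have "s m = (\<lambda>x. complex_of_real (g x) * (complex_of_real (x - cos \<theta>) * (\<zeta> m / D m x)))"
        by (simp add: s_def fun_eq_iff)
      moreover have "(\<lambda>x. complex_of_real (g x) * (complex_of_real (x - cos \<theta>) * (\<zeta> m / D m x))) \<in> borel_measurable lebesgue"
      proof (rule borel_measurable_times[OF _ D_meas])
        show "(\<lambda>x. complex_of_real (g x)) \<in> borel_measurable lebesgue"
          using borel_measurable_integrable[OF intg] by measurable
      qed
      ultimately show ?thesis by simp
    qed
    show "integrable lebesgue (\<lambda>x. (1 + 2 / sin \<theta>) / 2 * \<bar>g x\<bar>)" using intg by simp
    show "AE x in lebesgue. (\<lambda>m. s m x) \<longlonglongrightarrow> complex_of_real (- g x / 2)"
    proof (rule AE_mp[OF AE_completion[OF AE_lborel_singleton[of "cos \<theta>"]]], rule AE_I2, rule impI)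
      fix x :: real
      assume False: "x \<noteq> cos \<theta>"
      show "(\<lambda>m. s m x) \<longlonglongrightarrow> complex_of_real (- g x / 2)"
      proof -
        let ?e = "cis \<theta>"
        have e2: "1 - 2 * complex_of_real x * ?e + ?e\<^sup>2 = of_real (2 * (cos \<theta> - x)) * ?e"
        proof -
          have "?e * (of_real (2 * cos \<theta>) - ?e) = 1"
          proof -
            have "of_real (2 * cos \<theta>) - ?e = cis (- \<theta>)" by (simp add: complex_eq_iff)
            thus ?thesis by (simp add: cis_mult)
          qed
          thus ?thesis by (simp add: algebra_simps power2_eq_square)
        qed
        hence nz: "1 - 2 * complex_of_real x * (of_real 1 * ?e) + (of_real 1 * ?e)\<^sup>2 \<noteq> 0" using False by auto
        have "(\<lambda>m. s m x) \<longlonglongrightarrow> complex_of_real (g x * (x - cos \<theta>)) *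
            ((of_real 1 * ?e) / (1 - 2 * complex_of_real x * (of_real 1 * ?e) + (of_real 1 * ?e)\<^sup>2))"
          unfolding s_def D_def by (intro tendsto_intros \<zeta>1 nz)
        also have "complex_of_real (g x * (x - cos \<theta>)) *
            ((of_real 1 * ?e) / (1 - 2 * complex_of_real x * (of_real 1 * ?e) + (of_real 1 * ?e)\<^sup>2)) =
            complex_of_real (g x * (x - cos \<theta>)) * (?e / (of_real (2 * (cos \<theta> - x)) * ?e))"
          unfolding e2[symmetric] by simp
        also have "\<dots> = complex_of_real (g x * (x - cos \<theta>) / (2 * (cos \<theta> - x)))" by simp
        also have "g x * (x - cos \<theta>) / (2 * (cos \<theta> - x)) = - g x / 2" using False by (simp add: field_simps)
        finally show ?thesis .
      qed
    qed
    show "AE x in lebesgue. norm (s m x) \<le> (1 + 2 / sin \<theta>) / 2 * \<bar>g x\<bar>" for m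
    proof (rule AE_I2)
      fix x :: real
      define C where "C = 1 + 2 / sin \<theta>"
      have *: "2 * \<bar>x - cos \<theta>\<bar> * norm (\<zeta> m) \<le> C * norm (D m x)"
        using generating_denominator_ge[OF r(1)[of m] r(2)[of m] \<theta>, of x] by (simp add: \<zeta>_def D_def C_def)
      have C0: "C \<ge> 0" using sin_gt_zero[OF \<theta>] by (simp add: C_def)
      have "\<bar>x - cos \<theta>\<bar> * (norm (\<zeta> m) / norm (D m x)) \<le> C / 2"
      proof (cases "D m x = 0")
        case False
        thus ?thesis using * by (simp add: field_simps)
      qed (use C0 in simp)
      hence "\<bar>g x\<bar> * (\<bar>x - cos \<theta>\<bar> * (norm (\<zeta> m) / norm (D m x))) \<le> \<bar>g x\<bar> * (C / 2)"
        by (intro mult_left_mono) auto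
      moreover have "norm (s m x) = \<bar>g x\<bar> * (\<bar>x - cos \<theta>\<bar> * (norm (\<zeta> m) / norm (D m x)))"
        by (simp only: s_def norm_mult norm_divide norm_of_real abs_mult mult.assoc)
      ultimately show "norm (s m x) \<le> (1 + 2 / sin \<theta>) / 2 * \<bar>g x\<bar>"
        unfolding C_def by (simp only: mult.commute)
    qed
  qed
  also have "integral\<^sup>L lebesgue (\<lambda>x. complex_of_real (- g x / 2)) = of_real (- wi Py / 2)"
  proof -
    have "integral\<^sup>L lebesgue (\<lambda>x. complex_of_real (- g x / 2)) = of_real (integral\<^sup>L lebesgue (\<lambda>x. - g x / 2))"
      by (rule integral_complex_of_real)
    also have "integral\<^sup>L lebesgue (\<lambda>x. - g x / 2) = - wi Py / 2" unfolding wi_eq by (simp add: g_def)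
    finally show ?thesis .
  qed
  finally show ?thesis unfolding gen[symmetric] \<zeta>_def r_def .
qed

end

section \<open>The case of parameters at most one\<close>

text \<open>If \<open>b\<close> lies in the disc around \<open>a\<close> with \<open>0\<close> on its boundary or outside, then \<open>Re (a / b) \<ge> 1/2\<close>.\<close>

lemma Re_mult_cnj_ge:
  assumes "norm (a - b) \<le> norm a"
  shows "2 * Re (b * cnj a) \<ge> (norm b)\<^sup>2"
proof -
  have "(norm (a - b))\<^sup>2 \<le> (norm a)\<^sup>2" using assms by (intro power_mono) auto
  thus ?thesis unfolding cmod_power2 by (simp add: power2_eq_square algebra_simps)
qed

context ultraspherical_gauss
begin

text \<open>The conjugated sum is the reciprocal series at exp (2 i \<theta>), truncated; the sign
  at a Gauss node is thereby reduced to a comparison of the truncation with the full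
  reciprocal.\<close>

lemma poly_Ehat_eq_Re:
  "poly Ehat (cos \<theta>) = 2 * Re (cis \<theta> ^ (n + 1) * cnj (\<Sum>\<mu>\<le>(n + 1) div 2. of_real (eta \<mu> * al \<mu>) * (cis \<theta> ^ 2) ^ \<mu>))"
proof -
  have "cis \<theta> ^ (n + 1) * cnj (\<Sum>\<mu>\<le>(n + 1) div 2. of_real (eta \<mu> * al \<mu>) * (cis \<theta> ^ 2) ^ \<mu>) =
     (\<Sum>\<mu>\<le>(n + 1) div 2. of_real (eta \<mu> * al \<mu>) * cis (real (n + 1 - 2 * \<mu>) * \<theta>))"
    unfolding cnj_sum sum_distrib_left
  proof (intro sum.cong refl)
    fix \<mu> assume "\<mu> \<in> {..(n + 1) div 2}"
    hence \<mu>: "2 * \<mu> \<le> n + 1" by auto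
    have "cis \<theta> ^ (n + 1) * cnj ((cis \<theta> ^ 2) ^ \<mu>) = cis (real (n + 1 - 2 * \<mu>) * \<theta>)"
      using \<mu> by (simp add: Complex.DeMoivre cis_cnj cis_mult of_nat_diff algebra_simps del: power_Suc of_nat_Suc)
    thus "cis \<theta> ^ (n + 1) * cnj (of_real (eta \<mu> * al \<mu>) * (cis \<theta> ^ 2) ^ \<mu>) =
        of_real (eta \<mu> * al \<mu>) * cis (real (n + 1 - 2 * \<mu>) * \<theta>)"
      by (simp add: mult_ac del: of_real_mult)
  qed
  thus ?thesis unfolding poly_Ehat_cos by (simp add: Re_sum del: of_real_mult)
qed

lemma radial_sequence:
  fixes \<theta> :: real
  defines "\<zeta> \<equiv> \<lambda>m. complex_of_real (1 - 1 / (real m + 2)) * cis \<theta>"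
  shows "norm (\<zeta> m) < 1" "\<zeta> \<longlonglongrightarrow> cis \<theta>"
proof -
  have "0 \<le> 1 - 1 / (real m + 2)" "1 - 1 / (real m + 2) < 1" by (auto simp: field_simps)
  thus "norm (\<zeta> m) < 1" unfolding \<zeta>_def norm_mult norm_of_real by simp
  have "(\<lambda>m. 1 - 1 / (real m + 2)) \<longlonglongrightarrow> 1" by real_asymp
  hence "\<zeta> \<longlonglongrightarrow> complex_of_real 1 * cis \<theta>" unfolding \<zeta>_def by (intro tendsto_intros)
  thus "\<zeta> \<longlonglongrightarrow> cis \<theta>" by simp
qed

text \<open>For l <= 1 both factors of (1 - l / v) (1 - l / (n + v + l)) lie in [0, 1] and increase
  with v. Monotone ratios are the log-convexity that Kaluza's theorem asks for.\<close>

lemma rho_bounds: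
  assumes l1: "l \<le> 1" and v: "1 \<le> v"
  shows "0 \<le> rho v" "rho v \<le> 1" "v \<le> v' \<Longrightarrow> rho v \<le> rho v'"
proof -
  have eq: "rho v = (1 - l / real v) * (1 - l / (real n + real v + l))" if "1 \<le> v" for v
  proof -
    have "real n + real v + l > 0" "real v > 0" using that l by linarith+
    thus ?thesis by (simp add: rho_def field_simps)
  qed
  have f: "0 \<le> 1 - l / real v" "1 - l / real v \<le> 1" "0 \<le> 1 - l / (real n + real v + l)" "1 - l / (real n + real v + l) \<le> 1"
    if "1 \<le> v" for v using that l l1 by (auto simp: field_simps)
  show "0 \<le> rho v" unfolding eq[OF v] by (intro mult_nonneg_nonneg f v)
  show "rho v \<le> 1" unfolding eq[OF v] by (intro mult_le_one f v)
  show "rho v \<le> rho v'" if "v \<le> v'"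
  proof -
    have v': "1 \<le> v'" using v that by simp
    show ?thesis unfolding eq[OF v] eq[OF v']
    proof (intro mult_mono f v v')
      show "1 - l / real v \<le> 1 - l / real v'"
        using v that l by (intro diff_left_mono divide_left_mono) auto
      show "1 - l / (real n + real v + l) \<le> 1 - l / (real n + real v' + l)"
        using v that l by (intro diff_left_mono divide_left_mono mult_pos_pos) auto
    qed
  qed
qed

lemma fc_bounds:
  assumes l1: "l \<le> 1"
  shows "0 \<le> fc v" "fc (v + k) \<le> fc v" "fc v \<le> 1"
proof -
  show nn: "0 \<le> fc v" for v
    by (induction v) (auto intro!: mult_nonneg_nonneg rho_bounds[OF l1])
  have dec: "fc (Suc v) \<le> fc v" for v
    using rho_bounds(2)[OF l1, of "Suc v"] nn[of v] by (simp add: mult_left_le_one_le nn rho_bounds[OF l1])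
  show le: "fc (v + k) \<le> fc v" for v k
  proof (induction k)
    case (Suc k)
    thus ?case using dec[of "v + k"] by simp
  qed simp
  show "fc v \<le> 1" using le[of 0 v] by simp
qed

text \<open>Kaluza's theorem: the reciprocal of a power series with log-convex coefficients has non-positive
  higher coefficients.\<close>

lemma al_nonpos:
  assumes l1: "l \<le> 1" and "m \<ge> 1"
  shows "al m \<le> 0"
  using assms(2)
proof (induction m rule: less_induct)
  case (less m)
  then obtain m' where m': "m = Suc m'" by (cases m) auto
  show ?case
  proof (cases "m' = 0")
    case True
    thus ?thesis using m' fc_bounds(1)[OF l1, of 1] by (subst al.simps) simp
  next
    case False
    have "al m = - (\<Sum>k\<le>m'. al k * fc (Suc m' - k))"
      using m' by (subst al.simps) (simp add: lessThan_Suc_atMost)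
    \<comment> \<open>Adding \<open>rho m\<close> times the vanishing convolution sum of order m'
      replaces the ratios \<open>rho (m - k)\<close> by differences, which are zero for k = 0 and
      nonnegative otherwise.\<close>
    also have "\<dots> = rho m * (\<Sum>k\<le>m'. al k * fc (m' - k)) - (\<Sum>k\<le>m'. al k * fc (Suc m' - k))"
      using al_conv[of m'] False by simp
    also have "\<dots> = (\<Sum>k\<le>m'. al k * (fc (m' - k) * (rho m - rho (m - k))))"
      unfolding sum_distrib_left sum_subtractf[symmetric]
    proof (intro sum.cong refl)
      fix k assume "k \<in> {..m'}"
      hence "Suc m' - k = Suc (m' - k)" "m - k = Suc (m' - k)" using m' by auto
      thus "rho m * (al k * fc (m' - k)) - al k * fc (Suc m' - k) = al k * (fc (m' - k) * (rho m - rho (m - k)))"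
        by (simp add: algebra_simps)
    qed
    also have "\<dots> \<le> 0"
    proof (intro sum_nonpos)
      fix k assume k: "k \<in> {..m'}"
      show "al k * (fc (m' - k) * (rho m - rho (m - k))) \<le> 0"
      proof (cases "k = 0")
        case False
        have "0 \<le> fc (m' - k) * (rho m - rho (m - k))"
          using k m' by (intro mult_nonneg_nonneg fc_bounds[OF l1]) (simp add: rho_bounds(3)[OF l1])
        moreover have "al k \<le> 0" using less.IH[of k] k m' False by simp
        ultimately show ?thesis by (rule mult_nonpos_nonneg[rotated])
      qed simp
    qed
    finally show ?thesis .
  qed
qed

text \<open>As the higher coefficients are nonpositive, the convolution identity says that the sum
  of |al k| fc (m - k) is fc m, and fc (m - k) >= fc m allows division. If fc m = 0 then l = 1, and
  all higher coefficients vanish.\<close>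

lemma sum_abs_al_le:
  assumes l1: "l \<le> 1"
  shows "(\<Sum>k=1..m. \<bar>al k\<bar>) \<le> 1"
proof (cases "m = 0")
  case m: False
  have conv: "(\<Sum>k=1..m. \<bar>al k\<bar> * fc (m - k)) = fc m" if "m \<ge> 1" for m
  proof -
    have "0 = (\<Sum>k\<in>insert 0 {1..m}. al k * fc (m - k))"
    proof -
      have "{..m} = insert 0 {1..m}" using that by auto
      thus ?thesis using al_conv[OF that] by simp
    qed
    also have "\<dots> = fc m + (\<Sum>k=1..m. al k * fc (m - k))" by simp
    also have "(\<Sum>k=1..m. al k * fc (m - k)) = - (\<Sum>k=1..m. \<bar>al k\<bar> * fc (m - k))"
      unfolding sum_negf[symmetric] using al_nonpos[OF l1] by (intro sum.cong) auto
    finally show ?thesis by simp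
  qed
  show ?thesis
  proof (cases "fc m = 0")
    case False
    hence pos: "fc m > 0" using fc_bounds(1)[OF l1, of m] by simp
    have "(\<Sum>k=1..m. \<bar>al k\<bar>) * fc m \<le> (\<Sum>k=1..m. \<bar>al k\<bar> * fc (m - k))"
      unfolding sum_distrib_right
    proof (intro sum_mono mult_left_mono)
      fix k assume "k \<in> {1..m}"
      thus "fc m \<le> fc (m - k)" using fc_bounds(2)[OF l1, of "m - k" k] by simp
    qed simp
    also have "\<dots> = 1 * fc m" using conv m by simp
    finally show ?thesis using pos by (rule mult_right_le_imp_le)
  next
    case True
    have fpos: "fc v > 0" if "l < 1" for v
    proof (induction v)
      case (Suc v)
      have "rho (Suc v) > 0" unfolding rho_def using l n that by (intro divide_pos_pos mult_pos_pos) auto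
      thus ?case using Suc by simp
    qed simp
    hence leq1: "l = 1" using True l1 fpos[of m] by force
    have f0: "fc k = 0" if "k \<ge> 1" for k
      using that
    proof (induction k rule: dec_induct)
      case base
      have "rho (Suc 0) = 0" unfolding rho_def using leq1 by simp
      thus ?case by simp
    qed simp
    have "\<bar>al k\<bar> = 0" if "k \<ge> 1" for k
    proof -
      have "\<bar>al k\<bar> * fc (k - k) \<le> (\<Sum>i=1..k. \<bar>al i\<bar> * fc (k - i))"
        using that fc_bounds(1)[OF l1] by (intro member_le_sum) auto
      also have "\<dots> = 0" using conv[OF that] f0[OF that] by simp
      finally show ?thesis by simp
    qed
    thus ?thesis by simp
  qed
qed simp

lemma summable_abs_al: "l \<le> 1 \<Longrightarrow> summable (\<lambda>k. \<bar>al k\<bar>)"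
proof (rule summableI_nonneg_bounded[where x = 2])
  fix m assume l1: "l \<le> 1"
  have "(\<Sum>k<m. \<bar>al k\<bar>) \<le> (\<Sum>k\<in>insert 0 {1..m}. \<bar>al k\<bar>)" by (intro sum_mono2) auto
  also have "\<dots> \<le> 2" using sum_abs_al_le[OF l1, of m] by simp
  finally show "(\<Sum>k<m. \<bar>al k\<bar>) \<le> 2" .
qed simp

text \<open>The reciprocal of the series with coefficients \<open>fc\<close>; for l <= 1 it
  converges absolutely up to the unit circle.\<close>

definition al_series :: "complex \<Rightarrow> complex" where
  "al_series \<xi> = (\<Sum>k. of_real (al k) * \<xi> ^ k)"

lemma norm_al_term_le: "norm \<xi> \<le> 1 \<Longrightarrow> norm (complex_of_real (al k) * \<xi> ^ k) \<le> \<bar>al k\<bar>"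
  by (simp add: norm_mult norm_power mult_left_le power_le_one)

lemma al_series_limit:
  assumes l1: "l \<le> 1" and "\<xi> \<longlonglongrightarrow> x" "\<And>m. norm (\<xi> m) \<le> 1" "norm x \<le> 1"
  shows "(\<lambda>m. al_series (\<xi> m)) \<longlonglongrightarrow> al_series x"
proof -
  have "uniform_limit (cball 0 1) (\<lambda>N \<xi>. \<Sum>k<N. of_real (al k) * \<xi> ^ k) (\<lambda>\<xi>. \<Sum>k. complex_of_real (al k) * \<xi> ^ k) sequentially"
    by (rule Weierstrass_m_test[OF _ summable_abs_al[OF l1]]) (use norm_al_term_le in auto)
  hence "continuous_on (cball 0 1) (\<lambda>\<xi>. \<Sum>k. complex_of_real (al k) * \<xi> ^ k)"
    by (rule uniform_limit_theorem[rotated]) (auto intro!: always_eventually continuous_intros)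
  hence "continuous_on (cball 0 1) al_series" unfolding al_series_def[abs_def] .
  thus ?thesis by (rule continuous_on_tendsto_compose) (use assms in \<open>auto intro: always_eventually\<close>)
qed

lemma gen_int_mult_al_series:
  assumes l1: "l \<le> 1" and \<zeta>: "norm \<zeta> < 1"
  shows "gen_int \<zeta> * al_series (\<zeta>\<^sup>2) = of_real kappa * \<zeta> ^ (n + 1)"
proof -
  have \<xi>: "norm (\<zeta>\<^sup>2) < 1" using \<zeta> by (simp add: norm_power power_less_one_iff)
  have sf: "summable (\<lambda>v. norm (complex_of_real (fc v) * (\<zeta>\<^sup>2) ^ v))"
  proof (rule summable_comparison_test'[OF summable_geometric[of "norm (\<zeta>\<^sup>2)"]])
    show "norm (norm (complex_of_real (fc v) * (\<zeta>\<^sup>2) ^ v)) \<le> norm (\<zeta>\<^sup>2) ^ v" for v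
      using fc_bounds[OF l1, of v] by (simp add: norm_mult norm_power mult_left_le_one_le)
  qed (use \<xi> in simp)
  have sa: "summable (\<lambda>k. norm (complex_of_real (al k) * (\<zeta>\<^sup>2) ^ k))"
    by (rule summable_comparison_test'[OF summable_abs_al[OF l1]]) (use norm_al_term_le[of "\<zeta>\<^sup>2"] \<xi> in auto)
  have "al_series (\<zeta>\<^sup>2) * (\<Sum>v. of_real (fc v) * (\<zeta>\<^sup>2) ^ v) =
      (\<Sum>k. \<Sum>i\<le>k. of_real (al i) * (\<zeta>\<^sup>2) ^ i * (of_real (fc (k - i)) * (\<zeta>\<^sup>2) ^ (k - i)))"
    unfolding al_series_def by (rule Cauchy_product[OF sa sf])
  also have "\<dots> = (\<Sum>k. if k = 0 then 1 else 0)"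
  proof (rule suminf_cong)
    fix k
    have "(\<Sum>i\<le>k. of_real (al i) * (\<zeta>\<^sup>2) ^ i * (of_real (fc (k - i)) * (\<zeta>\<^sup>2) ^ (k - i))) =
        of_real (\<Sum>i\<le>k. al i * fc (k - i)) * (\<zeta>\<^sup>2) ^ k"
      unfolding of_real_sum sum_distrib_right
    proof (intro sum.cong refl)
      fix i assume "i \<in> {..k}"
      hence "(\<zeta>\<^sup>2) ^ k = (\<zeta>\<^sup>2) ^ i * (\<zeta>\<^sup>2) ^ (k - i)" by (simp flip: power_add)
      thus "of_real (al i) * (\<zeta>\<^sup>2) ^ i * (of_real (fc (k - i)) * (\<zeta>\<^sup>2) ^ (k - i)) = of_real (al i * fc (k - i)) * (\<zeta>\<^sup>2) ^ k"
        by simp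
    qed
    also have "\<dots> = (if k = 0 then 1 else 0)" using al_conv[of k] by (cases "k = 0") auto
    finally show "(\<Sum>i\<le>k. of_real (al i) * (\<zeta>\<^sup>2) ^ i * (of_real (fc (k - i)) * (\<zeta>\<^sup>2) ^ (k - i))) = (if k = 0 then 1 else 0)" .
  qed
  also have "\<dots> = (1 :: complex)"
    using sums_single[of 0 "\<lambda>_. 1 :: complex"] by (simp add: sums_iff if_distrib)
  finally have prod: "al_series (\<zeta>\<^sup>2) * (\<Sum>v. of_real (fc v) * (\<zeta>\<^sup>2) ^ v) = 1" .
  have "(\<lambda>v. of_real (fc v) * (\<zeta>\<^sup>2) ^ v * (of_real kappa * \<zeta> ^ (n + 1))) sums
      ((\<Sum>v. of_real (fc v) * (\<zeta>\<^sup>2) ^ v) * (of_real kappa * \<zeta> ^ (n + 1)))"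
    by (intro sums_mult2 summable_sums summable_norm_cancel[OF sf])
  hence "gen_int \<zeta> = (\<Sum>v. of_real (fc v) * (\<zeta>\<^sup>2) ^ v) * (of_real kappa * \<zeta> ^ (n + 1))"
    by (rule sums_unique2[OF fc_sums[OF \<zeta>, unfolded power_mult]])
  hence "gen_int \<zeta> * al_series (\<zeta>\<^sup>2) = (al_series (\<zeta>\<^sup>2) * (\<Sum>v. of_real (fc v) * (\<zeta>\<^sup>2) ^ v)) * (of_real kappa * \<zeta> ^ (n + 1))"
    by (simp only: mult_ac)
  thus ?thesis unfolding prod by simp
qed

text \<open>By the real radial limit the full reciprocal w2 has, up to the sign of
  \<open>wi Py\<close>, the argument of exp (i (n + 1) \<theta>), and |wi Py| |w2| = 2 kappa. The
  tail w2 - w1 is at most 1 minus the moduli of the kept higher terms, hence at most |w1|; so Re (w2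
  cnj w1) >= |w2|^2 / 2.\<close>

lemma Ehat_at_gauss_node_le_one:
  assumes l1: "l \<le> 1" and P: "P = [:- cos \<theta>, 1:] * Py" and \<theta>: "0 < \<theta>" "\<theta> < pi"
  shows "poly Ehat (cos \<theta>) * wi Py \<le> - (2 * kappa)"
proof -
  define \<zeta> where "\<zeta> = (\<lambda>m. complex_of_real (1 - 1 / (real m + 2)) * cis \<theta>)"
  have \<zeta>: "norm (\<zeta> m) < 1" "\<zeta> \<longlonglongrightarrow> cis \<theta>" for m
    unfolding \<zeta>_def by (rule radial_sequence)+
  define I where "I = wi Py"
  define w1 where "w1 = (\<Sum>\<mu>\<le>(n + 1) div 2. complex_of_real (eta \<mu> * al \<mu>) * (cis \<theta> ^ 2) ^ \<mu>)"
  define w2 where "w2 = al_series ((cis \<theta>)\<^sup>2)"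
  have nc: "norm ((cis \<theta>)\<^sup>2) \<le> 1" by (simp add: norm_power)
  have "(\<lambda>m. gen_int (\<zeta> m)) \<longlonglongrightarrow> of_real (- I / 2)"
    unfolding \<zeta>_def I_def by (rule gen_int_limit[OF P \<theta>])
  moreover have "(\<lambda>m. al_series ((\<zeta> m)\<^sup>2)) \<longlonglongrightarrow> w2"
    unfolding w2_def using \<zeta> nc by (intro al_series_limit[OF l1] tendsto_intros)
       (simp_all add: norm_power power_le_one less_imp_le)
  ultimately have "(\<lambda>m. gen_int (\<zeta> m) * al_series ((\<zeta> m)\<^sup>2)) \<longlonglongrightarrow> of_real (- I / 2) * w2"
    by (rule tendsto_mult)
  moreover have "(\<lambda>m. gen_int (\<zeta> m) * al_series ((\<zeta> m)\<^sup>2)) = (\<lambda>m. of_real kappa * \<zeta> m ^ (n + 1))"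
    using gen_int_mult_al_series[OF l1 \<zeta>(1)] by (rule ext)
  moreover have "(\<lambda>m. of_real kappa * \<zeta> m ^ (n + 1)) \<longlonglongrightarrow> of_real kappa * cis \<theta> ^ (n + 1)"
    by (intro tendsto_intros \<zeta>)
  ultimately have lim: "of_real (- I / 2) * w2 = of_real kappa * cis \<theta> ^ (n + 1)"
    by (metis LIMSEQ_unique)
  have eta01: "0 \<le> eta k" "eta k \<le> 1" for k by (auto simp: eta_def)
  have "norm (w1 - w2) \<le> norm w1"
  proof -
    define e where "e = (cis \<theta>)\<^sup>2"
    have e1: "norm e = 1" by (simp add: e_def norm_power)
    define K where "K = (n + 1) div 2"
    have w1N: "w1 = (\<Sum>\<mu>\<le>N. complex_of_real (eta \<mu> * al \<mu>) * e ^ \<mu>)" if "N \<ge> K" for N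
      unfolding w1_def e_def[symmetric] K_def[symmetric]
      by (intro sum.mono_neutral_left) (use that K_def in \<open>auto simp: eta_def\<close>)
    have bnd: "norm (w1 - (\<Sum>\<mu>\<le>N. of_real (al \<mu>) * e ^ \<mu>)) \<le> norm w1" if N: "N \<ge> K" for N
    proof -
      have ins: "{..N} = insert 0 {1..N}" by auto
      have "w1 - (\<Sum>\<mu>\<le>N. of_real (al \<mu>) * e ^ \<mu>) = (\<Sum>\<mu>\<le>N. of_real ((eta \<mu> - 1) * al \<mu>) * e ^ \<mu>)"
        unfolding w1N[OF N] sum_subtractf[symmetric] by (intro sum.cong refl) (simp add: algebra_simps)
      also have "\<dots> = (\<Sum>\<mu>=1..N. of_real ((eta \<mu> - 1) * al \<mu>) * e ^ \<mu>)"
        unfolding ins by (simp add: eta_def)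
      also have "norm \<dots> \<le> (\<Sum>\<mu>=1..N. (1 - eta \<mu>) * \<bar>al \<mu>\<bar>)"
        by (rule sum_norm_le) (use eta01 in \<open>simp add: norm_mult norm_power e1 abs_mult del: of_real_mult\<close>)
      also have "\<dots> = (\<Sum>\<mu>=1..N. \<bar>al \<mu>\<bar>) - (\<Sum>\<mu>=1..N. eta \<mu> * \<bar>al \<mu>\<bar>)"
        by (simp add: left_diff_distrib sum_subtractf)
      also have "\<dots> \<le> 1 - (\<Sum>\<mu>=1..N. eta \<mu> * \<bar>al \<mu>\<bar>)" using sum_abs_al_le[OF l1, of N] by simp
      also have "\<dots> \<le> norm w1"
      proof -
        have "w1 = 1 + (\<Sum>\<mu>=1..N. of_real (eta \<mu> * al \<mu>) * e ^ \<mu>)"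
          unfolding w1N[OF N] ins by (simp add: eta_def)
        hence "1 - norm (\<Sum>\<mu>=1..N. complex_of_real (eta \<mu> * al \<mu>) * e ^ \<mu>) \<le> norm w1"
          using norm_diff_ineq[of 1 "\<Sum>\<mu>=1..N. complex_of_real (eta \<mu> * al \<mu>) * e ^ \<mu>"] by simp
        moreover have "norm (\<Sum>\<mu>=1..N. complex_of_real (eta \<mu> * al \<mu>) * e ^ \<mu>) \<le> (\<Sum>\<mu>=1..N. eta \<mu> * \<bar>al \<mu>\<bar>)"
          by (rule sum_norm_le) (use eta01 in \<open>simp add: norm_mult norm_power e1 abs_mult del: of_real_mult\<close>)
        ultimately show ?thesis by linarith
      qed
      finally show ?thesis .
    qed
    have "summable (\<lambda>k. complex_of_real (al k) * e ^ k)"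
    proof (rule summable_norm_cancel, rule summable_comparison_test'[OF summable_abs_al[OF l1]])
      show "norm (norm (complex_of_real (al k) * e ^ k)) \<le> \<bar>al k\<bar>" for k using norm_al_term_le[of e k] e1 by simp
    qed
    hence "(\<lambda>N. \<Sum>\<mu>\<le>N. of_real (al \<mu>) * e ^ \<mu>) \<longlonglongrightarrow> w2"
      unfolding w2_def al_series_def e_def[symmetric] by (rule summable_LIMSEQ')
    hence "(\<lambda>N. norm (w1 - (\<Sum>\<mu>\<le>N. of_real (al \<mu>) * e ^ \<mu>))) \<longlonglongrightarrow> norm (w1 - w2)"
      by (intro tendsto_intros)
    thus ?thesis
    proof (rule tendsto_upperbound)
      show "\<forall>\<^sub>F N in sequentially. norm (w1 - (\<Sum>\<mu>\<le>N. of_real (al \<mu>) * e ^ \<mu>)) \<le> norm w1"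
        using eventually_ge_at_top[of K] by eventually_elim (rule bnd)
    qed simp
  qed
  hence R: "(norm w2)\<^sup>2 \<le> 2 * Re (w2 * cnj w1)" by (rule Re_mult_cnj_ge)
  have "norm (of_real (- I / 2) * w2) = norm (of_real kappa * cis \<theta> ^ (n + 1))" using lim by simp
  hence "\<bar>I\<bar> / 2 * norm w2 = kappa" using kappa_pos by (simp add: norm_mult norm_power)
  hence "(\<bar>I\<bar> / 2 * norm w2)\<^sup>2 = kappa\<^sup>2" by simp
  hence I2: "I\<^sup>2 * (norm w2)\<^sup>2 = 4 * kappa\<^sup>2" by (simp add: power_mult_distrib power_divide)
  have "kappa * poly Ehat (cos \<theta>) = 2 * Re (of_real kappa * cis \<theta> ^ (n + 1) * cnj w1)"
    unfolding poly_Ehat_eq_Re w1_def[symmetric] by (simp add: mult.assoc)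
  also have "\<dots> = - I * Re (w2 * cnj w1)" unfolding lim[symmetric] mult.assoc by (simp del: of_real_divide of_real_minus)
  finally have kE: "kappa * poly Ehat (cos \<theta>) = - I * Re (w2 * cnj w1)" .
  have "kappa * (poly Ehat (cos \<theta>) * I) = - (I\<^sup>2 * Re (w2 * cnj w1))"
    using kE by algebra
  also have "\<dots> \<le> - (I\<^sup>2 * ((norm w2)\<^sup>2 / 2))"
    using R by (intro le_imp_neg_le mult_left_mono) auto
  also have "\<dots> = kappa * - (2 * kappa)" using I2 by (simp add: power2_eq_square)
  finally have "kappa * (poly Ehat (cos \<theta>) * I) \<le> kappa * - (2 * kappa)" .
  thus ?thesis unfolding I_def[symmetric] using kappa_pos by (rule mult_left_le_imp_le)
qed

end

section \<open>The case of parameter three\<close>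

lemma unit_combination_le:
  fixes x y a b :: real
  assumes "x\<^sup>2 + y\<^sup>2 = 1" "a\<^sup>2 + b\<^sup>2 \<le> K\<^sup>2" "0 \<le> K"
  shows "x * a + y * b \<le> K"
proof -
  have "(x * a + y * b)\<^sup>2 + (x * b - y * a)\<^sup>2 = (x\<^sup>2 + y\<^sup>2) * (a\<^sup>2 + b\<^sup>2)"
    by (simp add: power2_eq_square algebra_simps)
  hence "(x * a + y * b)\<^sup>2 + (x * b - y * a)\<^sup>2 = a\<^sup>2 + b\<^sup>2" using assms(1) by simp
  hence "(x * a + y * b)\<^sup>2 \<le> K\<^sup>2" using assms(2) zero_le_power2[of "x * b - y * a"] by linarith
  thus ?thesis using assms(3) by (rule power2_le_imp_le)
qed

text \<open>For \<open>\<lambda> = 3\<close> everything reduces to bounding a boundary term at the Gauss nodes.  With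
  \<open>x = cos \<psi>\<close>, \<open>y = sin \<psi>\<close>, \<open>\<psi> = (n + 3) \<theta>\<close>, \<open>N = n + 3\<close>, the node equation is the last
  assumption of the next two lemmas; it is used only when \<open>N\<^sup>2 sin\<^sup>2 \<theta> > 12\<close>.\<close>

lemma boundary_even_le:
  fixes N p sg dl u v s c x y :: real
  assumes xy: "x\<^sup>2 + y\<^sup>2 = 1" and cs: "c\<^sup>2 + s\<^sup>2 = 1" and N: "N > 0" and p: "99/100 \<le> p" "p \<le> 1"
    and sg: "2 * p \<le> sg" "(sg - 2 * p) * N\<^sup>2 \<le> 12" and dl: "0 \<le> dl" "dl * N \<le> 6"
    and u: "0 \<le> u" "u \<le> 575/1000" and v: "0 \<le> v" "v \<le> 23/100 * N"
    and node: "y * (2 * p - sg * (1 - 2 * s\<^sup>2)) = - x * (2 * s * c) * dl"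
  shows "x * (c * u) + y * (s * v) \<le> 99/100"
proof (cases "N\<^sup>2 * s\<^sup>2 \<le> 12")
  \<comment> \<open>Near the endpoints Cauchy-Schwarz suffices: 0.575^2 + 12 * 0.23^2 <
    0.99^2.\<close>
  case True
  have c1: "c\<^sup>2 \<le> 1" using cs zero_le_power2[of s] by linarith
  have "(c * u)\<^sup>2 \<le> 1 * (575/1000)\<^sup>2"
    unfolding power_mult_distrib using u c1 by (intro mult_mono power_mono) auto
  moreover have "(s * v)\<^sup>2 \<le> (23/100)\<^sup>2 * 12"
  proof -
    have "v\<^sup>2 \<le> (23/100 * N)\<^sup>2" using v by (intro power_mono) auto
    hence "s\<^sup>2 * v\<^sup>2 \<le> s\<^sup>2 * (23/100 * N)\<^sup>2" by (intro mult_left_mono) auto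
    hence "(s * v)\<^sup>2 \<le> (23/100)\<^sup>2 * (N\<^sup>2 * s\<^sup>2)" by (simp only: power_mult_distrib mult_ac)
    also have "\<dots> \<le> (23/100)\<^sup>2 * 12" by (intro mult_left_mono True) simp
    finally show ?thesis .
  qed
  ultimately have "(c * u)\<^sup>2 + (s * v)\<^sup>2 \<le> (99/100)\<^sup>2" by (simp add: power2_eq_square)
  thus ?thesis by (intro unit_combination_le[OF xy]) auto
next
  case False
  \<comment> \<open>D is the factor of y in the node equation, so multiplying by D eliminates y.
    Here sg - 2 p < s^2, which gives D >= 2.96 s^2, and dl v <= 0.23 * 6 = 1.38.\<close>
  define D where "D = 2 * p - sg * (1 - 2 * s\<^sup>2)"
  have s2: "s\<^sup>2 > 0" using False N by (cases "s = 0") auto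
  have "(sg - 2 * p) * N\<^sup>2 < N\<^sup>2 * s\<^sup>2" using False sg by linarith
  hence eps: "sg - 2 * p < s\<^sup>2" using N by (simp add: mult.commute)
  have "4 * p * s\<^sup>2 \<le> 2 * sg * s\<^sup>2" using sg s2 by (intro mult_right_mono) auto
  moreover have "4 * (99/100) * s\<^sup>2 \<le> 4 * p * s\<^sup>2" using p s2 by (intro mult_right_mono) auto
  ultimately have D: "D \<ge> 296/100 * s\<^sup>2" unfolding D_def using eps by (simp add: algebra_simps)
  hence Dpos: "D > 0" using s2 by linarith
  have "dl * v \<le> dl * (23/100 * N)" using dl v by (intro mult_left_mono) auto
  hence dlv: "dl * v \<le> 138/100" using dl by linarith
  have "2 * s\<^sup>2 * (dl * v) \<le> 2 * s\<^sup>2 * (138/100)" using dlv s2 by (intro mult_left_mono) auto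
  also have "\<dots> \<le> 99/100 * D" using D s2 by linarith
  finally have t: "2 * s\<^sup>2 * (dl * v) \<le> 99/100 * D" .
  have t0: "0 \<le> 2 * s\<^sup>2 * (dl * v)" using dl v by simp
  have "u * D \<le> 575/1000 * D" "0 \<le> u * D" using u Dpos by (auto intro: mult_right_mono)
  hence bound: "\<bar>u * D - 2 * s\<^sup>2 * (dl * v)\<bar> \<le> 99/100 * D" using t t0 Dpos by linarith
  have "(x * (c * u) + y * (s * v)) * D = x * c * u * D + (y * D) * (s * v)" by (simp add: algebra_simps)
  also have "\<dots> = (x * c) * (u * D - 2 * s\<^sup>2 * (dl * v))"
    using node unfolding D_def[symmetric] by (simp add: algebra_simps power2_eq_square)
  also have "\<dots> \<le> \<bar>x * c\<bar> * \<bar>u * D - 2 * s\<^sup>2 * (dl * v)\<bar>" by (metis abs_ge_self abs_mult)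
  also have "\<dots> \<le> 1 * (99/100 * D)"
  proof (intro mult_mono bound)
    have "x\<^sup>2 \<le> 1" "c\<^sup>2 \<le> 1" using xy cs zero_le_power2[of y] zero_le_power2[of s] by linarith+
    thus "\<bar>x * c\<bar> \<le> 1" unfolding abs_mult by (intro mult_le_one) (auto simp: abs_square_le_1)
  qed auto
  finally show ?thesis using Dpos by simp
qed

lemma boundary_odd_le:
  fixes N p sg dl u a s c x y :: real
  assumes xy: "x\<^sup>2 + y\<^sup>2 = 1" and cs: "c\<^sup>2 + s\<^sup>2 = 1" and N: "N > 0" and p: "99/100 \<le> p" "p \<le> 1"
    and sg: "2 * p \<le> sg" "(sg - 2 * p) * N\<^sup>2 \<le> 12" "sg \<le> 2" and dl: "0 \<le> dl" "dl * N \<le> 6"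
    and u: "\<bar>u\<bar> \<le> 46/100" and a: "0 \<le> a" "a \<le> 115/1000 * N"
    and node: "y * (2 * p - sg * (1 - 2 * s\<^sup>2)) = - x * (2 * s * c) * dl"
  shows "x * (u + a * dl * (1 - 2 * s\<^sup>2)) + y * (a * sg * (2 * s * c)) \<le> 198/100"
proof (cases "N\<^sup>2 * s\<^sup>2 \<le> 12")
  \<comment> \<open>Again Cauchy-Schwarz: 1.15^2 + 12 * 0.46^2 < 1.98^2, where 1.15 = 0.46 +
    0.69.\<close>
  case True
  have s1: "s\<^sup>2 \<le> 1" "c\<^sup>2 \<le> 1" using cs zero_le_power2[of c] zero_le_power2[of s] by linarith+
  have "a * dl \<le> 115/1000 * N * dl" using a dl by (intro mult_right_mono) auto
  also have "\<dots> = 115/1000 * (dl * N)" by simp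
  finally have adl: "a * dl \<le> 69/100" using dl by linarith
  have "\<bar>a * dl * (1 - 2 * s\<^sup>2)\<bar> \<le> 69/100 * 1"
    unfolding abs_mult[of "a * dl"] using s1 adl a dl by (intro mult_mono) (auto simp: abs_le_iff)
  hence "\<bar>u + a * dl * (1 - 2 * s\<^sup>2)\<bar> \<le> \<bar>115/100\<bar>" using u by linarith
  hence "(u + a * dl * (1 - 2 * s\<^sup>2))\<^sup>2 \<le> (115/100)\<^sup>2" unfolding abs_le_square_iff .
  moreover have "(a * sg * (2 * s * c))\<^sup>2 \<le> (46/100)\<^sup>2 * 12"
  proof -
    have "a * sg \<le> 115/1000 * N * 2" using a sg p N by (intro mult_mono) auto
    hence "(a * sg)\<^sup>2 \<le> (23/100 * N)\<^sup>2" using a sg p by (intro power_mono mult_nonneg_nonneg) auto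
    hence "(a * sg)\<^sup>2 * (4 * s\<^sup>2 * c\<^sup>2) \<le> (23/100 * N)\<^sup>2 * (4 * s\<^sup>2 * 1)"
      using s1 by (intro mult_mono) auto
    also have "\<dots> = (46/100)\<^sup>2 * (N\<^sup>2 * s\<^sup>2)" by (simp add: power2_eq_square)
    also have "\<dots> \<le> (46/100)\<^sup>2 * 12" by (intro mult_left_mono True) auto
    finally show ?thesis by (simp add: power_mult_distrib mult_ac)
  qed
  ultimately have "(u + a * dl * (1 - 2 * s\<^sup>2))\<^sup>2 + (a * sg * (2 * s * c))\<^sup>2 \<le> (198/100)\<^sup>2"
    by (simp add: power2_eq_square)
  thus ?thesis by (intro unit_combination_le[OF xy]) auto
next
  case False
  define C where "C = 1 - 2 * s\<^sup>2"
  define D where "D = 2 * p - sg * C"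
  have s2: "s\<^sup>2 > 0" using False N by (cases "s = 0") auto
  have "(sg - 2 * p) * N\<^sup>2 < N\<^sup>2 * s\<^sup>2" using False sg by linarith
  hence eps: "sg - 2 * p < s\<^sup>2" using N by (simp add: mult.commute)
  have "4 * p * s\<^sup>2 \<le> 2 * sg * s\<^sup>2" using sg s2 by (intro mult_right_mono) auto
  moreover have "4 * (99/100) * s\<^sup>2 \<le> 4 * p * s\<^sup>2" using p s2 by (intro mult_right_mono) auto
  ultimately have D: "D \<ge> 296/100 * s\<^sup>2" unfolding D_def C_def using eps by (simp add: algebra_simps)
  hence Dpos: "D > 0" using s2 by linarith
  have "a * dl \<le> 115/1000 * N * dl" using a dl by (intro mult_right_mono) auto
  also have "\<dots> = 115/1000 * (dl * N)" by simp
  finally have adl: "a * dl \<le> 69/100" using dl by linarith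
  \<comment> \<open>R collects what is left of the terms in a after y is eliminated; it is of order
    s^2. The budget is 0.46 + 1.50 <= 1.98, since 0.69 * 5 <= 1.5 * 2.96.\<close>
  define R where "R = sg - 2 * p * C"
  have "4 * p * s\<^sup>2 \<le> 4 * 1 * s\<^sup>2" using p s2 by (intro mult_right_mono) auto
  hence "R \<le> 5 * s\<^sup>2" unfolding R_def C_def using eps by (simp add: algebra_simps)
  moreover have R0: "0 \<le> R"
  proof -
    have "0 \<le> 4 * p * s\<^sup>2" using p by simp
    thus ?thesis unfolding R_def C_def using sg by (simp add: algebra_simps)
  qed
  ultimately have "a * dl * R \<le> 69/100 * (5 * s\<^sup>2)"
    using adl by (intro mult_mono) auto
  moreover have "0 \<le> a * dl * R" using a dl R0 by simp
  moreover have "69/100 * (5 * s\<^sup>2) \<le> 150/100 * D" using D s2 by linarith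
  moreover have "\<bar>u * D\<bar> \<le> 46/100 * D" unfolding abs_mult using u Dpos by (intro mult_mono) auto
  ultimately have bound: "\<bar>u * D - a * dl * R\<bar> \<le> 198/100 * D" using Dpos by linarith
  have c2: "c\<^sup>2 = 1 - s\<^sup>2" using cs by simp
  have CD: "C * D - sg * (4 * s\<^sup>2 * c\<^sup>2) = - R"
    unfolding D_def R_def C_def c2 by (simp add: algebra_simps power2_eq_square)
  have "(x * (u + a * dl * C) + y * (a * sg * (2 * s * c))) * D =
      x * (u * D + a * dl * (C * D)) + (y * D) * (a * sg * (2 * s * c))" by (simp add: algebra_simps)
  also have "\<dots> = x * (u * D + a * dl * (C * D)) + (- x * (2 * s * c) * dl) * (a * sg * (2 * s * c))"
    using node unfolding D_def C_def by simp
  also have "\<dots> = x * (u * D + a * dl * (C * D - sg * (4 * s\<^sup>2 * c\<^sup>2)))"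
    by (simp add: algebra_simps power2_eq_square)
  also have "\<dots> = x * (u * D - a * dl * R)" unfolding CD by simp
  also have "\<dots> \<le> \<bar>x\<bar> * \<bar>u * D - a * dl * R\<bar>" by (metis abs_ge_self abs_mult)
  also have "\<dots> \<le> 1 * (198/100 * D)"
  proof (intro mult_mono bound)
    have "x\<^sup>2 \<le> 1" using xy zero_le_power2[of y] by linarith
    thus "\<bar>x\<bar> \<le> 1" by (simp add: abs_square_le_1)
  qed auto
  finally show ?thesis using Dpos unfolding C_def by simp
qed

text \<open>For l = 3 the series with coefficients \<open>fc\<close> is the quadratic 1 - 2 p3 z +
  q3 z^2.\<close>

definition p3 :: "nat \<Rightarrow> real" where "p3 n = (real n + 1) / (real n + 4)"
definition q3 :: "nat \<Rightarrow> real" where "q3 n = (real n + 1) * (real n + 2) / ((real n + 4) * (real n + 5))"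

lemma q3_pos: "0 < q3 n" and q3_less_1: "q3 n < 1"
proof -
  show "0 < q3 n" unfolding q3_def by (intro divide_pos_pos mult_pos_pos) auto
  have "(real n + 1) * (real n + 2) < (real n + 4) * (real n + 5)" by (simp add: algebra_simps)
  moreover have "0 < (real n + 4) * (real n + 5)" by (intro mult_pos_pos) auto
  ultimately show "q3 n < 1" unfolding q3_def by (subst divide_less_eq_1_pos)
qed

lemma exp_three_halves: "exp (- (3 / 2)) < (23/100 :: real)"
proof -
  have "1 + 1/4 + (1/4)\<^sup>2 / 2 \<le> exp (1/4 :: real)" by (rule exp_lower_Taylor_quadratic) simp
  hence "(1 + 1/4 + (1/4)\<^sup>2 / 2) ^ 6 \<le> exp (1/4 :: real) ^ 6" by (intro power_mono) auto
  also have "\<dots> = exp (3 / 2)" by (simp flip: exp_of_nat_mult)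
  finally have "100/23 < exp (3 / 2 :: real)" by (simp add: power2_eq_square eval_nat_numeral)
  thus ?thesis by (simp add: exp_minus field_simps)
qed

text \<open>q3 n is 1 - 6 / n to first order, so the power n / 2 of its square root tends to exp
  (-3/2), about 0.223.\<close>

lemma eventually_sqrt_q3_power_le:
  "\<forall>\<^sub>F n in sequentially. \<forall>M. n \<le> 2 * M \<longrightarrow> sqrt (q3 n) ^ M \<le> 23/100"
proof -
  have "(\<lambda>n. sqrt (q3 n) powr (real n / 2)) \<longlonglongrightarrow> exp (- (3 / 2))"
    unfolding q3_def by real_asymp
  hence "\<forall>\<^sub>F n in sequentially. sqrt (q3 n) powr (real n / 2) < 23/100"
    using exp_three_halves by (rule order_tendstoD)
  thus ?thesis
  proof eventually_elim
    case (elim n)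
    have q: "0 < q3 n" "q3 n \<le> 1" using q3_pos[of n] q3_less_1[of n] by auto
    show ?case
    proof (intro allI impI)
      fix M assume "n \<le> 2 * M"
      hence "sqrt (q3 n) powr real M \<le> sqrt (q3 n) powr (real n / 2)"
        using q by (intro powr_mono') auto
      thus "sqrt (q3 n) ^ M \<le> 23/100" using elim q by (simp add: powr_realpow)
    qed
  qed
qed

text \<open>The recurrence has the complex characteristic roots \<open>\<rho> exp (\<plusminus>i \<phi>)\<close>.\<close>

locale recurrence3 =
  fixes n :: nat and a :: "nat \<Rightarrow> real"
  assumes n: "n \<ge> 300" and small: "\<And>M. n \<le> 2 * M \<Longrightarrow> sqrt (q3 n) ^ M \<le> 23/100"
    and a0: "a 0 = 1" and a1: "a 1 = 2 * p3 n" and rec: "\<And>m. a (m + 2) = 2 * p3 n * a (m + 1) - q3 n * a m"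
begin

definition r where "r = sqrt (q3 n)"
definition ph where "ph = arccos (p3 n / r)"

text \<open>\<open>sg\<close> and \<open>dl\<close> refer to 1 + q3 and 1 - q3, as in the boundary
  estimates; 1 + q3 - 2 p3 behaves like 12 / n^2 and 1 - q3 like 6 / n.\<close>

lemma q3_bounds: "0 < q3 n" "q3 n < 1" and p3_bounds: "99/100 \<le> p3 n" "p3 n \<le> 1"
  and sg: "2 * p3 n \<le> 1 + q3 n" "(1 + q3 n - 2 * p3 n) * (real n + 3)\<^sup>2 \<le> 12"
  and dl: "(1 - q3 n) * (real n + 3) \<le> 6"
proof -
  show "0 < q3 n" "q3 n < 1" by (rule q3_pos, rule q3_less_1)
  \<comment> \<open>This inequality holds from n = 296 on, whence the round threshold 300.\<close>
  show "99/100 \<le> p3 n" "p3 n \<le> 1" using n by (auto simp: p3_def field_simps)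
  have pos: "(real n + 4) * (real n + 5) > 0" by simp
  have e: "1 + q3 n - 2 * p3 n = 12 / ((real n + 4) * (real n + 5))"
    by (simp add: q3_def p3_def divide_simps) (simp add: algebra_simps)
  thus "2 * p3 n \<le> 1 + q3 n" using pos by (smt (verit) divide_nonneg_pos)
  have sq: "(real n + 3)\<^sup>2 \<le> (real n + 4) * (real n + 5)" by (simp add: power2_eq_square algebra_simps)
  show "(1 + q3 n - 2 * p3 n) * (real n + 3)\<^sup>2 \<le> 12" unfolding e using sq pos by (simp add: divide_simps)
  have "1 - q3 n = 6 * (real n + 3) / ((real n + 4) * (real n + 5))"
    by (simp add: q3_def divide_simps) (simp add: algebra_simps)
  hence "(1 - q3 n) * (real n + 3) = 6 * ((real n + 3)\<^sup>2 / ((real n + 4) * (real n + 5)))"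
    by (simp add: power2_eq_square)
  moreover have "(real n + 3)\<^sup>2 / ((real n + 4) * (real n + 5)) \<le> 1"
    using sq pos by (subst divide_le_eq_1_pos)
  ultimately show "(1 - q3 n) * (real n + 3) \<le> 6" by linarith
qed

lemma r_bounds: "0 < r" "r < 1" "r\<^sup>2 = q3 n" "p3 n \<le> r"
proof -
  show "0 < r" "r < 1" "r\<^sup>2 = q3 n" using q3_bounds by (auto simp: r_def)
  have "(p3 n)\<^sup>2 \<le> q3 n"
    by (simp add: p3_def q3_def power2_eq_square divide_simps) (simp add: algebra_simps)
  thus "p3 n \<le> r" unfolding r_def by (rule real_le_rsqrt)
qed

lemma cos_ph: "cos ph = p3 n / r" and sin_ph2: "(sin ph)\<^sup>2 = 3 / ((real n + 2) * (real n + 4))"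
  and ph: "0 < ph" "ph \<le> pi / 2"
proof -
  have c: "0 \<le> p3 n / r" "p3 n / r \<le> 1" using p3_bounds r_bounds by auto
  show cp: "cos ph = p3 n / r" unfolding ph_def using c by (intro cos_arccos) auto
  have "(cos ph)\<^sup>2 = (p3 n)\<^sup>2 / q3 n" unfolding cp power_divide r_bounds ..
  also have "\<dots> = 1 - 3 / ((real n + 2) * (real n + 4))"
    by (simp add: p3_def q3_def power2_eq_square divide_simps) (simp add: algebra_simps)
  finally show s2: "(sin ph)\<^sup>2 = 3 / ((real n + 2) * (real n + 4))" using sin_squared_eq[of ph] by simp
  show "ph \<le> pi / 2" unfolding ph_def using c by (intro arccos_le_pi2) auto
  have "0 \<le> ph" unfolding ph_def using c by (intro arccos_lbound) auto
  moreover have "(sin ph)\<^sup>2 > 0" unfolding s2 by simp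
  hence "ph \<noteq> 0" by auto
  ultimately show "0 < ph" by simp
qed

lemma sin_ph: "0 < sin ph"
  using ph pi_gt_zero by (intro sin_gt_zero) linarith+

text \<open>sin ph is about sqrt 3 / n, so multiples up to n / 2 + 3 stay in the first quarter
  period: on the indices met in the truncation the sines are nonnegative and increasing.\<close>

lemma ph_small:
  assumes "2 * m \<le> n + 6"
  shows "real m * ph \<le> pi / 2"
proof -
  have "3 * (real n + 6)\<^sup>2 \<le> 4 * ((real n + 2) * (real n + 4))"
  proof -
    have "300 * real n \<le> real n * real n" using n by (intro mult_right_mono) auto
    moreover have "300 \<le> real n" using n by simp
    moreover have "3 * (real n + 6)\<^sup>2 = 3 * (real n * real n) + 36 * real n + 108"
      "4 * ((real n + 2) * (real n + 4)) = 4 * (real n * real n) + 24 * real n + 32"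
      by (simp_all add: power2_eq_square algebra_simps)
    ultimately show ?thesis by linarith
  qed
  hence "((real n + 6) / 2 * sin ph)\<^sup>2 \<le> 1\<^sup>2"
    unfolding power_mult_distrib sin_ph2 by (simp add: power_divide divide_simps)
  hence 1: "(real n + 6) / 2 * sin ph \<le> 1" by (rule power2_le_imp_le) simp
  have "2 * ph / pi \<le> sin ph" using ph by (intro sin_ge_jordan) auto
  hence "ph \<le> pi / 2 * sin ph" by (simp add: field_simps)
  hence "real m * ph \<le> (real n + 6) / 2 * (pi / 2 * sin ph)"
    using assms ph by (intro mult_mono) auto
  also have "\<dots> = pi / 2 * ((real n + 6) / 2 * sin ph)" by simp
  also have "\<dots> \<le> pi / 2 * 1" by (intro mult_left_mono 1) simp
  finally show ?thesis by simp
qed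

lemma a_closed: "a m * sin ph = r ^ m * sin (real (m + 1) * ph)"
proof -
  have "a m * sin ph = r ^ m * sin (real (m + 1) * ph) \<and> a (m + 1) * sin ph = r ^ (m + 1) * sin (real (m + 2) * ph)"
  proof (induction m)
    case 0
    have "r * sin (2 * ph) = 2 * (r * cos ph) * sin ph" by (simp add: sin_double)
    also have "r * cos ph = p3 n" using r_bounds by (simp add: cos_ph)
    finally show ?case using a0 a1 by simp
  next
    case (Suc m)
    have "sin (real (m + 3) * ph) = 2 * cos ph * sin (real (m + 2) * ph) - sin (real (m + 1) * ph)"
      using sin_add[of "real (m + 2) * ph" ph] sin_diff[of "real (m + 2) * ph" ph] by (simp add: algebra_simps)
    hence "r ^ (m + 2) * sin (real (m + 3) * ph) =
       r ^ (m + 2) * (2 * cos ph * sin (real (m + 2) * ph) - sin (real (m + 1) * ph))" by (simp only:)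
    also have "\<dots> = 2 * (r * cos ph) * (r ^ (m + 1) * sin (real (m + 2) * ph)) - r\<^sup>2 * (r ^ m * sin (real (m + 1) * ph))"
      by (simp add: algebra_simps power2_eq_square)
    also have "r * cos ph = p3 n" using r_bounds by (simp add: cos_ph)
    also have "2 * p3 n * (r ^ (m + 1) * sin (real (m + 2) * ph)) - r\<^sup>2 * (r ^ m * sin (real (m + 1) * ph)) = a (m + 2) * sin ph"
      using Suc unfolding r_bounds(3) rec by (simp add: algebra_simps)
    finally show ?case using Suc by (simp add: numeral_3_eq_3)
  qed
  thus ?thesis by blast
qed

lemma sin_multiple_le: "sin (real m * ph) \<le> real m * sin ph" if "2 * m \<le> n + 6"
  using that
proof (induction m)
  case (Suc m)
  have "sin (real (Suc m) * ph) = sin (real m * ph) * cos ph + cos (real m * ph) * sin ph"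
    by (simp add: distrib_right sin_add add.commute)
  also have "\<dots> \<le> sin (real m * ph) * 1 + 1 * sin ph"
    using ph_small[of m] Suc.prems ph sin_ph pi_gt_zero
    by (intro add_mono mult_left_mono mult_right_mono sin_ge_zero) auto
  finally show ?case using Suc by (simp add: distrib_right)
qed simp

lemma a_bounds:
  assumes "2 * m \<le> n + 4"
  shows "0 \<le> a m" "a m \<le> r ^ m * (real m + 1)"
proof -
  have m: "2 * (m + 1) \<le> n + 6" using assms by simp
  have "0 \<le> sin (real (m + 1) * ph)"
    using ph_small[OF m] ph pi_gt_zero by (intro sin_ge_zero) auto
  hence "0 \<le> a m * sin ph" unfolding a_closed using r_bounds by simp
  thus "0 \<le> a m" using sin_ph by (simp add: zero_le_mult_iff)
  have "a m * sin ph \<le> r ^ m * (real (m + 1) * sin ph)"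
    unfolding a_closed using r_bounds by (intro mult_left_mono sin_multiple_le m) auto
  thus "a m \<le> r ^ m * (real m + 1)" using sin_ph by (simp add: mult.assoc[symmetric] add.commute)
qed

lemma power_r_small: "n \<le> 2 * M \<Longrightarrow> r ^ M \<le> 23/100" "r ^ Suc M \<le> r ^ M"
  using small[of M] r_bounds by (auto simp: r_def[symmetric] mult_left_le_one_le)

text \<open>In the difference neighbouring sines nearly cancel: they cost sin ph, and the factor 1 -
  r costs at most 3/2 sin ph, so 0.575 = 0.23 * 5/2. The sum has no cancellation and is bounded by
  0.23 (2 M + 3).\<close>

lemma even_bounds:
  assumes M: "n = 2 * M"
  shows "0 \<le> a (M + 1) - q3 n * a M" "a (M + 1) - q3 n * a M \<le> 575/1000"
    "0 \<le> a (M + 1) + q3 n * a M" "a (M + 1) + q3 n * a M \<le> 23/100 * (real n + 3)"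
proof -
  let ?s = "\<lambda>m. sin (real m * ph)"
  have uv: "(a (M + 1) - q3 n * a M) * sin ph = r ^ Suc M * (?s (M + 2) - r * ?s (M + 1))"
    using a_closed[of "M + 1"] a_closed[of M] unfolding r_bounds(3)[symmetric]
    by (simp add: algebra_simps power2_eq_square)
  have s1: "0 \<le> ?s (M + 1)" using ph_small[of "M + 1"] M ph pi_gt_zero by (intro sin_ge_zero) auto
  have mono: "?s (M + 1) \<le> ?s (M + 2)"
  proof (rule sin_monotone_2pi_le)
    have "0 \<le> real (M + 1) * ph" using ph by simp
    thus "- (pi / 2) \<le> real (M + 1) * ph" using pi_gt_zero by linarith
    show "real (M + 1) * ph \<le> real (M + 2) * ph" using ph by (intro mult_right_mono) auto
    show "real (M + 2) * ph \<le> pi / 2" using M by (intro ph_small) simp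
  qed
  have "r * ?s (M + 1) \<le> 1 * ?s (M + 1)" using r_bounds s1 by (intro mult_right_mono) auto
  hence "0 \<le> (a (M + 1) - q3 n * a M) * sin ph" unfolding uv using r_bounds mono by (intro mult_nonneg_nonneg) auto
  thus "0 \<le> a (M + 1) - q3 n * a M" using sin_ph by (simp add: zero_le_mult_iff)
  have "?s (M + 2) = ?s (M + 1) * cos ph + cos (real (M + 1) * ph) * sin ph"
    using sin_add[of "real (M + 1) * ph" ph] by (simp add: algebra_simps)
  also have "\<dots> \<le> ?s (M + 1) * 1 + 1 * sin ph"
    using s1 sin_ph by (intro add_mono mult_left_mono mult_right_mono) auto
  finally have "?s (M + 2) - r * ?s (M + 1) \<le> sin ph + (1 - r) * ?s (M + 1)" by (simp add: algebra_simps)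
  also have "(1 - r) * ?s (M + 1) \<le> (1 - r) * (real (M + 1) * sin ph)"
    using r_bounds M by (intro mult_left_mono sin_multiple_le) auto
  also have "(1 - r) * (real (M + 1) * sin ph) \<le> 3 / 2 * sin ph"
  proof -
    have "(1 - r) * real (M + 1) \<le> (1 - p3 n) * real (M + 1)" using r_bounds by (intro mult_right_mono) auto
    also have "\<dots> \<le> 3 / 2" using M by (simp add: p3_def field_simps)
    finally have "(1 - r) * real (M + 1) * sin ph \<le> 3 / 2 * sin ph" using sin_ph by (intro mult_right_mono) auto
    thus ?thesis by (simp add: mult.assoc)
  qed
  finally have "?s (M + 2) - r * ?s (M + 1) \<le> 5 / 2 * sin ph" by simp
  hence "(a (M + 1) - q3 n * a M) * sin ph \<le> r ^ Suc M * (5 / 2 * sin ph)"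
    unfolding uv using r_bounds by (intro mult_left_mono) auto
  also have "\<dots> \<le> 23/100 * (5 / 2 * sin ph)"
    using power_r_small[of M] M sin_ph by (intro mult_right_mono) auto
  finally show "a (M + 1) - q3 n * a M \<le> 575/1000" using sin_ph by simp
  have aM: "0 \<le> a M" "a M \<le> r ^ M * (real M + 1)" "0 \<le> a (M + 1)" "a (M + 1) \<le> r ^ (M + 1) * (real (M + 1) + 1)"
    using a_bounds[of M] a_bounds[of "M + 1"] M by auto
  show "0 \<le> a (M + 1) + q3 n * a M" using aM q3_bounds by simp
  have "a (M + 1) + q3 n * a M \<le> r ^ (M + 1) * (real (M + 1) + 1) + 1 * (r ^ M * (real M + 1))"
    using aM q3_bounds by (intro add_mono mult_mono) auto
  also have "\<dots> \<le> 23/100 * (real (M + 1) + 1) + 1 * (23/100 * (real M + 1))"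
    using power_r_small[of M] M by (intro add_mono mult_left_mono mult_right_mono) auto
  also have "\<dots> = 23/100 * (real n + 3)" using M by (simp add: field_simps)
  finally show "a (M + 1) + q3 n * a M \<le> 23/100 * (real n + 3)" .
qed

text \<open>The difference equals 2 r^(M+1) cos ((M + 1) ph), whence 0.46 = 2 * 0.23; and M + 1 = (n
  + 3) / 2 turns 0.23 into 0.115.\<close>

lemma odd_bounds:
  assumes M: "n + 1 = 2 * M"
  shows "\<bar>a (M + 1) - q3 n * a (M - 1)\<bar> \<le> 46/100" "0 \<le> a M" "a M \<le> 115/1000 * (real n + 3)"
proof -
  have M1: "M \<ge> 1" using M by simp
  have "(a (M + 1) - q3 n * a (M - 1)) * sin ph = r ^ (M + 1) * (sin (real (M + 2) * ph) - sin (real M * ph))"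
  proof -
    have "r ^ (M + 1) = r\<^sup>2 * r ^ (M - 1)" using M1 by (simp flip: power_add)
    thus ?thesis using a_closed[of "M + 1"] a_closed[of "M - 1"] M1 unfolding r_bounds(3)[symmetric]
      by (simp add: algebra_simps)
  qed
  also have "sin (real (M + 2) * ph) - sin (real M * ph) = 2 * cos (real (M + 1) * ph) * sin ph"
    using sin_add[of "real (M + 1) * ph" ph] sin_diff[of "real (M + 1) * ph" ph] by (simp add: algebra_simps)
  finally have "a (M + 1) - q3 n * a (M - 1) = r ^ (M + 1) * (2 * cos (real (M + 1) * ph))" using sin_ph by simp
  hence "\<bar>a (M + 1) - q3 n * a (M - 1)\<bar> = r ^ (M + 1) * (2 * \<bar>cos (real (M + 1) * ph)\<bar>)"
    using r_bounds by (simp add: abs_mult)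
  also have "\<dots> \<le> 23/100 * (2 * 1)"
  proof (intro mult_mono)
    have "n \<le> 2 * M" using M by simp
    thus "r ^ (M + 1) \<le> 23/100" using power_r_small[of M] by simp
  qed auto
  finally show "\<bar>a (M + 1) - q3 n * a (M - 1)\<bar> \<le> 46/100" by simp
  show "0 \<le> a M" using a_bounds[of M] M by simp
  have "a M \<le> r ^ M * (real M + 1)" using a_bounds[of M] M by simp
  also have "\<dots> \<le> 23/100 * (real M + 1)" using power_r_small[of M] M by (intro mult_right_mono) auto
  also have "\<dots> = 115/1000 * (real n + 3)" using M by (simp add: field_simps)
  finally show "a M \<le> 115/1000 * (real n + 3)" .
qed

text \<open>The recurrence cancels all middle coefficients; beside 1 only the boundary term of the
  truncation is left.\<close>

lemma truncated_product:
  fixes z :: complex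
  shows "(\<Sum>k\<le>m. of_real (a k) * z ^ k) * (1 - of_real (2 * p3 n) * z + of_real (q3 n) * z\<^sup>2) =
     1 - of_real (a (m + 1)) * z ^ (m + 1) + of_real (q3 n * a m) * z ^ (m + 2)"
proof (induction m)
  case 0
  show ?case using a0 a1[unfolded One_nat_def] by (simp add: power2_eq_square del: of_real_mult)
next
  case (Suc m)
  have aS: "a (Suc m + 1) = 2 * p3 n * a (Suc m) - q3 n * a m" using rec[of m] by simp
  show ?case unfolding sum.atMost_Suc distrib_right Suc.IH aS by (simp add: algebra_simps power2_eq_square)
qed

text \<open>Centring the three exponentials at the middle frequency n + 3 separates \<psi> from
  \<theta>.\<close>

lemma node_equation:
  assumes node: "Im (cis \<theta> ^ (n + 1) * (1 - of_real (2 * p3 n) * (cis \<theta>)\<^sup>2 + of_real (q3 n) * ((cis \<theta>)\<^sup>2)\<^sup>2)) = 0"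
  defines "\<psi> \<equiv> (real n + 3) * \<theta>"
  shows "sin \<psi> * (2 * p3 n - (1 + q3 n) * (1 - 2 * (sin \<theta>)\<^sup>2)) = - cos \<psi> * (2 * sin \<theta> * cos \<theta>) * (1 - q3 n)"
proof -
  have "cis \<theta> ^ (n + 1) * (1 - of_real (2 * p3 n) * (cis \<theta>)\<^sup>2 + of_real (q3 n) * ((cis \<theta>)\<^sup>2)\<^sup>2) =
      cis \<theta> ^ (n + 1) - of_real (2 * p3 n) * cis \<theta> ^ (n + 3) + of_real (q3 n) * cis \<theta> ^ (n + 5)"
    by (simp add: algebra_simps power_add power2_eq_square eval_nat_numeral)
  also have "\<dots> = cis (\<psi> - 2 * \<theta>) - of_real (2 * p3 n) * cis \<psi> + of_real (q3 n) * cis (\<psi> + 2 * \<theta>)"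
    unfolding Complex.DeMoivre \<psi>_def by (simp add: algebra_simps)
  finally have "sin (\<psi> - 2 * \<theta>) - 2 * p3 n * sin \<psi> + q3 n * sin (\<psi> + 2 * \<theta>) = 0" using node by simp
  hence "sin \<psi> * (2 * p3 n - (1 + q3 n) * cos (2 * \<theta>)) = - cos \<psi> * sin (2 * \<theta>) * (1 - q3 n)"
    unfolding sin_add sin_diff by (simp add: algebra_simps)
  thus ?thesis by (simp only: cos_double_sin sin_double)
qed

text \<open>By \<open>truncated_product\<close> the product is 1 minus a boundary term in cos \<psi>
  and sin \<psi>, and the boundary estimates keep its real part at least 1/100.\<close>

lemma Re_truncated_ge:
  fixes e :: "nat \<Rightarrow> real"
  assumes node: "Im (cis \<theta> ^ (n + 1) * (1 - of_real (2 * p3 n) * (cis \<theta>)\<^sup>2 + of_real (q3 n) * ((cis \<theta>)\<^sup>2)\<^sup>2)) = 0"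
    and e: "\<And>\<mu>. 2 * \<mu> < n + 1 \<Longrightarrow> e \<mu> = 1" "\<And>\<mu>. 2 * \<mu> = n + 1 \<Longrightarrow> e \<mu> = 1 / 2"
  shows "1 / 100 \<le> Re ((1 - of_real (2 * p3 n) * (cis \<theta>)\<^sup>2 + of_real (q3 n) * ((cis \<theta>)\<^sup>2)\<^sup>2) *
      (\<Sum>\<mu>\<le>(n + 1) div 2. of_real (e \<mu> * a \<mu>) * ((cis \<theta>)\<^sup>2) ^ \<mu>))"
proof -
  define z where "z = (cis \<theta>)\<^sup>2"
  define F where "F = 1 - of_real (2 * p3 n) * z + of_real (q3 n) * z\<^sup>2"
  define \<psi> where "\<psi> = (real n + 3) * \<theta>"
  note ne = node_equation[OF node, folded \<psi>_def]
  have zk: "Re (z ^ k) = cos (real (2 * k) * \<theta>)" for k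
    unfolding z_def power_mult[symmetric] Complex.DeMoivre by (simp add: mult_ac)
  have trig: "(cos \<psi>)\<^sup>2 + (sin \<psi>)\<^sup>2 = 1" "(cos \<theta>)\<^sup>2 + (sin \<theta>)\<^sup>2 = 1" by simp_all
  have N: "real n + 3 > 0" by simp
  show ?thesis
  proof (cases "even n")
    case True
    then obtain M where M: "n = 2 * M" by (elim evenE)
    have "(\<Sum>\<mu>\<le>(n + 1) div 2. of_real (e \<mu> * a \<mu>) * z ^ \<mu>) = (\<Sum>\<mu>\<le>M. of_real (a \<mu>) * z ^ \<mu>)"
      using M by (intro sum.cong) (auto simp: e)
    hence "F * (\<Sum>\<mu>\<le>(n + 1) div 2. of_real (e \<mu> * a \<mu>) * z ^ \<mu>) =
        1 - of_real (a (M + 1)) * z ^ (M + 1) + of_real (q3 n * a M) * z ^ (M + 2)"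
      using truncated_product[where m = M and z = z] unfolding F_def by (simp only: mult.commute)
    hence "Re (F * (\<Sum>\<mu>\<le>(n + 1) div 2. of_real (e \<mu> * a \<mu>) * z ^ \<mu>)) =
        1 - a (M + 1) * Re (z ^ (M + 1)) + q3 n * a M * Re (z ^ (M + 2))" by (simp del: power_Suc of_real_mult)
    also have "Re (z ^ (M + 1)) = cos (\<psi> - \<theta>)" unfolding zk \<psi>_def M by (simp add: algebra_simps)
    also have "Re (z ^ (M + 2)) = cos (\<psi> + \<theta>)" unfolding zk \<psi>_def M by (simp add: algebra_simps)
    also have "1 - a (M + 1) * cos (\<psi> - \<theta>) + q3 n * a M * cos (\<psi> + \<theta>) =
       1 - (cos \<psi> * (cos \<theta> * (a (M + 1) - q3 n * a M)) + sin \<psi> * (sin \<theta> * (a (M + 1) + q3 n * a M)))"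
      unfolding cos_add cos_diff by (simp add: algebra_simps)
    finally have eq: "Re (F * (\<Sum>\<mu>\<le>(n + 1) div 2. of_real (e \<mu> * a \<mu>) * z ^ \<mu>)) =
       1 - (cos \<psi> * (cos \<theta> * (a (M + 1) - q3 n * a M)) + sin \<psi> * (sin \<theta> * (a (M + 1) + q3 n * a M)))" .
    have "cos \<psi> * (cos \<theta> * (a (M + 1) - q3 n * a M)) + sin \<psi> * (sin \<theta> * (a (M + 1) + q3 n * a M)) \<le> 99/100"
      by (rule boundary_even_le[OF trig N p3_bounds sg _ dl even_bounds[OF M] ne]) (use q3_bounds in simp)
    thus ?thesis unfolding F_def[symmetric] z_def[symmetric] using eq by linarith
  next
    case False
    then obtain K where K: "n = 2 * K + 1" by (elim oddE)
    define M where "M = K + 1"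
    have M: "n + 1 = 2 * M" "(n + 1) div 2 = M" by (auto simp: K M_def)
    have "{..M} = insert M {..K}" by (auto simp: M_def)
    hence "(\<Sum>\<mu>\<le>(n + 1) div 2. of_real (e \<mu> * a \<mu>) * z ^ \<mu>) = of_real (e M * a M) * z ^ M + (\<Sum>\<mu>\<le>K. of_real (e \<mu> * a \<mu>) * z ^ \<mu>)"
      unfolding M by (simp add: M_def)
    also have "(\<Sum>\<mu>\<le>K. of_real (e \<mu> * a \<mu>) * z ^ \<mu>) = (\<Sum>\<mu>\<le>K. of_real (a \<mu>) * z ^ \<mu>)"
      using K by (intro sum.cong) (auto simp: e)
    also have "e M = 1 / 2" by (rule e(2)) (use M in simp)
    \<comment> \<open>Halving the last term gives the mean of two consecutive full truncations;
      therefore the odd boundary estimate has 1.98 = 2 * 0.99.\<close>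
    also have "of_real (1 / 2 * a M) * z ^ M + (\<Sum>\<mu>\<le>K. of_real (a \<mu>) * z ^ \<mu>) =
        ((\<Sum>\<mu>\<le>K. of_real (a \<mu>) * z ^ \<mu>) + (\<Sum>\<mu>\<le>M. of_real (a \<mu>) * z ^ \<mu>)) / 2"
      by (simp add: M_def field_simps)
    finally have "F * (\<Sum>\<mu>\<le>(n + 1) div 2. of_real (e \<mu> * a \<mu>) * z ^ \<mu>) =
        ((\<Sum>\<mu>\<le>K. of_real (a \<mu>) * z ^ \<mu>) * F + (\<Sum>\<mu>\<le>M. of_real (a \<mu>) * z ^ \<mu>) * F) / 2"
      by (simp add: algebra_simps)
    also have "\<dots> = ((1 - of_real (a (K + 1)) * z ^ (K + 1) + of_real (q3 n * a K) * z ^ (K + 2)) +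
        (1 - of_real (a (M + 1)) * z ^ (M + 1) + of_real (q3 n * a M) * z ^ (M + 2))) / 2"
      unfolding F_def truncated_product ..
    finally have FE: "F * (\<Sum>\<mu>\<le>(n + 1) div 2. of_real (e \<mu> * a \<mu>) * z ^ \<mu>) =
        ((1 - of_real (a (K + 1)) * z ^ (K + 1) + of_real (q3 n * a K) * z ^ (K + 2)) +
        (1 - of_real (a (M + 1)) * z ^ (M + 1) + of_real (q3 n * a M) * z ^ (M + 2))) / 2" .
    have "Re (F * (\<Sum>\<mu>\<le>(n + 1) div 2. of_real (e \<mu> * a \<mu>) * z ^ \<mu>)) =
        ((1 - a (K + 1) * Re (z ^ (K + 1)) + q3 n * a K * Re (z ^ (K + 2))) +
        (1 - a (M + 1) * Re (z ^ (M + 1)) + q3 n * a M * Re (z ^ (M + 2)))) / 2"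
      unfolding FE by (simp del: power_Suc of_real_mult)
    also have "Re (z ^ (K + 1)) = cos (\<psi> - 2 * \<theta>)" unfolding zk \<psi>_def K by (simp add: algebra_simps)
    also have "Re (z ^ (K + 2)) = cos \<psi>" unfolding zk \<psi>_def K by (simp add: algebra_simps)
    also have "Re (z ^ (M + 1)) = cos \<psi>" unfolding zk \<psi>_def K M_def by (simp add: algebra_simps)
    also have "Re (z ^ (M + 2)) = cos (\<psi> + 2 * \<theta>)" unfolding zk \<psi>_def K M_def by (simp add: algebra_simps)
    also have "((1 - a (K + 1) * cos (\<psi> - 2 * \<theta>) + q3 n * a K * cos \<psi>) +
        (1 - a (M + 1) * cos \<psi> + q3 n * a M * cos (\<psi> + 2 * \<theta>))) / 2 =
       1 - (cos \<psi> * ((a (M + 1) - q3 n * a (M - 1)) + a M * (1 - q3 n) * cos (2 * \<theta>)) +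
          sin \<psi> * (a M * (1 + q3 n) * sin (2 * \<theta>))) / 2"
      unfolding cos_add cos_diff M_def by (simp add: algebra_simps add_divide_distrib diff_divide_distrib)
    also have "cos (2 * \<theta>) = 1 - 2 * (sin \<theta>)\<^sup>2" by (rule cos_double_sin)
    also have "sin (2 * \<theta>) = 2 * sin \<theta> * cos \<theta>" by (rule sin_double)
    finally have eq: "Re (F * (\<Sum>\<mu>\<le>(n + 1) div 2. of_real (e \<mu> * a \<mu>) * z ^ \<mu>)) =
       1 - (cos \<psi> * ((a (M + 1) - q3 n * a (M - 1)) + a M * (1 - q3 n) * (1 - 2 * (sin \<theta>)\<^sup>2)) +
          sin \<psi> * (a M * (1 + q3 n) * (2 * sin \<theta> * cos \<theta>))) / 2" .
    have "cos \<psi> * ((a (M + 1) - q3 n * a (M - 1)) + a M * (1 - q3 n) * (1 - 2 * (sin \<theta>)\<^sup>2)) +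
          sin \<psi> * (a M * (1 + q3 n) * (2 * sin \<theta> * cos \<theta>)) \<le> 198/100"
      by (rule boundary_odd_le[OF trig N p3_bounds sg _ _ dl odd_bounds[OF M(1)] ne]) (use q3_bounds in simp_all)
    moreover have "X = 1 - B / 2 \<Longrightarrow> B \<le> 198/100 \<Longrightarrow> 1 / 100 \<le> X" for X B :: real by linarith
    ultimately show ?thesis unfolding F_def[symmetric] z_def[symmetric] using eq by blast
  qed
qed

end

context ultraspherical_gauss
begin

text \<open>The ratio \<open>rho 3\<close> has the factor 3 - l, so the series stops after its
  quadratic term.\<close>

lemma fc_three:
  assumes l3: "l = 3"
  shows "fc 1 = - (2 * p3 n)" "fc 2 = q3 n" "fc (v + 3) = 0"
proof -
  have r1: "rho (Suc 0) = - 2 * p3 n" unfolding rho_def p3_def using l3 by (simp add: algebra_simps)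
  have r2: "rho (Suc (Suc 0)) = - ((real n + 2) / (real n + 5)) / 2"
    unfolding rho_def using l3 by (simp add: divide_simps)
  have r3: "rho (Suc (Suc (Suc 0))) = 0" unfolding rho_def using l3 by simp
  show "fc 1 = - (2 * p3 n)" using r1 by simp
  have "q3 n = p3 n * ((real n + 2) / (real n + 5))" by (simp add: q3_def p3_def)
  moreover have "- X / 2 * (- 2 * A * 1) = A * X" for X A :: real by simp
  ultimately show "fc 2 = q3 n" unfolding numeral_2_eq_2 fc.simps r1 r2 by (simp only:)
  show "fc (v + 3) = 0"
  proof (induction v)
    case 0
    show ?case using r3 by (simp add: numeral_3_eq_3)
  next
    case (Suc v)
    thus ?case unfolding add_Suc fc.simps by simp
  qed
qed

lemma al_three:
  assumes l3: "l = 3"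
  shows "al 1 = 2 * p3 n" "al (m + 2) = 2 * p3 n * al (m + 1) - q3 n * al m"
proof -
  show "al 1 = 2 * p3 n" using fc_three(1)[OF l3] by (subst al.simps) simp
  have "0 = (\<Sum>k\<le>m + 2. al k * fc (m + 2 - k))" using al_conv[of "m + 2"] by simp
  also have "\<dots> = (\<Sum>k\<in>{m, m + 1, m + 2}. al k * fc (m + 2 - k))"
  proof (rule sum.mono_neutral_right)
    show "\<forall>k\<in>{..m + 2} - {m, m + 1, m + 2}. al k * fc (m + 2 - k) = 0"
    proof
      fix k assume "k \<in> {..m + 2} - {m, m + 1, m + 2}"
      hence "k < m" by auto
      hence e: "m + 2 - k = (m - 1 - k) + 3" by simp
      show "al k * fc (m + 2 - k) = 0" unfolding e fc_three(3)[OF l3] by simp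
    qed
  qed auto
  also have "\<dots> = al m * fc 2 + al (m + 1) * fc 1 + al (m + 2)" by simp
  finally show "al (m + 2) = 2 * p3 n * al (m + 1) - q3 n * al m"
    unfolding fc_three(1,2)[OF l3] by (simp add: algebra_simps)
qed

text \<open>With a polynomial F as series, the radial limit is - I / 2 = kappa exp (i (n + 1)
  \<theta>) F at exp (2 i \<theta>), where I is \<open>wi Py\<close>. Reality of I is the node
  equation, and conjugating the identity turns I times the value of \<open>Ehat\<close> into - 4
  kappa Re (F w1).\<close>

lemma Ehat_at_gauss_node_three:
  assumes l3: "l = 3" and big: "n \<ge> 300" "\<And>M. n \<le> 2 * M \<Longrightarrow> sqrt (q3 n) ^ M \<le> 23/100"
    and P: "P = [:- cos \<theta>, 1:] * Py" and \<theta>: "0 < \<theta>" "\<theta> < pi"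
  shows "poly Ehat (cos \<theta>) * wi Py \<le> - (4 * kappa * (1 / 100))"
proof -
  interpret recurrence3 n al
    using big al_three[OF l3] by unfold_locales auto
  define \<zeta> where "\<zeta> = (\<lambda>m. complex_of_real (1 - 1 / (real m + 2)) * cis \<theta>)"
  have \<zeta>: "norm (\<zeta> m) < 1" "\<zeta> \<longlonglongrightarrow> cis \<theta>" for m
    unfolding \<zeta>_def by (rule radial_sequence)+
  define I where "I = wi Py"
  define F where "F = (\<lambda>z :: complex. 1 - of_real (2 * p3 n) * z + of_real (q3 n) * z\<^sup>2)"
  have gen: "gen_int \<zeta> = of_real kappa * \<zeta> ^ (n + 1) * F (\<zeta>\<^sup>2)" if "norm \<zeta> < 1" for \<zeta>
  proof -
    let ?f = "\<lambda>v. complex_of_real (fc v) * \<zeta> ^ (2 * v) * (of_real kappa * \<zeta> ^ (n + 1))"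
    have "?f sums (\<Sum>v\<in>{0, 1, 2}. ?f v)"
    proof (rule sums_finite)
      fix v :: nat assume "v \<notin> {0, 1, 2}"
      hence "fc v = 0" using fc_three(3)[OF l3, of "v - 3"] by auto
      thus "?f v = 0" by simp
    qed simp
    also have "(\<Sum>v\<in>{0, 1, 2}. ?f v) = of_real kappa * \<zeta> ^ (n + 1) * F (\<zeta>\<^sup>2)"
      using fc_three(1,2)[OF l3] by (simp add: F_def algebra_simps eval_nat_numeral)
    finally show ?thesis using fc_sums[OF that] sums_unique2 by blast
  qed
  have "(\<lambda>m. gen_int (\<zeta> m)) \<longlonglongrightarrow> of_real (- I / 2)"
    unfolding \<zeta>_def I_def by (rule gen_int_limit[OF P \<theta>])
  moreover have "(\<lambda>m. gen_int (\<zeta> m)) = (\<lambda>m. of_real kappa * \<zeta> m ^ (n + 1) * F ((\<zeta> m)\<^sup>2))"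
    using gen[OF \<zeta>(1)] by (rule ext)
  moreover have "(\<lambda>m. of_real kappa * \<zeta> m ^ (n + 1) * F ((\<zeta> m)\<^sup>2)) \<longlonglongrightarrow> of_real kappa * cis \<theta> ^ (n + 1) * F ((cis \<theta>)\<^sup>2)"
    unfolding F_def by (intro tendsto_intros \<zeta>)
  ultimately have lim: "of_real (- I / 2) = of_real kappa * cis \<theta> ^ (n + 1) * F ((cis \<theta>)\<^sup>2)"
    by (metis LIMSEQ_unique)
  define w1 where "w1 = (\<Sum>\<mu>\<le>(n + 1) div 2. complex_of_real (eta \<mu> * al \<mu>) * ((cis \<theta>)\<^sup>2) ^ \<mu>)"
  define E1 where "E1 = cis \<theta> ^ (n + 1)"
  have "of_real kappa * (E1 * F ((cis \<theta>)\<^sup>2)) = of_real (- I / 2)"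
    using lim by (simp add: E1_def mult.assoc)
  hence "Im (of_real kappa * (E1 * F ((cis \<theta>)\<^sup>2))) = 0" by (simp only: Im_complex_of_real)
  hence node: "Im (E1 * F ((cis \<theta>)\<^sup>2)) = 0" using kappa_pos by simp
  have R: "1 / 100 \<le> Re (F ((cis \<theta>)\<^sup>2) * w1)"
    unfolding F_def w1_def by (rule Re_truncated_ge) (use node in \<open>auto simp: F_def E1_def eta_def\<close>)
  have "complex_of_real I = - 2 * of_real (- I / 2)" by simp
  also have "\<dots> = - 2 * (of_real kappa * (E1 * F ((cis \<theta>)\<^sup>2)))"
    unfolding lim E1_def by (simp only: mult.assoc)
  finally have "cnj (of_real I) = cnj (- 2 * (of_real kappa * (E1 * F ((cis \<theta>)\<^sup>2))))" by simp
  hence cI: "complex_of_real I = - 2 * of_real kappa * (cnj E1 * cnj (F ((cis \<theta>)\<^sup>2)))" by simp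
  have cE: "cnj E1 * E1 = 1" by (simp add: E1_def Complex.DeMoivre cis_cnj cis_mult del: power_Suc)
  have "of_real I * (E1 * cnj w1) = - 2 * of_real kappa * (cnj E1 * E1) * (cnj (F ((cis \<theta>)\<^sup>2)) * cnj w1)"
    unfolding cI by (simp only: mult_ac)
  also have "\<dots> = - 2 * of_real kappa * cnj (F ((cis \<theta>)\<^sup>2) * w1)" unfolding cE by simp
  finally have "of_real I * (E1 * cnj w1) = - 2 * of_real kappa * cnj (F ((cis \<theta>)\<^sup>2) * w1)" .
  hence "Re (of_real I * (E1 * cnj w1)) = Re (- 2 * of_real kappa * cnj (F ((cis \<theta>)\<^sup>2) * w1))" by simp
  hence "I * Re (E1 * cnj w1) = - 2 * kappa * Re (F ((cis \<theta>)\<^sup>2) * w1)" by simp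
  moreover have "poly Ehat (cos \<theta>) = 2 * Re (E1 * cnj w1)"
    unfolding poly_Ehat_eq_Re w1_def E1_def ..
  ultimately have "poly Ehat (cos \<theta>) * I = - (4 * kappa * Re (F ((cis \<theta>)\<^sup>2) * w1))" by (simp add: algebra_simps)
  also have "\<dots> \<le> - (4 * kappa * (1 / 100))" using R kappa_pos by (intro le_imp_neg_le mult_left_mono) auto
  finally show ?thesis unfolding I_def .
qed

end

section \<open>Gauss-Kronrod formulas\<close>

lemma quadrature_sum_over_nodes:
  assumes "quadrature_formula N Q"
  obtains a where "\<And>g. apply_quadrature Q g = (\<Sum>z\<in>node_set Q. a z * g z)"
    "\<And>g. (\<Sum>j=1..num_nodes Q. \<bar>coefficient Q j\<bar> * g (node Q j)) = (\<Sum>z\<in>node_set Q. \<bar>a z\<bar> * g z)"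
    "finite (node_set Q)" "card (node_set Q) = N"
proof -
  have N: "num_nodes Q = N" and inj: "inj_on (node Q) {1..N}"
    using assms by (auto simp: quadrature_formula_def intro: strict_mono_on_imp_inj_on)
  define a where "a = (\<lambda>z. coefficient Q (the_inv_into {1..N} (node Q) z))"
  have a: "a (node Q j) = coefficient Q j" if "j \<in> {1..N}" for j
    unfolding a_def using the_inv_into_f_f[OF inj that] by simp
  have 1: "apply_quadrature Q g = (\<Sum>z\<in>node_set Q. a z * g z)" for g
    unfolding apply_quadrature_def node_set_def N sum.reindex[OF inj] by (intro sum.cong) (auto simp: a)
  have 2: "(\<Sum>j=1..num_nodes Q. \<bar>coefficient Q j\<bar> * g (node Q j)) = (\<Sum>z\<in>node_set Q. \<bar>a z\<bar> * g z)" for g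
    unfolding node_set_def N sum.reindex[OF inj] by (intro sum.cong) (auto simp: a)
  have "finite (node_set Q)" by (simp add: node_set_def)
  moreover have "card (node_set Q) = N" unfolding node_set_def N card_image[OF inj] by simp
  ultimately show thesis by (rule that[OF 1 2])
qed

lemma sign_prod_differences:
  fixes z :: real
  assumes "finite X"
  shows "0 < (-1) ^ card {u \<in> X. z < u} * (\<Prod>u\<in>X - {z}. z - u)"
proof -
  have "X - {z} = {u \<in> X. u < z} \<union> {u \<in> X. z < u}" by auto
  hence "(\<Prod>u\<in>X - {z}. z - u) = (\<Prod>u\<in>{u \<in> X. u < z}. z - u) * (\<Prod>u\<in>{u \<in> X. z < u}. z - u)"
    using assms by (simp add: prod.union_disjoint disjoint_iff)
  also have "(\<Prod>u\<in>{u \<in> X. z < u}. z - u) = (\<Prod>u\<in>{u \<in> X. z < u}. (-1) * (u - z))"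
    by (intro prod.cong) auto
  also have "\<dots> = (-1) ^ card {u \<in> X. z < u} * (\<Prod>u\<in>{u \<in> X. z < u}. u - z)"
    by (simp only: prod.distrib prod_constant)
  finally have "(-1) ^ card {u \<in> X. z < u} * (\<Prod>u\<in>X - {z}. z - u) =
      ((-1) ^ card {u \<in> X. z < u} * (-1) ^ card {u \<in> X. z < u}) *
      ((\<Prod>u\<in>{u \<in> X. u < z}. z - u) * (\<Prod>u\<in>{u \<in> X. z < u}. u - z))"
    by (simp only: mult_ac)
  also have "(-1) ^ card {u \<in> X. z < u} * (-1) ^ card {u \<in> X. z < u} = (1 :: real)"
    by (simp flip: power_mult_distrib)
  also have "1 * ((\<Prod>u\<in>{u \<in> X. u < z}. z - u) * (\<Prod>u\<in>{u \<in> X. z < u}. u - z)) > 0"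
    unfolding mult_1 by (intro mult_pos_pos prod_pos) auto
  finally show ?thesis .
qed

text \<open>If the elements of \<open>Y\<close> have odd rank, they occupy all \<open>n\<close> odd ranks below \<open>2 n + 1\<close>.\<close>

lemma even_rank_of_odd_ranks:
  fixes X Y :: "real set"
  assumes X: "finite X" "card X = 2 * n + 1" and Y: "Y \<subseteq> X" "card Y = n"
    and odd: "\<And>y. y \<in> Y \<Longrightarrow> odd (card {u \<in> X. y < u})" and z: "z \<in> X - Y"
  shows "even (card {u \<in> X. z < u})"
proof (rule ccontr)
  define rk where "rk = (\<lambda>z. card {u \<in> X. z < u})"
  assume "odd (card {u \<in> X. z < u})"
  hence zo: "odd (rk z)" by (simp add: rk_def)
  have less: "rk v < rk u" if "u \<in> X" "v \<in> X" "u < v" for u v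
    unfolding rk_def using X that by (intro psubset_card_mono) auto
  have inj: "inj_on rk X"
  proof (rule inj_onI)
    fix u v assume "u \<in> X" "v \<in> X" "rk u = rk v"
    thus "u = v" using less[of u v] less[of v u] by (cases u v rule: linorder_cases) auto
  qed
  have rkX: "rk u < 2 * n + 1" if "u \<in> X" for u
    unfolding rk_def X(2)[symmetric] using X that by (intro psubset_card_mono) auto
  define R where "R = (\<lambda>i :: nat. 2 * i + 1) ` {..<n}"
  have R: "finite R" "card R = n" unfolding R_def by (auto simp: card_image inj_on_def)
  have in_R: "rk u \<in> R" if "u \<in> X" and o: "odd (rk u)" for u
  proof -
    from o obtain i where "rk u = 2 * i + 1" by (elim oddE)
    thus ?thesis using rkX[OF \<open>u \<in> X\<close>] by (auto simp: R_def)
  qed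
  have "rk ` Y \<subseteq> R" using in_R Y odd by (auto simp: rk_def)
  moreover have "card (rk ` Y) = n" using inj_on_subset[OF inj Y(1)] Y(2) by (simp add: card_image)
  ultimately have "rk ` Y = R" using R by (intro card_subset_eq) auto
  hence "rk z \<in> rk ` Y" using in_R z zo by blast
  then obtain y where "y \<in> Y" "rk z = rk y" by blast
  thus False using inj z Y(1) by (auto simp: inj_on_def)
qed

lemma poly_prod_linear: "poly (\<Prod>u\<in>A. [:- u, 1:]) (x :: real) = (\<Prod>u\<in>A. x - u)"
  unfolding poly_prod by (intro prod.cong refl) simp

lemma degree_prod_linear: "finite A \<Longrightarrow> degree (\<Prod>u\<in>A. [:- u, 1:] :: real poly) = card A"
  by (subst degree_prod_eq_sum_degree) auto

lemma coeff_prod_linear: "finite A \<Longrightarrow> coeff (\<Prod>u\<in>A. [:- u, 1:] :: real poly) (card A) = 1"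
  using degree_prod_linear[of A] lead_coeff_prod[of "\<lambda>u. [:- u, 1:]" A] by simp

context ultraspherical_gauss
begin

lemma P_split: "y \<in> Y \<Longrightarrow> P = [:- y, 1:] * (\<Prod>u\<in>Y - {y}. [:- u, 1:])"
  unfolding P_def using fin_Y by (rule prod.remove)

text \<open>For y = 1 or y = -1 the polynomial P Py = (x - y) Py^2 would have constant sign on the
  interval, against the orthogonality of P to Py.\<close>

lemma node_interior:
  assumes y: "y \<in> Y"
  shows "-1 < y" "y < 1"
proof -
  define Py where "Py = (\<Prod>u\<in>Y - {y}. [:- u, 1:])"
  have P': "P = [:- y, 1:] * Py" unfolding Py_def by (rule P_split[OF y])
  have nz: "Py \<noteq> 0" "[:- y, 1:] \<noteq> 0" using P' P_nz by auto
  have "degree Py < n" unfolding Py_def using fin_Y card_Y y n by (simp add: degree_prod_linear)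
  hence orth0: "wi (P * Py) = 0" by (rule orth)
  have "y \<noteq> 1"
  proof
    assume y1: "y = 1"
    have "0 < wi (- (P * Py))"
    proof (rule wi_pos)
      show "- (P * Py) \<noteq> 0" using P_nz nz by simp
      fix x :: real assume x: "x \<in> {-1<..<1}"
      have "poly (- (P * Py)) x = (1 - x) * (poly Py x)\<^sup>2" by (simp add: P' y1 power2_eq_square algebra_simps)
      thus "0 \<le> poly (- (P * Py)) x" using x by simp
    qed
    thus False unfolding wi_minus orth0 by simp
  qed
  moreover have "y \<noteq> -1"
  proof
    assume y1: "y = -1"
    have "0 < wi (P * Py)"
    proof (rule wi_pos)
      show "P * Py \<noteq> 0" using P_nz nz by simp
      fix x :: real assume x: "x \<in> {-1<..<1}"
      have "poly (P * Py) x = (1 + x) * (poly Py x)\<^sup>2" by (simp add: P' y1 power2_eq_square algebra_simps)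
      thus "0 \<le> poly (P * Py) x" using x by simp
    qed
    thus False using orth0 by simp
  qed
  ultimately show "-1 < y" "y < 1" using Y_Icc y by force+
qed

text \<open>Division of \<open>Ehat\<close> by x - y leaves a quotient with leading coefficient
  2^(n+1), and P times it integrates to 2 kappa. This term is the source of the difference between
  the Kronrod and the Gauss weight at y.\<close>

lemma wi_quotient_Ehat:
  assumes P: "P = [:- y, 1:] * Py"
  shows "wi (Py * Ehat) = poly Ehat y * wi Py + 2 * kappa"
proof -
  define D where "D = synthetic_div Ehat y"
  have E: "Ehat = [:- y, 1:] * D + [:poly Ehat y:]" unfolding D_def by (rule synthetic_div_correct'[symmetric])
  have dD: "degree D \<le> n" unfolding D_def using degree_Ehat_le by (simp add: degree_synthetic_div)
  have "coeff Ehat (n + 1) = coeff D n"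
    by (subst E) (use dD in \<open>simp add: coeff_eq_0 coeff_pCons\<close>)
  hence cD: "coeff D n = 2 ^ (n + 1)" using coeff_Ehat_top by simp
  have "Py * Ehat = P * D + smult (poly Ehat y) Py"
    by (subst E) (simp add: P algebra_simps)
  hence "wi (Py * Ehat) = wi (P * D) + poly Ehat y * wi Py" by (simp only: wi_linear)
  also have "wi (P * D) = 2 * kappa" using wi_P_top[OF dD] by (simp add: cD kappa_eq)
  finally show ?thesis by (simp only: add.commute)
qed

text \<open>The constant arises as follows: at a Gauss node the weight a is at least \<gamma> -
  \<gamma> / (2 c0), with \<gamma> the Gauss weight, so |a| <= a + \<gamma> / c0. The surplus is
  summed by the Gauss formula itself, exact to degree 2 n - 1, and amounts to 1 / c0 times the
  integral.\<close>

lemma kronrod_dominated: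
  assumes Q: "quadrature_formula (2 * n + 1) Q" "exact_to_degree (ultraspherical_weight l) (3 * n + 1) Q"
    and G: "gauss_formula (ultraspherical_weight l) n G" "node_set G = Y" "Y \<subseteq> node_set Q" and c0: "c0 > 0"
    and key: "\<And>\<theta> Py. P = [:- cos \<theta>, 1:] * Py \<Longrightarrow> 0 < \<theta> \<Longrightarrow> \<theta> < pi \<Longrightarrow>
       poly Ehat (cos \<theta>) * wi Py \<le> - (4 * kappa * c0)"
  shows "dominated (1 + 1 / c0) (2 * n - 1) (ultraspherical_weight l) Q"
proof -
  define X where "X = node_set Q"
  obtain a where a: "\<And>g. apply_quadrature Q g = (\<Sum>z\<in>X. a z * g z)"
    "\<And>g. (\<Sum>j=1..num_nodes Q. \<bar>coefficient Q j\<bar> * g (node Q j)) = (\<Sum>z\<in>X. \<bar>a z\<bar> * g z)"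
    "finite X" "card X = 2 * n + 1"
    unfolding X_def using quadrature_sum_over_nodes[OF Q(1)] by metis
  have Gq: "quadrature_formula n G" "exact_to_degree (ultraspherical_weight l) (2 * n - 1) G"
    using G by (auto simp: gauss_formula_def)
  obtain \<gamma> where \<gamma>: "\<And>g. apply_quadrature G g = (\<Sum>z\<in>Y. \<gamma> z * g z)"
    using quadrature_sum_over_nodes[OF Gq(1)] G(2) by metis
  have YX: "Y \<subseteq> X" using G(3) by (simp add: X_def)
  have Qex: "wi p = (\<Sum>z\<in>X. a z * poly p z)" if "degree p \<le> 3 * n + 1" for p
    using Q(2) that unfolding exact_to_degree_def a(1) by simp
  have Gex: "wi p = (\<Sum>z\<in>Y. \<gamma> z * poly p z)" if "degree p \<le> 2 * n - 1" for p
    using Gq(2) that unfolding exact_to_degree_def \<gamma> by simp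
  define E where "E = (\<Prod>z\<in>X - Y. [:- z, 1:])"
  have finE: "finite (X - Y)" using a(3) by simp
  have cardE: "card (X - Y) = n + 1" using a(3,4) YX card_Y fin_Y by (simp add: card_Diff_subset)
  have dE: "degree E = n + 1" "coeff E (n + 1) = 1"
    using degree_prod_linear[OF finE] coeff_prod_linear[OF finE] by (simp_all add: E_def cardE)
  have P0: "poly P z = 0" if "z \<in> Y" for z using that fin_Y by (simp add: P_def poly_prod_linear)
  have E0: "poly E z = 0" if "z \<in> X - Y" for z using that finE by (simp add: E_def poly_prod_linear)
  have EhatE: "Ehat = smult (2 ^ (n + 1)) E"
  proof (rule Ehat_unique[OF dE])
    fix q :: "real poly" assume q: "degree q \<le> n"
    have "degree (P * (E * q)) \<le> n + (n + 1 + n)"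
      using dE q degree_P by (intro order.trans[OF degree_mult_le] add_mono) auto
    hence "wi (P * (E * q)) = (\<Sum>z\<in>X. a z * poly (P * (E * q)) z)" by (intro Qex) simp
    also have "\<dots> = 0"
    proof (intro sum.neutral ballI)
      fix z assume "z \<in> X"
      thus "a z * poly (P * (E * q)) z = 0" using P0[of z] E0[of z] by (cases "z \<in> Y") auto
    qed
    finally show "wi (P * (E * q)) = 0" .
  qed
  \<comment> \<open>The derivative at z of the monic polynomial vanishing at all nodes; its sign is
    the parity of the rank of z.\<close>
  define W where "W = (\<lambda>z. \<Prod>u\<in>X - {z}. z - u)"
  have gauss: "\<gamma> y > 0 \<and> W y < 0 \<and> a y \<ge> \<gamma> y - \<gamma> y / (2 * c0)" if y: "y \<in> Y" for y
  proof -
    define Py where "Py = (\<Prod>u\<in>Y - {y}. [:- u, 1:])"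
    have P': "P = [:- y, 1:] * Py" unfolding Py_def by (rule P_split[OF y])
    have finYy: "finite (Y - {y})" using fin_Y by simp
    have dPy: "degree Py = n - 1" unfolding Py_def using y card_Y fin_Y by (simp add: degree_prod_linear)
    have Py0: "poly Py z = 0" if "z \<in> Y" "z \<noteq> y" for z using that finYy by (simp add: Py_def poly_prod_linear)
    define k where "k = poly Py y"
    have "wi (Py * Py) = (\<Sum>z\<in>Y. \<gamma> z * poly (Py * Py) z)"
      using dPy n by (intro Gex order.trans[OF degree_mult_le]) auto
    also have "\<dots> = (\<Sum>z\<in>{y}. \<gamma> z * poly (Py * Py) z)"
      using y fin_Y Py0 by (intro sum.mono_neutral_right) auto
    finally have "\<gamma> y * k\<^sup>2 = wi (Py * Py)" by (simp add: k_def power2_eq_square)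
    also have "\<dots> > 0" using P_nz P' by (intro wi_pos) auto
    finally have g: "\<gamma> y > 0" by (simp add: zero_less_mult_iff)
    have "wi Py = (\<Sum>z\<in>Y. \<gamma> z * poly Py z)" using dPy n by (intro Gex) simp
    also have "\<dots> = (\<Sum>z\<in>{y}. \<gamma> z * poly Py z)"
      using y fin_Y Py0 by (intro sum.mono_neutral_right) auto
    finally have wPy: "wi Py = \<gamma> y * k" by (simp add: k_def)
    define h where "h = poly Ehat y"
    have "wi (Py * Ehat) = (\<Sum>z\<in>X. a z * poly (Py * Ehat) z)"
      using dPy degree_Ehat_le n by (intro Qex order.trans[OF degree_mult_le]) auto
    also have "\<dots> = (\<Sum>z\<in>{y}. a z * poly (Py * Ehat) z)"
    proof (rule sum.mono_neutral_right)
      show "\<forall>z\<in>X - {y}. a z * poly (Py * Ehat) z = 0"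
      proof
        fix z assume "z \<in> X - {y}"
        thus "a z * poly (Py * Ehat) z = 0" using Py0[of z] E0[of z] by (cases "z \<in> Y") (auto simp: EhatE)
      qed
    qed (use a(3) y YX in auto)
    finally have akh: "a y * (k * h) = h * (\<gamma> y * k) + 2 * kappa"
      unfolding wi_quotient_Ehat[OF P'] by (simp add: wPy k_def h_def)
    have y_int: "-1 < y" "y < 1" using node_interior[OF y] by auto
    hence "0 < arccos y" "arccos y < pi" "cos (arccos y) = y" using arccos_lt_bounded[of y] by auto
    hence "h * wi Py \<le> - (4 * kappa * c0)" using key[of "arccos y" Py] P' by (simp add: h_def)
    hence bound: "\<gamma> y * (k * h) \<le> - (4 * kappa * c0)" by (simp add: wPy mult_ac)
    moreover have "4 * kappa * c0 > 0" using kappa_pos c0 by simp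
    ultimately have "\<gamma> y * (k * h) < 0" by linarith
    hence kh: "k * h < 0" using g by (simp add: mult_less_0_iff)
    have "W y = k * poly E y"
    proof -
      have "X - {y} = (Y - {y}) \<union> (X - Y)" using y YX by auto
      thus ?thesis unfolding W_def k_def Py_def E_def poly_prod_linear using finYy finE
        by (simp add: prod.union_disjoint disjoint_iff)
    qed
    also have "\<dots> = (k * h) / 2 ^ (n + 1)" by (simp add: h_def EhatE)
    also have "\<dots> < 0" using kh by (simp add: divide_neg_pos)
    finally have Wy: "W y < 0" .
    \<comment> \<open>The weights satisfy a y k h = \<gamma> y k h + 2 kappa with k h < 0, and the
      hypothesis \<open>key\<close> bounds the perturbation 2 kappa by a multiple of \<gamma> y |k
      h|.\<close>
    have "(\<gamma> y - \<gamma> y / (2 * c0)) * - (k * h) \<le> a y * - (k * h)"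
    proof -
      have "4 * kappa * c0 / (2 * c0) \<le> - (\<gamma> y * (k * h)) / (2 * c0)"
        using bound c0 by (intro divide_right_mono) auto
      hence "2 * kappa \<le> - (\<gamma> y * (k * h)) / (2 * c0)" using c0 by simp
      moreover have "(\<gamma> y - \<gamma> y / (2 * c0)) * - (k * h) = - (\<gamma> y * (k * h)) - (- (\<gamma> y * (k * h)) / (2 * c0))"
        by (simp add: left_diff_distrib)
      moreover have "a y * - (k * h) = - (\<gamma> y * (k * h)) - 2 * kappa" using akh by (simp add: mult_ac)
      ultimately show ?thesis by linarith
    qed
    hence "\<gamma> y - \<gamma> y / (2 * c0) \<le> a y" by (rule mult_right_le_imp_le) (use kh in simp)
    with g Wy show ?thesis by simp
  qed
  have rank_odd: "odd (card {u \<in> X. y < u})" if "y \<in> Y" for y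
  proof
    assume "even (card {u \<in> X. y < u})"
    hence "0 < W y" using sign_prod_differences[OF a(3), of y] by (simp add: W_def)
    thus False using gauss[OF that] by simp
  qed
  have kron: "a z \<ge> 0" if z: "z \<in> X - Y" for z
  proof -
    have "even (card {u \<in> X. z < u})"
      using a(3,4) YX card_Y rank_odd z by (rule even_rank_of_odd_ranks)
    hence Wz: "0 < W z" using sign_prod_differences[OF a(3), of z] by (simp add: W_def)
    define Ez where "Ez = (\<Prod>u\<in>X - Y - {z}. [:- u, 1:])"
    have finEz: "finite (X - Y - {z})" using finE by simp
    have cardEz: "card (X - Y - {z}) = n" using cardE z finE by simp
    have dEz: "degree Ez = n" "coeff Ez n = 1"
      using degree_prod_linear[OF finEz] coeff_prod_linear[OF finEz] by (simp_all add: Ez_def cardEz)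
    have Ez0: "poly Ez u = 0" if "u \<in> X - Y" "u \<noteq> z" for u
      using that finEz by (simp add: Ez_def poly_prod_linear)
    have "wi (P * Ez) = (\<Sum>u\<in>X. a u * poly (P * Ez) u)"
      using dEz degree_P by (intro Qex order.trans[OF degree_mult_le]) auto
    also have "\<dots> = (\<Sum>u\<in>{z}. a u * poly (P * Ez) u)"
    proof (rule sum.mono_neutral_right)
      show "\<forall>u\<in>X - {z}. a u * poly (P * Ez) u = 0"
      proof
        fix u assume "u \<in> X - {z}"
        thus "a u * poly (P * Ez) u = 0" using P0[of u] Ez0[of u] by (cases "u \<in> Y") auto
      qed
    qed (use a(3) z in auto)
    also have "\<dots> = a z * W z"
    proof -
      have "X - {z} = Y \<union> (X - Y - {z})" using z YX by auto
      thus ?thesis unfolding W_def Ez_def P_def using fin_Y finEz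
        by (simp add: prod.union_disjoint disjoint_iff poly_prod_linear)
    qed
    finally have "a z * W z = wi (P * P)" using wi_P_top[of Ez] dEz by simp
    hence "a z * W z > 0" using wi_PP_pos by simp
    thus ?thesis using Wz by (simp add: zero_less_mult_iff)
  qed
  show ?thesis unfolding dominated_def
  proof (intro allI impI)
    fix p :: "real poly" assume dp: "degree p \<le> 2 * n - 1" and p0: "\<forall>x\<in>{-1..1}. 0 \<le> poly p x"
    have X_Icc: "X \<subseteq> {-1..1}" using Q(1) by (simp add: X_def quadrature_formula_def)
    have "(\<Sum>z\<in>X. \<bar>a z\<bar> * poly p z) \<le> (\<Sum>z\<in>X. a z * poly p z + (if z \<in> Y then \<gamma> z / c0 * poly p z else 0))"
    proof (rule sum_mono)
      fix z assume z: "z \<in> X"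
      hence pz: "0 \<le> poly p z" using p0 X_Icc by blast
      show "\<bar>a z\<bar> * poly p z \<le> a z * poly p z + (if z \<in> Y then \<gamma> z / c0 * poly p z else 0)"
      proof (cases "z \<in> Y")
        case True
        have "\<gamma> z / c0 = 2 * (\<gamma> z / (2 * c0))" by simp
        moreover have "\<gamma> z / (2 * c0) > 0" using gauss[OF True] c0 by simp
        ultimately have "\<bar>a z\<bar> \<le> a z + \<gamma> z / c0" using gauss[OF True] by linarith
        hence "\<bar>a z\<bar> * poly p z \<le> (a z + \<gamma> z / c0) * poly p z" using pz by (rule mult_right_mono)
        thus ?thesis using True by (simp add: distrib_right)
      next
        case False
        thus ?thesis using kron[of z] z by simp
      qed
    qed
    also have "\<dots> = wi p + (\<Sum>z\<in>X. if z \<in> Y then \<gamma> z / c0 * poly p z else 0)"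
      using Qex[of p] dp by (simp add: sum.distrib)
    also have "(\<Sum>z\<in>X. if z \<in> Y then \<gamma> z / c0 * poly p z else 0) = (\<Sum>z\<in>Y. \<gamma> z / c0 * poly p z)"
      using a(3) YX by (intro sum.mono_neutral_cong_right) auto
    also have "\<dots> = (1 / c0) * wi p" using Gex[OF dp] by (simp add: sum_divide_distrib)
    also have "wi p + (1 / c0) * wi p = (1 + 1 / c0) * wi p" by (simp add: distrib_right)
    finally show "(\<Sum>j=1..num_nodes Q. \<bar>coefficient Q j\<bar> * poly p (node Q j)) \<le> (1 + 1 / c0) * wi p"
      unfolding a(2) .
  qed
qed

end

lemma ultraspherical_gauss_of_formula:
  assumes l: "0 \<le> l" and n: "1 \<le> n" and G: "gauss_formula (ultraspherical_weight l) n G"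
  shows "ultraspherical_gauss l n (node_set G) (\<Prod>y\<in>node_set G. [:- y, 1:])"
proof -
  have q: "quadrature_formula n G" and ex: "exact_to_degree (ultraspherical_weight l) (2 * n - 1) G"
    using G by (auto simp: gauss_formula_def)
  obtain a where a: "\<And>g. apply_quadrature G g = (\<Sum>z\<in>node_set G. a z * g z)"
    "finite (node_set G)" "card (node_set G) = n"
    using quadrature_sum_over_nodes[OF q] by metis
  show ?thesis
  proof
    fix s :: "real poly" assume s: "degree s < n"
    let ?p = "(\<Prod>y\<in>node_set G. [:- y, 1:]) * s"
    have "degree ?p \<le> 2 * n - 1"
      using s degree_prod_linear[OF a(2)] a(3) by (intro order.trans[OF degree_mult_le]) simp
    hence "apply_quadrature G (poly ?p) = weighted_integral (ultraspherical_weight l) (poly ?p)"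
      using ex unfolding exact_to_degree_def by blast
    hence "weighted_integral (ultraspherical_weight l) (poly ?p) = (\<Sum>z\<in>node_set G. a z * poly ?p z)"
      unfolding a(1) by (rule sym)
    also have "\<dots> = 0"
      using a(2) by (intro sum.neutral ballI) (simp add: poly_prod_linear)
    finally show "weighted_integral (ultraspherical_weight l) (poly ?p) = 0" .
  qed (use l n a q in \<open>auto simp: quadrature_formula_def\<close>)
qed

lemma exact_to_degree_mono: "exact_to_degree w d Q \<Longrightarrow> d' \<le> d \<Longrightarrow> exact_to_degree w d' Q"
  by (auto simp: exact_to_degree_def)

lemma dominated_mono: "dominated c d w Q \<Longrightarrow> d' \<le> d \<Longrightarrow> dominated c d' w Q"
  unfolding dominated_def by (meson order.trans)

text \<open>\<open>key\<close> is demanded for large n only, as the parameter 3 requires, and for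
  all Y and P because the Gauss nodes are obtained from \<open>Q n\<close> inside the proof.\<close>

lemma error_order_of_kronrod:
  assumes l: "0 \<le> l" and f: "f \<in> V s" and c0: "c0 > 0"
    and Q: "\<forall>\<^sub>F n in sequentially. gauss_kronrod_formula (ultraspherical_weight l) n (Q n)"
    and key: "\<forall>\<^sub>F n in sequentially. \<forall>Y P \<theta> Py. ultraspherical_gauss l n Y P \<longrightarrow> P = [:- cos \<theta>, 1:] * Py \<longrightarrow>
       0 < \<theta> \<longrightarrow> \<theta> < pi \<longrightarrow> poly (ultraspherical_gauss.Ehat l n) (cos \<theta>) *
         weighted_integral (ultraspherical_weight l) (poly Py) \<le> - (4 * ultraspherical_gauss.kappa l n P * c0)"
  shows "error_order (ultraspherical_weight l) Q f s"
proof (rule error_order_of_dominated[OF admissible_ultraspherical[OF l] f, of "1 + 1 / c0"])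
  show "0 \<le> 1 + 1 / c0" using c0 by simp
  show "\<forall>\<^sub>F n in sequentially. node_set (Q n) \<subseteq> {-1..1} \<and> exact_to_degree (ultraspherical_weight l) (n - 1) (Q n) \<and>
      dominated (1 + 1 / c0) (n - 1) (ultraspherical_weight l) (Q n)"
    using Q key eventually_ge_at_top[of 1]
  proof eventually_elim
    case (elim n)
    then obtain G where G: "gauss_formula (ultraspherical_weight l) n G" "node_set G \<subseteq> node_set (Q n)"
      and q: "quadrature_formula (2 * n + 1) (Q n)" "exact_to_degree (ultraspherical_weight l) (3 * n + 1) (Q n)"
      by (auto simp: gauss_kronrod_formula_def)
    interpret ultraspherical_gauss l n "node_set G" "\<Prod>y\<in>node_set G. [:- y, 1:]"
      by (rule ultraspherical_gauss_of_formula[OF l elim(3) G(1)])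
    have "dominated (1 + 1 / c0) (2 * n - 1) (ultraspherical_weight l) (Q n)"
      by (rule kronrod_dominated[OF q G(1) refl G(2) c0]) (use elim(2) ultraspherical_gauss_axioms in blast)
    thus ?case using q by (auto simp: quadrature_formula_def intro: dominated_mono exact_to_degree_mono)
  qed
qed

text \<open>The estimate \<open>Ehat_at_gauss_node_le_one\<close> is \<open>key\<close> with c0 =
  1/2, for which the lower bound on the weights at the Gauss nodes becomes 0.\<close>

lemma error_order_kronrod_le_one:
  assumes l: "0 \<le> l" "l \<le> 1" and f: "f \<in> V s"
    and Q: "\<forall>\<^sub>F n in sequentially. gauss_kronrod_formula (ultraspherical_weight l) n (Q n)"
  shows "error_order (ultraspherical_weight l) Q f s"
proof (rule error_order_of_kronrod[OF l(1) f _ Q, of "1 / 2"])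
  have "poly (ultraspherical_gauss.Ehat l n) (cos \<theta>) * weighted_integral (ultraspherical_weight l) (poly Py)
      \<le> - (4 * ultraspherical_gauss.kappa l n P * (1 / 2))"
    if "ultraspherical_gauss l n Y P" "P = [:- cos \<theta>, 1:] * Py" "0 < \<theta>" "\<theta> < pi" for n Y P \<theta> Py
    using ultraspherical_gauss.Ehat_at_gauss_node_le_one[OF that(1) l(2) that(2-4)] by simp
  thus "\<forall>\<^sub>F n in sequentially. \<forall>Y P \<theta> Py. ultraspherical_gauss l n Y P \<longrightarrow> P = [:- cos \<theta>, 1:] * Py \<longrightarrow>
       0 < \<theta> \<longrightarrow> \<theta> < pi \<longrightarrow> poly (ultraspherical_gauss.Ehat l n) (cos \<theta>) *
         weighted_integral (ultraspherical_weight l) (poly Py) \<le> - (4 * ultraspherical_gauss.kappa l n P * (1 / 2))"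
    by (intro always_eventually) blast
qed simp

lemma error_order_kronrod_three:
  assumes f: "f \<in> V s"
    and Q: "\<forall>\<^sub>F n in sequentially. gauss_kronrod_formula (ultraspherical_weight 3) n (Q n)"
  shows "error_order (ultraspherical_weight 3) Q f s"
proof (rule error_order_of_kronrod[OF _ f _ Q, of "1 / 100"])
  show "\<forall>\<^sub>F n in sequentially. \<forall>Y P \<theta> Py. ultraspherical_gauss 3 n Y P \<longrightarrow> P = [:- cos \<theta>, 1:] * Py \<longrightarrow>
       0 < \<theta> \<longrightarrow> \<theta> < pi \<longrightarrow> poly (ultraspherical_gauss.Ehat 3 n) (cos \<theta>) *
         weighted_integral (ultraspherical_weight 3) (poly Py) \<le> - (4 * ultraspherical_gauss.kappa 3 n P * (1 / 100))"
    using eventually_ge_at_top[of 300] eventually_sqrt_q3_power_le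
  proof eventually_elim
    case (elim n)
    show ?case
    proof (intro allI impI)
      fix Y P \<theta> Py
      assume *: "ultraspherical_gauss 3 n Y P" "P = [:- cos \<theta>, 1:] * Py" "0 < \<theta>" "\<theta> < pi"
      show "poly (ultraspherical_gauss.Ehat 3 n) (cos \<theta>) *
         weighted_integral (ultraspherical_weight 3) (poly Py) \<le> - (4 * ultraspherical_gauss.kappa 3 n P * (1 / 100))"
        by (rule ultraspherical_gauss.Ehat_at_gauss_node_three[OF *(1) refl elim(1) _ *(2-4)]) (use elim(2) in blast)
    qed
  qed
qed simp_all

text \<open>The threshold m serves the Clenshaw-Curtis formulas, which start at n = 2.\<close>

lemma error_order_of_positive:
  assumes "admissible w" "f \<in> V s"
    and Q: "\<And>n. n \<ge> m \<Longrightarrow> quadrature_formula n (Q n)" "\<And>n. n \<ge> m \<Longrightarrow> positive_quadrature (Q n)"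
      "\<And>n. n \<ge> m \<Longrightarrow> exact_to_degree w (n - 1) (Q n)"
  shows "error_order w Q f s"
proof (rule error_order_of_dominated[OF assms(1,2), of 1])
  show "\<forall>\<^sub>F n in sequentially. node_set (Q n) \<subseteq> {-1..1} \<and> exact_to_degree w (n - 1) (Q n) \<and> dominated 1 (n - 1) w (Q n)"
    using eventually_ge_at_top[of m]
  proof eventually_elim
    case (elim n)
    thus ?case using Q[OF elim] dominated_positive[of "Q n"] by (auto simp: quadrature_formula_def)
  qed
qed simp

lemma interpolatory_exact:
  "quadrature_formula n Q \<Longrightarrow> interpolatory w Q \<Longrightarrow> exact_to_degree w (n - 1) Q"
  by (simp add: interpolatory_def quadrature_formula_def)

theorem mainTheorem3:
  fixes s :: nat and f :: "real \<Rightarrow> real"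
  assumes "f \<in> V s"
  shows
    "(\<forall>w Q. admissible w \<longrightarrow>
        (\<forall>n\<ge>1. quadrature_formula n (Q n) \<and> positive_quadrature (Q n) \<and> interpolatory w (Q n)) \<longrightarrow>
        error_order w Q f s) \<and>
     (\<forall>w Q. admissible w \<longrightarrow> (\<forall>n\<ge>1. gauss_formula w n (Q n)) \<longrightarrow> error_order w Q f s) \<and>
     (\<forall>e\<in>{-1, 1}. \<forall>w Q. admissible w \<longrightarrow>
        (\<forall>n\<ge>1. radau_formula e w n (Q n)) \<longrightarrow> error_order w Q f s) \<and>
     (\<forall>Q. (\<forall>n\<ge>2. clenshaw_curtis_formula (\<lambda>_. 1) n (Q n)) \<longrightarrow> error_order (\<lambda>_. 1) Q f s) \<and>
     (\<forall>Q. (\<forall>n\<ge>1. filippi_formula (\<lambda>_. 1) n (Q n)) \<longrightarrow> error_order (\<lambda>_. 1) Q f s) \<and>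
     (\<forall>Q. (\<forall>n\<ge>1. polya_formula (\<lambda>_. 1) n (Q n)) \<longrightarrow> error_order (\<lambda>_. 1) Q f s) \<and>
     (\<forall>l Q. l \<in> {0..1} \<union> {3} \<longrightarrow>
        (\<forall>\<^sub>F n in sequentially. gauss_kronrod_formula (ultraspherical_weight l) n (Q n)) \<longrightarrow>
        error_order (ultraspherical_weight l) Q f s)"
proof (intro conjI allI ballI impI)
  fix w :: "real \<Rightarrow> real" and Q :: "nat \<Rightarrow> quadrature"
  assume w: "admissible w"
    and "\<forall>n\<ge>1. quadrature_formula n (Q n) \<and> positive_quadrature (Q n) \<and> interpolatory w (Q n)"
  thus "error_order w Q f s"
    by (intro error_order_of_positive[OF w assms, of 1] interpolatory_exact) auto
next
  fix w :: "real \<Rightarrow> real" and Q :: "nat \<Rightarrow> quadrature"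
  assume w: "admissible w" and Q: "\<forall>n\<ge>1. gauss_formula w n (Q n)"
  hence wf: "weight_function w" by (simp add: admissible_def)
  show "error_order w Q f s"
  proof (rule error_order_of_positive[OF w assms, of 1])
    fix n :: nat assume "n \<ge> 1"
    hence q: "quadrature_formula n (Q n)" "exact_to_degree w (2 * n - 1) (Q n)" using Q by (auto simp: gauss_formula_def)
    show "quadrature_formula n (Q n)" by fact
    show "positive_quadrature (Q n)"
      by (rule positive_of_exact[OF q(1) exact_to_degree_mono[OF q(2)] wf]) simp
    show "exact_to_degree w (n - 1) (Q n)" by (rule exact_to_degree_mono[OF q(2)]) simp
  qed
next
  fix e :: real and w :: "real \<Rightarrow> real" and Q :: "nat \<Rightarrow> quadrature"
  assume w: "admissible w" and Q: "\<forall>n\<ge>1. radau_formula e w n (Q n)"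
  hence wf: "weight_function w" by (simp add: admissible_def)
  show "error_order w Q f s"
  proof (rule error_order_of_positive[OF w assms, of 1])
    fix n :: nat assume "n \<ge> 1"
    hence q: "quadrature_formula n (Q n)" "exact_to_degree w (2 * n - 2) (Q n)" using Q by (auto simp: radau_formula_def)
    show "quadrature_formula n (Q n)" by fact
    show "positive_quadrature (Q n)" by (rule positive_of_exact[OF q wf])
    show "exact_to_degree w (n - 1) (Q n)" by (rule exact_to_degree_mono[OF q(2)]) simp
  qed
next
  fix Q :: "nat \<Rightarrow> quadrature"
  assume Q: "\<forall>n\<ge>2. clenshaw_curtis_formula (\<lambda>_. 1) n (Q n)"
  thus "error_order (\<lambda>_. 1) Q f s"
    by (intro error_order_of_positive[OF admissible_one assms, of 2] interpolatory_exact clenshaw_curtis_positive)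
       (auto simp: clenshaw_curtis_formula_def)
next
  fix Q :: "nat \<Rightarrow> quadrature"
  assume Q: "\<forall>n\<ge>1. filippi_formula (\<lambda>_. 1) n (Q n)"
  thus "error_order (\<lambda>_. 1) Q f s"
    by (intro error_order_of_positive[OF admissible_one assms, of 1] interpolatory_exact filippi_positive)
       (auto simp: filippi_formula_def)
next
  fix Q :: "nat \<Rightarrow> quadrature"
  assume Q: "\<forall>n\<ge>1. polya_formula (\<lambda>_. 1) n (Q n)"
  thus "error_order (\<lambda>_. 1) Q f s"
    by (intro error_order_of_positive[OF admissible_one assms, of 1] interpolatory_exact polya_positive)
       (auto simp: polya_formula_def)
next
  fix l :: real and Q :: "nat \<Rightarrow> quadrature"
  assume "l \<in> {0..1} \<union> {3}"
    and "\<forall>\<^sub>F n in sequentially. gauss_kronrod_formula (ultraspherical_weight l) n (Q n)"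
  thus "error_order (ultraspherical_weight l) Q f s"
    using error_order_kronrod_le_one[OF _ _ assms] error_order_kronrod_three[OF assms] by auto
qed

end
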